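(* Let $\varphi(z_1,z_2)=(\alpha_1z_1,\alpha_2z_2)$, where $\alpha_1,\alpha_2\in\mathbb{T}$ are both not roots of unity. Let $w\in\mathbb{A}^2$ and let $T:\mathbb{A}^2\to\mathbb{A}^2$ be the operator $(Tf)(z)=w(z)f(\varphi(z))$. (1) If $w$ is invertible in $\mathbb{A}^2$, then $\sigma(T)=\sigma_{sf}(T)=\{\lambda\in\mathbb{C}:\rho_{min}(T)\le|\lambda|\le\rho(T)\}$. (2) If $w$ is not invertible in $C(\mathbb{T}^2)$, then $\sigma(T)=\sigma_{sf}(T)=\rho(T)\mathbb{D}$. (3) If $w$ is invertible in $C(\mathbb{T}^2)$ but not invertible in $\mathbb{A}^2$, then $$\sigma_{a.p.}(T)=\sigma_{sf}(T)=\{\lambda\in\mathbb{C}:\rho_{min}(T,C(\mathbb{T}^2))\le|\lambda|\le\rho(T)\},\qquad \sigma(T)=\sigma_{lsf}(T)=\rho(T)\mathbb{D}.$$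
   Context: $\mathbb{D}$, $\mathbb{U}$ and $\mathbb{T}$ are the closed unit disc, the open unit disc and the unit circle in $\mathbb{C}$. For $c\in\mathbb{C}$ and $S\subseteq\mathbb{C}$, $cS=\{cs:s\in S\}$. $\mathbb{A}^2$ is the bidisc algebra: all functions continuous on $\mathbb{D}^2$ and analytic in $\mathbb{U}^2$, with the sup norm. Invertibility of $w$ in $C(\mathbb{T}^2)$ refers to the restriction of $w$ to $\mathbb{T}^2$. For a bounded linear operator $T$ on a Banach space $X$: $T$ is upper semi-Fredholm if its range is closed and $\dim\ker T<\infty$; lower semi-Fredholm if its range has finite codimension; semi-Fredholm if it is upper or lower semi-Fredholm. $\sigma(T)$ is the spectrum and $\rho(T)$ the spectral radius; $\rho_{min}(T)=1/\rho(T^{-1})$ if $T$ is invertible and $\rho_{min}(T)=0$ otherwise; $\rho_{min}(T,C(\mathbb{T}^2))$ is this quantity for the operator on $C(\mathbb{T}^2)$ given by the same formula $f\mapsto w\,(f\circ\varphi)$. $\sigma_{a.p.}(T)$ is the approximate point spectrum (the set of $\lambda$ for which there are $x_n\in X$, $\|x_n\|=1$, with $Tx_n-\lambda x_n\to0$); $\sigma_{sf}(T)$ and $\sigma_{lsf}(T)$ are the sets of $\lambda\in\mathbb{C}$ such that $\lambda I-T$ is not semi-Fredholm, respectively not lower semi-Fredholm. *)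

theory Defs
  imports "HOL-Complex_Analysis.Complex_Analysis"
begin

section \<open>Complex Banach spaces\<close>

class scaleC =
  fixes scaleC :: "complex \<Rightarrow> 'a \<Rightarrow> 'a"  (infixr \<open>*\<^sub>C\<close> 75)

class complex_normed_vector = real_normed_vector + scaleC +
  assumes scaleC_add_right: "a *\<^sub>C (x + y) = a *\<^sub>C x + a *\<^sub>C y"
    and scaleC_add_left: "(a + b) *\<^sub>C x = a *\<^sub>C x + b *\<^sub>C x"
    and scaleC_scaleC: "a *\<^sub>C b *\<^sub>C x = (a * b) *\<^sub>C x"
    and scaleC_one: "1 *\<^sub>C x = x"
    and scaleR_scaleC: "r *\<^sub>R x = complex_of_real r *\<^sub>C x"
    and norm_scaleC: "norm (a *\<^sub>C x) = cmod a * norm x"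

class complex_banach = complex_normed_vector + banach

global_interpretation complex_vector: vector_space "scaleC :: complex \<Rightarrow> 'a \<Rightarrow> 'a::complex_normed_vector"
  defines cspan = complex_vector.span
  by unfold_locales
    (auto simp: scaleC_add_right scaleC_add_left scaleC_scaleC scaleC_one)

instantiation complex :: complex_banach
begin

definition scaleC_complex :: "complex \<Rightarrow> complex \<Rightarrow> complex"
  where "scaleC_complex c x = c * x"

instance
  by standard (auto simp: scaleC_complex_def algebra_simps norm_mult scaleR_conv_of_real)

end

instance bcontfun :: (metric_space, banach) banach ..

lemma scaleC_diff_right: "a *\<^sub>C (x - y) = a *\<^sub>C x - a *\<^sub>C (y :: 'a::complex_normed_vector)"
  by (rule complex_vector.scale_right_diff_distrib)

lemma bcontfun_scaleC:
  fixes f :: "'a::topological_space \<Rightarrow> 'b::complex_normed_vector"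
  assumes "f \<in> bcontfun"
  shows "(\<lambda>x. c *\<^sub>C f x) \<in> bcontfun"
proof -
  have lin: "bounded_linear (\<lambda>x::'b. c *\<^sub>C x)"
    by (rule bounded_linear_intro[where K = "cmod c"])
      (auto simp: scaleC_add_right scaleR_scaleC scaleC_scaleC norm_scaleC mult.commute)
  show ?thesis
    using assms bounded_linear.continuous_on[OF lin]
      bounded_linear_image[OF _ lin, of "range f"]
    by (auto simp: bcontfun_def image_image)
qed

instantiation bcontfun :: (topological_space, complex_normed_vector) complex_normed_vector
begin

definition scaleC_bcontfun :: "complex \<Rightarrow> ('a \<Rightarrow>\<^sub>C 'b) \<Rightarrow> 'a \<Rightarrow>\<^sub>C 'b"
  where "scaleC_bcontfun c f = Bcontfun (\<lambda>x. c *\<^sub>C apply_bcontfun f x)"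

lemma apply_scaleC_bcontfun [simp]:
  "apply_bcontfun (c *\<^sub>C f) x = c *\<^sub>C apply_bcontfun (f :: 'a \<Rightarrow>\<^sub>C 'b) x"
  by (simp add: scaleC_bcontfun_def Bcontfun_inverse bcontfun_scaleC apply_bcontfun)

instance
proof
  fix a b :: complex and r :: real and f g :: "'a \<Rightarrow>\<^sub>C 'b"
  show "a *\<^sub>C (f + g) = a *\<^sub>C f + a *\<^sub>C g"
    by (rule bcontfun_eqI) (simp add: scaleC_add_right)
  show "(a + b) *\<^sub>C f = a *\<^sub>C f + b *\<^sub>C f"
    by (rule bcontfun_eqI) (simp add: scaleC_add_left)
  show "a *\<^sub>C b *\<^sub>C f = (a * b) *\<^sub>C f"
    by (rule bcontfun_eqI) (simp add: scaleC_scaleC)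
  show "1 *\<^sub>C f = f"
    by (rule bcontfun_eqI) (simp add: scaleC_one)
  show "r *\<^sub>R f = complex_of_real r *\<^sub>C f"
    by (rule bcontfun_eqI) (simp add: scaleR_scaleC)
  have le: "norm (c *\<^sub>C h) \<le> cmod c * norm h" for c and h :: "'a \<Rightarrow>\<^sub>C 'b"
    by (rule norm_bound) (simp add: norm_scaleC norm_bounded mult_left_mono)
  show "norm (a *\<^sub>C f) = cmod a * norm f"
  proof (rule antisym[OF le])
    show "cmod a * norm f \<le> norm (a *\<^sub>C f)"
    proof (cases "a = 0")
      case False
      have "f = inverse a *\<^sub>C a *\<^sub>C f"
        by (rule bcontfun_eqI) (simp add: scaleC_scaleC scaleC_one False)
      then have "norm f \<le> cmod (inverse a) * norm (a *\<^sub>C f)"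
        using le[of "inverse a" "a *\<^sub>C f"] by simp
      then show ?thesis
        using False by (simp add: norm_inverse norm_divide field_simps)
    qed simp
  qed
qed

end

instance bcontfun :: (metric_space, complex_banach) complex_banach ..


section \<open>Spectra and semi-Fredholm operators\<close>

definition bounded_clinear :: "('a::complex_normed_vector \<Rightarrow> 'b::complex_normed_vector) \<Rightarrow> bool"
  where "bounded_clinear T \<longleftrightarrow> bounded_linear T \<and> (\<forall>c x. T (c *\<^sub>C x) = c *\<^sub>C T x)"

definition invertible_op :: "('a::complex_banach \<Rightarrow> 'a) \<Rightarrow> bool"
  where "invertible_op T \<longleftrightarrow> (\<exists>S. bounded_clinear S \<and> S \<circ> T = id \<and> T \<circ> S = id)"

definition resolvent_op :: "complex \<Rightarrow> ('a::complex_banach \<Rightarrow> 'a) \<Rightarrow> 'a \<Rightarrow> 'a"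
  where "resolvent_op \<mu> T = (\<lambda>x. \<mu> *\<^sub>C x - T x)"

definition spectrum :: "('a::complex_banach \<Rightarrow> 'a) \<Rightarrow> complex set"
  where "spectrum T = {\<mu>. \<not> invertible_op (resolvent_op \<mu> T)}"

definition spectral_radius :: "('a::complex_banach \<Rightarrow> 'a) \<Rightarrow> real"
  where "spectral_radius T = (SUP \<mu>\<in>spectrum T. cmod \<mu>)"

definition min_spectral_radius :: "('a::complex_banach \<Rightarrow> 'a) \<Rightarrow> real"
  where "min_spectral_radius T =
    (if invertible_op T then 1 / spectral_radius (inv T) else 0)"

definition approx_point_spectrum :: "('a::complex_banach \<Rightarrow> 'a) \<Rightarrow> complex set"
  where "approx_point_spectrum T =
    {\<mu>. \<exists>x :: nat \<Rightarrow> 'a. (\<forall>n. norm (x n) = 1) \<and> (\<lambda>n. T (x n) - \<mu> *\<^sub>C x n) \<longlonglongrightarrow> 0}"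

definition upper_semi_Fredholm :: "('a::complex_banach \<Rightarrow> 'a) \<Rightarrow> bool"
  where "upper_semi_Fredholm T \<longleftrightarrow>
    closed (range T) \<and> (\<exists>B. finite B \<and> {x. T x = 0} \<subseteq> cspan B)"

definition lower_semi_Fredholm :: "('a::complex_banach \<Rightarrow> 'a) \<Rightarrow> bool"
  where "lower_semi_Fredholm T \<longleftrightarrow> (\<exists>B. finite B \<and> cspan (range T \<union> B) = UNIV)"

definition semi_Fredholm :: "('a::complex_banach \<Rightarrow> 'a) \<Rightarrow> bool"
  where "semi_Fredholm T \<longleftrightarrow> upper_semi_Fredholm T \<or> lower_semi_Fredholm T"

definition sf_spectrum :: "('a::complex_banach \<Rightarrow> 'a) \<Rightarrow> complex set"
  where "sf_spectrum T = {\<mu>. \<not> semi_Fredholm (resolvent_op \<mu> T)}"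

definition lsf_spectrum :: "('a::complex_banach \<Rightarrow> 'a) \<Rightarrow> complex set"
  where "lsf_spectrum T = {\<mu>. \<not> lower_semi_Fredholm (resolvent_op \<mu> T)}"


section \<open>The closed bidisc and the torus\<close>

typedef bidisc = "cball 0 1 \<times> cball 0 1 :: (complex \<times> complex) set"
  morphisms bidisc_pt Bidisc
  by (intro exI[of _ "(0, 0)"]) simp

typedef torus = "sphere 0 1 \<times> sphere 0 1 :: (complex \<times> complex) set"
  morphisms torus_pt Torus
  by (intro exI[of _ "(1, 1)"]) simp

instantiation bidisc :: metric_space
begin

definition dist_bidisc :: "bidisc \<Rightarrow> bidisc \<Rightarrow> real"
  where "dist_bidisc p q = dist (bidisc_pt p) (bidisc_pt q)"

definition uniformity_bidisc :: "(bidisc \<times> bidisc) filter"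
  where "uniformity_bidisc = (INF e\<in>{0 <..}. principal {(p, q). dist p q < e})"

definition open_bidisc :: "bidisc set \<Rightarrow> bool"
  where "open_bidisc S = (\<forall>p\<in>S. \<forall>\<^sub>F (p', q) in uniformity. p' = p \<longrightarrow> q \<in> S)"

instance
  by standard (auto simp: dist_bidisc_def uniformity_bidisc_def open_bidisc_def
      bidisc_pt_inject intro: dist_triangle2)

end

instantiation torus :: metric_space
begin

definition dist_torus :: "torus \<Rightarrow> torus \<Rightarrow> real"
  where "dist_torus p q = dist (torus_pt p) (torus_pt q)"

definition uniformity_torus :: "(torus \<times> torus) filter"
  where "uniformity_torus = (INF e\<in>{0 <..}. principal {(p, q). dist p q < e})"

definition open_torus :: "torus set \<Rightarrow> bool"
  where "open_torus S = (\<forall>p\<in>S. \<forall>\<^sub>F (p', q) in uniformity. p' = p \<longrightarrow> q \<in> S)"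

instance
  by standard (auto simp: dist_torus_def uniformity_torus_def open_torus_def
      torus_pt_inject intro: dist_triangle2)

end

lemma continuous_on_bidisc_pt: "continuous_on S bidisc_pt"
  unfolding continuous_on_iff dist_bidisc_def by blast

lemma continuous_on_torus_pt: "continuous_on S torus_pt"
  unfolding continuous_on_iff dist_torus_def by blast

lemma continuous_on_Bidisc: "continuous_on (cball 0 1 \<times> cball 0 1) Bidisc"
  unfolding continuous_on_iff dist_bidisc_def by (metis Bidisc_inverse)

lemma continuous_on_Torus: "continuous_on (sphere 0 1 \<times> sphere 0 1) Torus"
  unfolding continuous_on_iff dist_torus_def by (metis Torus_inverse)

lemma compact_UNIV_bidisc: "compact (UNIV :: bidisc set)"
proof -
  have "compact (Bidisc ` (cball 0 1 \<times> cball 0 1))"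
    by (intro compact_continuous_image continuous_on_Bidisc compact_Times compact_cball)
  also have "Bidisc ` (cball 0 1 \<times> cball 0 1) = UNIV"
    using Bidisc_cases by blast
  finally show ?thesis .
qed

lemma compact_UNIV_torus: "compact (UNIV :: torus set)"
proof -
  have "compact (Torus ` (sphere 0 1 \<times> sphere 0 1))"
    by (intro compact_continuous_image continuous_on_Torus compact_Times compact_sphere)
  also have "Torus ` (sphere 0 1 \<times> sphere 0 1) = UNIV"
    using Torus_cases by blast
  finally show ?thesis .
qed

definition torus_to_bidisc :: "torus \<Rightarrow> bidisc"
  where "torus_to_bidisc t = Bidisc (torus_pt t)"

definition rotation :: "complex \<Rightarrow> complex \<Rightarrow> complex \<times> complex \<Rightarrow> complex \<times> complex"
  where "rotation \<alpha>\<^sub>1 \<alpha>\<^sub>2 = (\<lambda>(z\<^sub>1, z\<^sub>2). (\<alpha>\<^sub>1 * z\<^sub>1, \<alpha>\<^sub>2 * z\<^sub>2))"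

text \<open>The next two maps are only meaningful when both factors are unimodular.\<close>

definition rotation_bidisc :: "complex \<Rightarrow> complex \<Rightarrow> bidisc \<Rightarrow> bidisc"
  where "rotation_bidisc \<alpha>\<^sub>1 \<alpha>\<^sub>2 p = Bidisc (rotation \<alpha>\<^sub>1 \<alpha>\<^sub>2 (bidisc_pt p))"

definition rotation_torus :: "complex \<Rightarrow> complex \<Rightarrow> torus \<Rightarrow> torus"
  where "rotation_torus \<alpha>\<^sub>1 \<alpha>\<^sub>2 p = Torus (rotation \<alpha>\<^sub>1 \<alpha>\<^sub>2 (torus_pt p))"

lemma torus_pt_norm: "cmod (fst (torus_pt t)) = 1" "cmod (snd (torus_pt t)) = 1"
  using torus_pt[of t] by auto

lemma bidisc_pt_norm: "cmod (fst (bidisc_pt p)) \<le> 1" "cmod (snd (bidisc_pt p)) \<le> 1"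
  using bidisc_pt[of p] by auto

lemma bidisc_pt_torus_to_bidisc [simp]: "bidisc_pt (torus_to_bidisc t) = torus_pt t"
  unfolding torus_to_bidisc_def by (rule Bidisc_inverse) (simp add: mem_Times_iff torus_pt_norm)

lemma bidisc_pt_rotation_bidisc:
  assumes "cmod \<alpha>\<^sub>1 = 1" "cmod \<alpha>\<^sub>2 = 1"
  shows "bidisc_pt (rotation_bidisc \<alpha>\<^sub>1 \<alpha>\<^sub>2 p) = rotation \<alpha>\<^sub>1 \<alpha>\<^sub>2 (bidisc_pt p)"
  unfolding rotation_bidisc_def
  by (rule Bidisc_inverse)
    (simp add: rotation_def split_beta norm_mult assms bidisc_pt_norm)

lemma torus_pt_rotation_torus:
  assumes "cmod \<alpha>\<^sub>1 = 1" "cmod \<alpha>\<^sub>2 = 1"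
  shows "torus_pt (rotation_torus \<alpha>\<^sub>1 \<alpha>\<^sub>2 p) = rotation \<alpha>\<^sub>1 \<alpha>\<^sub>2 (torus_pt p)"
  unfolding rotation_torus_def
  by (rule Torus_inverse)
    (simp add: rotation_def split_beta norm_mult assms torus_pt_norm)

lemma continuous_on_rotation: "continuous_on S (rotation \<alpha>\<^sub>1 \<alpha>\<^sub>2)"
  unfolding rotation_def split_beta by (intro continuous_intros)

lemma continuous_on_rotation_bidisc:
  assumes "cmod \<alpha>\<^sub>1 = 1" "cmod \<alpha>\<^sub>2 = 1"
  shows "continuous_on UNIV (rotation_bidisc \<alpha>\<^sub>1 \<alpha>\<^sub>2)"
proof -
  have "continuous_on UNIV (\<lambda>p. rotation \<alpha>\<^sub>1 \<alpha>\<^sub>2 (bidisc_pt p))"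
    by (rule continuous_on_compose2[OF continuous_on_rotation[of UNIV] continuous_on_bidisc_pt]) simp
  then show ?thesis
    unfolding continuous_on_iff dist_bidisc_def by (simp add: bidisc_pt_rotation_bidisc[OF assms])
qed

lemma continuous_on_rotation_torus:
  assumes "cmod \<alpha>\<^sub>1 = 1" "cmod \<alpha>\<^sub>2 = 1"
  shows "continuous_on UNIV (rotation_torus \<alpha>\<^sub>1 \<alpha>\<^sub>2)"
proof -
  have "continuous_on UNIV (\<lambda>p. rotation \<alpha>\<^sub>1 \<alpha>\<^sub>2 (torus_pt p))"
    by (rule continuous_on_compose2[OF continuous_on_rotation[of UNIV] continuous_on_torus_pt]) simp
  then show ?thesis
    unfolding continuous_on_iff dist_torus_def by (simp add: torus_pt_rotation_torus[OF assms])
qed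

lemma continuous_on_torus_to_bidisc: "continuous_on UNIV torus_to_bidisc"
  using continuous_on_torus_pt[of UNIV]
  unfolding continuous_on_iff dist_bidisc_def by simp


section \<open>Holomorphic functions of two variables\<close>

text \<open>Holomorphy is complex Frechet differentiability at every point, the two-variable
  analogue of the library's \<^const>\<open>holomorphic_on\<close> on open sets.\<close>

definition holomorphic2_on :: "(complex \<times> complex \<Rightarrow> complex) \<Rightarrow> (complex \<times> complex) set \<Rightarrow> bool"
  where "holomorphic2_on f S \<longleftrightarrow>
    (\<forall>z\<in>S. \<exists>a b. (f has_derivative (\<lambda>(h, k). a * h + b * k)) (at z))"

lemma holomorphic2_on_const: "holomorphic2_on (\<lambda>z. c) S"
  unfolding holomorphic2_on_def
  by (auto intro!: exI[of _ 0] derivative_eq_intros)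

lemma holomorphic2_on_add:
  assumes "holomorphic2_on f S" "holomorphic2_on g S"
  shows "holomorphic2_on (\<lambda>z. f z + g z) S"
  unfolding holomorphic2_on_def
proof
  fix z assume "z \<in> S"
  with assms obtain a b c d where
    "(f has_derivative (\<lambda>(h, k). a * h + b * k)) (at z)"
    "(g has_derivative (\<lambda>(h, k). c * h + d * k)) (at z)"
    unfolding holomorphic2_on_def by blast
  from has_derivative_add[OF this]
  have "((\<lambda>z. f z + g z) has_derivative (\<lambda>(h, k). (a + c) * h + (b + d) * k)) (at z)"
    by (rule has_derivative_eq_rhs) (auto simp: fun_eq_iff algebra_simps)
  then show "\<exists>a b. ((\<lambda>z. f z + g z) has_derivative (\<lambda>(h, k). a * h + b * k)) (at z)"
    by blast
qed

lemma holomorphic2_on_mult: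
  assumes "holomorphic2_on f S" "holomorphic2_on g S"
  shows "holomorphic2_on (\<lambda>z. f z * g z) S"
  unfolding holomorphic2_on_def
proof
  fix z assume "z \<in> S"
  with assms obtain a b c d where
    "(f has_derivative (\<lambda>(h, k). a * h + b * k)) (at z)"
    "(g has_derivative (\<lambda>(h, k). c * h + d * k)) (at z)"
    unfolding holomorphic2_on_def by blast
  from has_derivative_mult[OF this]
  have "((\<lambda>z. f z * g z) has_derivative
      (\<lambda>(h, k). (f z * c + a * g z) * h + (f z * d + b * g z) * k)) (at z)"
    by (rule has_derivative_eq_rhs) (auto simp: fun_eq_iff algebra_simps)
  then show "\<exists>a b. ((\<lambda>z. f z * g z) has_derivative (\<lambda>(h, k). a * h + b * k)) (at z)"
    by blast
qed

lemma holomorphic2_on_transform: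
  assumes f: "holomorphic2_on f S" and S: "open S" and eq: "\<And>z. z \<in> S \<Longrightarrow> f z = g z"
  shows "holomorphic2_on g S"
  unfolding holomorphic2_on_def
proof
  fix z assume z: "z \<in> S"
  with f obtain a b where "(f has_derivative (\<lambda>(h, k). a * h + b * k)) (at z)"
    unfolding holomorphic2_on_def by blast
  then have "(g has_derivative (\<lambda>(h, k). a * h + b * k)) (at z)"
    using S z eq by (rule has_derivative_transform_within_open)
  then show "\<exists>a b. (g has_derivative (\<lambda>(h, k). a * h + b * k)) (at z)"
    by blast
qed

lemma holomorphic2_on_rotation:
  assumes "holomorphic2_on f S" "rotation \<alpha>\<^sub>1 \<alpha>\<^sub>2 ` S \<subseteq> S"
  shows "holomorphic2_on (\<lambda>z. f (rotation \<alpha>\<^sub>1 \<alpha>\<^sub>2 z)) S"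
  unfolding holomorphic2_on_def
proof
  fix z assume "z \<in> S"
  then have "rotation \<alpha>\<^sub>1 \<alpha>\<^sub>2 z \<in> S"
    using assms(2) by blast
  with assms(1) obtain a b where
    f: "(f has_derivative (\<lambda>(h, k). a * h + b * k)) (at (rotation \<alpha>\<^sub>1 \<alpha>\<^sub>2 z))"
    unfolding holomorphic2_on_def by blast
  have "(rotation \<alpha>\<^sub>1 \<alpha>\<^sub>2 has_derivative rotation \<alpha>\<^sub>1 \<alpha>\<^sub>2) (at z)"
    unfolding rotation_def split_beta by (auto intro!: derivative_eq_intros)
  from has_derivative_compose[OF this f]
  have "((\<lambda>z. f (rotation \<alpha>\<^sub>1 \<alpha>\<^sub>2 z)) has_derivative
      (\<lambda>(h, k). (a * \<alpha>\<^sub>1) * h + (b * \<alpha>\<^sub>2) * k)) (at z)"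
    by (rule has_derivative_eq_rhs) (auto simp: fun_eq_iff rotation_def algebra_simps)
  then show "\<exists>a b. ((\<lambda>z. f (rotation \<alpha>\<^sub>1 \<alpha>\<^sub>2 z)) has_derivative (\<lambda>(h, k). a * h + b * k)) (at z)"
    by blast
qed

lemma holomorphic2_on_imp_holomorphic_on:
  assumes "holomorphic2_on f (A \<times> B)"
  shows "b \<in> B \<Longrightarrow> (\<lambda>x. f (x, b)) holomorphic_on A"
    and "a \<in> A \<Longrightarrow> (\<lambda>y. f (a, y)) holomorphic_on B"
proof -
  assume b: "b \<in> B"
  show "(\<lambda>x. f (x, b)) holomorphic_on A"
    unfolding holomorphic_on_def
  proof
    fix x assume "x \<in> A"
    with b assms obtain p q where
      f: "(f has_derivative (\<lambda>(h, k). p * h + q * k)) (at (x, b))"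
      unfolding holomorphic2_on_def by blast
    have g: "((\<lambda>x. (x, b)) has_derivative (\<lambda>h. (h, 0))) (at x)"
      by (auto intro!: derivative_eq_intros)
    have "((\<lambda>x. f (x, b)) has_field_derivative p) (at x)"
      using has_derivative_compose[OF g f] by (simp add: has_field_derivative_def)
    then show "(\<lambda>x. f (x, b)) field_differentiable at x within A"
      using field_differentiable_at_within field_differentiable_def by blast
  qed
next
  assume a: "a \<in> A"
  show "(\<lambda>y. f (a, y)) holomorphic_on B"
    unfolding holomorphic_on_def
  proof
    fix y assume "y \<in> B"
    with a assms obtain p q where
      f: "(f has_derivative (\<lambda>(h, k). p * h + q * k)) (at (a, y))"
      unfolding holomorphic2_on_def by blast
    have g: "((\<lambda>y. (a, y)) has_derivative (\<lambda>h. (0, h))) (at y)"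
      by (auto intro!: derivative_eq_intros)
    have "((\<lambda>y. f (a, y)) has_field_derivative q) (at y)"
      using has_derivative_compose[OF g f] by (simp add: has_field_derivative_def)
    then show "(\<lambda>y. f (a, y)) field_differentiable at y within B"
      using field_differentiable_at_within field_differentiable_def by blast
  qed
qed

lemma Osgood_bidisc:
  fixes f :: "complex \<times> complex \<Rightarrow> complex"
  assumes cont: "continuous_on (cball 0 1 \<times> cball 0 1) f"
    and hol1: "\<And>b. b \<in> ball 0 1 \<Longrightarrow> (\<lambda>x. f (x, b)) holomorphic_on ball 0 1"
    and hol2: "\<And>a. a \<in> ball 0 1 \<Longrightarrow> (\<lambda>y. f (a, y)) holomorphic_on ball 0 1"
  shows "holomorphic2_on f (ball 0 1 \<times> ball 0 1)"
  unfolding holomorphic2_on_def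
proof
  let ?U = "ball 0 1 :: complex set"
  fix z :: "complex \<times> complex" assume "z \<in> ?U \<times> ?U"
  then obtain x y where z: "z = (x, y)" and x: "x \<in> ?U" and y: "y \<in> ?U"
    by blast
  define D where "D a b = deriv (\<lambda>y. f (a, y)) b" for a b
  have D: "((\<lambda>y. f (a, y)) has_field_derivative D a b) (at b)" if "a \<in> ?U" "b \<in> ?U" for a b
    unfolding D_def using holomorphic_derivI[OF hol2 open_ball that(2)] that(1) by blast
  have D_cont: "((\<lambda>(a, b). D a b) \<longlongrightarrow> D x y) (at (x, y))"
  proof (rule tendstoI)
    fix e :: real assume e: "e > 0"
    obtain s where s: "s > 0" "ball y s \<subseteq> ?U"
      using y open_ball openE by blast
    define r where "r = s / 3"
    have r: "r > 0" "\<And>b c. dist y b < r \<Longrightarrow> dist b c \<le> r \<Longrightarrow> c \<in> ?U"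
    proof -
      show "r > 0" using s by (simp add: r_def)
      fix b c assume "dist y b < r" "dist b c \<le> r"
      then have "dist y c < s"
        using dist_triangle[of y c b] s(1) by (simp add: r_def)
      then show "c \<in> ?U" using s(2) by auto
    qed
    have "uniformly_continuous_on (cball 0 1 \<times> cball 0 1) f"
      by (intro compact_uniformly_continuous cont compact_Times compact_cball)
    then obtain d where d: "d > 0" "\<And>p q. p \<in> cball 0 1 \<times> cball 0 1 \<Longrightarrow>
        q \<in> cball 0 1 \<times> cball 0 1 \<Longrightarrow> dist p q < d \<Longrightarrow> dist (f p) (f q) < e * r / 4"
      unfolding uniformly_continuous_on_def using e r(1)
      by (metis divide_pos_pos mult_pos_pos zero_less_numeral)
    have "isCont (D x) y"
    proof -
      have "D x holomorphic_on ?U"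
        unfolding D_def[abs_def] by (intro holomorphic_deriv hol2 x open_ball)
      then show ?thesis
        using y continuous_on_eq_continuous_at holomorphic_on_imp_continuous_on open_ball by blast
    qed
    then obtain d' where d': "d' > 0" "\<And>b. dist b y < d' \<Longrightarrow> dist (D x b) (D x y) < e / 2"
      unfolding continuous_at_eps_delta using e by (metis half_gt_zero)
    have main: "dist (D a b) (D x y) < e"
      if a: "a \<in> ?U" and ax: "dist a x < d" and near: "dist b y < r" "dist b y < d'" for a b
    proof -
      have near': "dist y b < r"
        using near(1) by (simp add: dist_commute)
      have sub: "cball b r \<subseteq> ?U"
        using r(2)[OF near'] by (simp only: subset_iff mem_cball) blast
      then have bU: "b \<in> ?U"
        using r(1) by (meson centre_in_cball less_imp_le subsetD)
      let ?g = "\<lambda>c. f (a, c) - f (x, c)"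
      have holg: "?g holomorphic_on ?U"
        by (intro holomorphic_intros hol2 a x)
      have "cmod ((deriv ^^ 1) ?g b) \<le> fact 1 * (e * r / 4) / r ^ 1"
      proof (rule Cauchy_higher_deriv_bound)
        show "?g holomorphic_on ball b r"
          using holg sub ball_subset_cball holomorphic_on_subset by blast
        show "continuous_on (cball b r) ?g"
          using holg sub holomorphic_on_imp_continuous_on continuous_on_subset by blast
        show "?g w \<in> ball 0 (e * r / 4)" if "w \<in> ball b r" for w
        proof -
          have "w \<in> ?U" using that sub ball_subset_cball by blast
          then have "dist (f (a, w)) (f (x, w)) < e * r / 4"
            using a x ax by (intro d(2)) (auto simp: dist_prod_def)
          then show ?thesis by (simp add: dist_norm norm_minus_commute)
        qed
      qed (use r in auto)
      moreover have "deriv ?g b = D a b - D x b"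
        by (intro DERIV_imp_deriv DERIV_diff D a x bU)
      ultimately have "cmod (D a b - D x b) \<le> e / 4"
        using r(1) by simp
      moreover have "dist (D x b) (D x y) < e / 2"
        by (rule d'(2)[OF near(2)])
      ultimately show ?thesis
        using dist_triangle[of "D a b" "D x y" "D x b"] e by (simp add: dist_norm)
    qed
    obtain t where t: "t > 0" "ball x t \<subseteq> ?U"
      using x open_ball openE by blast
    let ?m = "min (min d t) (min r d')"
    have "?m > 0" using d d' r t by simp
    moreover have "dist (D a b) (D x y) < e" if "dist (a, b) (x, y) < ?m" for a b
    proof -
      have "dist a x < ?m" "dist b y < ?m"
        using that dist_fst_le[of "(a, b)" "(x, y)"] dist_snd_le[of "(a, b)" "(x, y)"] by auto
      moreover from this have "a \<in> ?U"
        by (intro subsetD[OF t(2)]) (simp add: dist_commute)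
      ultimately show ?thesis
        by (intro main) simp_all
    qed
    ultimately show "\<forall>\<^sub>F p in at (x, y). dist (case p of (a, b) \<Rightarrow> D a b) (D x y) < e"
      unfolding eventually_at by (intro exI[of _ ?m]) auto
  qed
  have "((\<lambda>(a, b). f (a, b)) has_derivative
      (\<lambda>(h, k). deriv (\<lambda>x. f (x, y)) x * h + blinfun_apply (blinfun_mult_right (D x y)) k))
      (at (x, y) within ?U \<times> ?U)"
  proof (rule has_derivative_partialsI)
    show "((\<lambda>x. f (x, y)) has_derivative (\<lambda>h. deriv (\<lambda>x. f (x, y)) x * h)) (at x within ?U)"
      using holomorphic_derivI[OF hol1[OF y] open_ball x]
      by (simp add: has_field_derivative_def has_derivative_at_withinI)
    show "((\<lambda>y. f (a, y)) has_derivative blinfun_apply (blinfun_mult_right (D a b))) (at b within ?U)"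
      if "a \<in> ?U" "b \<in> ?U" for a b
      using D[OF that] by (simp add: has_field_derivative_def has_derivative_at_withinI)
    have "((\<lambda>p. blinfun_mult_right (case p of (a, b) \<Rightarrow> D a b)) \<longlongrightarrow> blinfun_mult_right (D x y))
        (at (x, y) within ?U \<times> ?U)"
      by (rule bounded_linear.tendsto[OF bounded_linear_blinfun_mult_right])
        (rule tendsto_within_subset[OF D_cont], simp)
    then show "continuous (at (x, y) within ?U \<times> ?U) (\<lambda>(a, b). blinfun_mult_right (D a b))"
      by (simp add: continuous_within case_prod_unfold)
  qed (use y in auto)
  then have "(f has_derivative (\<lambda>(h, k). deriv (\<lambda>x. f (x, y)) x * h + D x y * k)) (at (x, y))"
    using x y at_within_open[of "(x, y)" "?U \<times> ?U"] by (simp add: open_Times)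
  then show "\<exists>a b. (f has_derivative (\<lambda>(h, k). a * h + b * k)) (at z)"
    unfolding z by blast
qed


section \<open>The bidisc algebra\<close>

text \<open>The closed bidisc is compact, so \<^typ>\<open>bidisc \<Rightarrow>\<^sub>C complex\<close> consists of all continuous
  functions on it.\<close>

typedef bidisc_algebra =
  "{f :: bidisc \<Rightarrow>\<^sub>C complex. holomorphic2_on (\<lambda>z. apply_bcontfun f (Bidisc z)) (ball 0 1 \<times> ball 0 1)}"
  morphisms bidisc_fun Bidisc_algebra
  by (rule exI[of _ 0]) (simp add: holomorphic2_on_const)

lemma holomorphic2_bidisc_fun:
  "holomorphic2_on (\<lambda>z. apply_bcontfun (bidisc_fun f) (Bidisc z)) (ball 0 1 \<times> ball 0 1)"
  using bidisc_fun[of f] by simp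

lemma holomorphic2_on_cmult:
  "holomorphic2_on f S \<Longrightarrow> holomorphic2_on (\<lambda>z. c * f z) S"
  by (intro holomorphic2_on_mult holomorphic2_on_const)

lemma holomorphic2_on_minus:
  "holomorphic2_on f S \<Longrightarrow> holomorphic2_on (\<lambda>z. - f z) S"
  using holomorphic2_on_cmult[of f S "-1"] by simp

lemma holomorphic2_on_diff:
  "holomorphic2_on f S \<Longrightarrow> holomorphic2_on g S \<Longrightarrow> holomorphic2_on (\<lambda>z. f z - g z) S"
  using holomorphic2_on_add[OF _ holomorphic2_on_minus, of f S g] by simp

setup_lifting type_definition_bidisc_algebra

instantiation bidisc_algebra :: complex_normed_vector
begin

lift_definition zero_bidisc_algebra :: bidisc_algebra is 0
  by (simp add: holomorphic2_on_const)

lift_definition plus_bidisc_algebra :: "bidisc_algebra \<Rightarrow> bidisc_algebra \<Rightarrow> bidisc_algebra" is "(+)"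
  by (simp add: holomorphic2_on_add)

lift_definition minus_bidisc_algebra :: "bidisc_algebra \<Rightarrow> bidisc_algebra \<Rightarrow> bidisc_algebra" is "(-)"
  by (simp add: holomorphic2_on_diff)

lift_definition uminus_bidisc_algebra :: "bidisc_algebra \<Rightarrow> bidisc_algebra" is uminus
  by (simp add: holomorphic2_on_minus)

lift_definition scaleC_bidisc_algebra :: "complex \<Rightarrow> bidisc_algebra \<Rightarrow> bidisc_algebra" is scaleC
  by (simp add: holomorphic2_on_cmult scaleC_complex_def)

lift_definition scaleR_bidisc_algebra :: "real \<Rightarrow> bidisc_algebra \<Rightarrow> bidisc_algebra" is scaleR
  by (simp add: holomorphic2_on_cmult scaleR_conv_of_real)

lift_definition norm_bidisc_algebra :: "bidisc_algebra \<Rightarrow> real" is norm .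

definition dist_bidisc_algebra :: "bidisc_algebra \<Rightarrow> bidisc_algebra \<Rightarrow> real"
  where "dist_bidisc_algebra f g = norm (f - g)"

definition sgn_bidisc_algebra :: "bidisc_algebra \<Rightarrow> bidisc_algebra"
  where "sgn_bidisc_algebra f = inverse (norm f) *\<^sub>R f"

definition uniformity_bidisc_algebra :: "(bidisc_algebra \<times> bidisc_algebra) filter"
  where "uniformity_bidisc_algebra = (INF e\<in>{0 <..}. principal {(f, g). dist f g < e})"

definition open_bidisc_algebra :: "bidisc_algebra set \<Rightarrow> bool"
  where "open_bidisc_algebra S = (\<forall>f\<in>S. \<forall>\<^sub>F (f', g) in uniformity. f' = f \<longrightarrow> g \<in> S)"

instance
proof
  fix f g h :: bidisc_algebra and r s :: real and a b :: complex
  show "f + g + h = f + (g + h)" by transfer (rule add.assoc)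
  show "f + g = g + f" by transfer (rule add.commute)
  show "0 + f = f" by transfer simp
  show "- f + f = 0" by transfer simp
  show "f - g = f + - g" by transfer simp
  show "r *\<^sub>R (f + g) = r *\<^sub>R f + r *\<^sub>R g" by transfer (rule scaleR_add_right)
  show "(r + s) *\<^sub>R f = r *\<^sub>R f + s *\<^sub>R f" by transfer (rule scaleR_add_left)
  show "r *\<^sub>R s *\<^sub>R f = (r * s) *\<^sub>R f" by transfer simp
  show "1 *\<^sub>R f = f" by transfer simp
  show "norm f = 0 \<longleftrightarrow> f = 0" by transfer simp
  show "norm (f + g) \<le> norm f + norm g" by transfer (rule norm_triangle_ineq)
  show "norm (r *\<^sub>R f) = \<bar>r\<bar> * norm f" by transfer simp
  show "a *\<^sub>C (f + g) = a *\<^sub>C f + a *\<^sub>C g" by transfer (rule scaleC_add_right)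
  show "(a + b) *\<^sub>C f = a *\<^sub>C f + b *\<^sub>C f" by transfer (rule scaleC_add_left)
  show "a *\<^sub>C b *\<^sub>C f = (a * b) *\<^sub>C f" by transfer (rule scaleC_scaleC)
  show "1 *\<^sub>C f = f" by transfer (rule scaleC_one)
  show "r *\<^sub>R f = complex_of_real r *\<^sub>C f" by transfer (rule scaleR_scaleC)
  show "norm (a *\<^sub>C f) = cmod a * norm f" by transfer (rule norm_scaleC)
qed (simp_all add: dist_bidisc_algebra_def sgn_bidisc_algebra_def
      uniformity_bidisc_algebra_def open_bidisc_algebra_def)

end

lemma closed_bidisc_algebra:
  "closed {f :: bidisc \<Rightarrow>\<^sub>C complex.
     holomorphic2_on (\<lambda>z. apply_bcontfun f (Bidisc z)) (ball 0 1 \<times> ball 0 1)}"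
  unfolding closed_sequential_limits
proof (intro allI impI, elim conjE, unfold mem_Collect_eq)
  fix f :: "nat \<Rightarrow> bidisc \<Rightarrow>\<^sub>C complex" and l
  assume f: "\<forall>n. holomorphic2_on (\<lambda>z. apply_bcontfun (f n) (Bidisc z)) (ball 0 1 \<times> ball 0 1)"
    and lim: "f \<longlonglongrightarrow> l"
  have unif: "uniform_limit S (\<lambda>n s. apply_bcontfun (f n) (g s)) (\<lambda>s. apply_bcontfun l (g s)) sequentially"
    for g :: "complex \<Rightarrow> bidisc" and S
    using tendsto_bcontfun_uniform_limit[OF lim] by (auto simp: uniform_limit_iff elim!: eventually_mono)
  show "holomorphic2_on (\<lambda>z. apply_bcontfun l (Bidisc z)) (ball 0 1 \<times> ball 0 1)"
  proof (rule Osgood_bidisc)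
    show "continuous_on (cball 0 1 \<times> cball 0 1) (\<lambda>z. apply_bcontfun l (Bidisc z))"
      by (rule continuous_on_compose2[OF _ continuous_on_Bidisc, of UNIV]) auto
    fix c :: complex assume c: "c \<in> ball 0 1"
    have ex: "\<exists>d>0. cball x d \<subseteq> ball 0 1 \<and> uniform_limit (cball x d)
        (\<lambda>n s. apply_bcontfun (f n) (g s)) (\<lambda>s. apply_bcontfun l (g s)) sequentially"
      if x: "x \<in> ball 0 1" for x :: complex and g
    proof -
      obtain d where "d > 0" "cball x d \<subseteq> ball 0 1"
        using x open_ball open_contains_cball by metis
      then show ?thesis using unif by blast
    qed
    show "(\<lambda>x. apply_bcontfun l (Bidisc (x, c))) holomorphic_on ball 0 1"
      by (rule holomorphic_uniform_sequence[OF open_ball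
            holomorphic2_on_imp_holomorphic_on(1)[OF f[rule_format] c] ex])
    show "(\<lambda>y. apply_bcontfun l (Bidisc (c, y))) holomorphic_on ball 0 1"
      by (rule holomorphic_uniform_sequence[OF open_ball
            holomorphic2_on_imp_holomorphic_on(2)[OF f[rule_format] c] ex])
  qed
qed

instance bidisc_algebra :: complex_banach
proof
  fix X :: "nat \<Rightarrow> bidisc_algebra"
  have dist: "dist f g = dist (bidisc_fun f) (bidisc_fun g)" for f g
    by (simp add: dist_norm norm_bidisc_algebra.rep_eq minus_bidisc_algebra.rep_eq)
  assume "Cauchy X"
  then have "Cauchy (\<lambda>n. bidisc_fun (X n))"
    by (simp add: Cauchy_def dist)
  then obtain l where l: "(\<lambda>n. bidisc_fun (X n)) \<longlonglongrightarrow> l"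
    using Cauchy_convergent_iff convergent_def by blast
  have "l \<in> {f. holomorphic2_on (\<lambda>z. apply_bcontfun f (Bidisc z)) (ball 0 1 \<times> ball 0 1)}"
    by (rule closed_sequentially[OF closed_bidisc_algebra _ l]) (rule bidisc_fun)
  then have "X \<longlonglongrightarrow> Bidisc_algebra l"
    using l by (simp add: lim_sequentially dist Bidisc_algebra_inverse)
  then show "convergent X"
    by (rule convergentI)
qed

lifting_update bidisc_algebra.lifting
lifting_forget bidisc_algebra.lifting


section \<open>Weighted rotation operators\<close>

definition weighted_comp :: "('a::topological_space \<Rightarrow>\<^sub>C complex) \<Rightarrow> ('a \<Rightarrow> 'a) \<Rightarrow>
    ('a \<Rightarrow>\<^sub>C complex) \<Rightarrow> 'a \<Rightarrow>\<^sub>C complex"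
  where "weighted_comp w \<phi> f = Bcontfun (\<lambda>x. apply_bcontfun w x * apply_bcontfun f (\<phi> x))"

definition weighted_rotation :: "complex \<Rightarrow> complex \<Rightarrow> bidisc_algebra \<Rightarrow> bidisc_algebra \<Rightarrow> bidisc_algebra"
  where "weighted_rotation \<alpha>\<^sub>1 \<alpha>\<^sub>2 w f =
    Bidisc_algebra (weighted_comp (bidisc_fun w) (rotation_bidisc \<alpha>\<^sub>1 \<alpha>\<^sub>2) (bidisc_fun f))"

definition restrict_torus :: "bidisc_algebra \<Rightarrow> torus \<Rightarrow>\<^sub>C complex"
  where "restrict_torus w = Bcontfun (\<lambda>t. apply_bcontfun (bidisc_fun w) (torus_to_bidisc t))"

definition weighted_rotation_torus :: "complex \<Rightarrow> complex \<Rightarrow> bidisc_algebra \<Rightarrow>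
    (torus \<Rightarrow>\<^sub>C complex) \<Rightarrow> torus \<Rightarrow>\<^sub>C complex"
  where "weighted_rotation_torus \<alpha>\<^sub>1 \<alpha>\<^sub>2 w =
    weighted_comp (restrict_torus w) (rotation_torus \<alpha>\<^sub>1 \<alpha>\<^sub>2)"

definition invertible_in_bidisc_algebra :: "bidisc_algebra \<Rightarrow> bool"
  where "invertible_in_bidisc_algebra w \<longleftrightarrow>
    (\<exists>u :: bidisc_algebra. \<forall>p. apply_bcontfun (bidisc_fun w) p * apply_bcontfun (bidisc_fun u) p = 1)"

definition invertible_in_C_torus :: "bidisc_algebra \<Rightarrow> bool"
  where "invertible_in_C_torus w \<longleftrightarrow>
    (\<exists>u :: torus \<Rightarrow>\<^sub>C complex. \<forall>t. apply_bcontfun (restrict_torus w) t * apply_bcontfun u t = 1)"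

lemma apply_weighted_comp:
  assumes "continuous_on UNIV \<phi>"
  shows "apply_bcontfun (weighted_comp w \<phi> f) x = apply_bcontfun w x * apply_bcontfun f (\<phi> x)"
proof -
  have "(\<lambda>x. apply_bcontfun w x * apply_bcontfun f (\<phi> x)) \<in> bcontfun"
  proof (rule bcontfun_normI)
    show "continuous_on UNIV (\<lambda>x. apply_bcontfun w x * apply_bcontfun f (\<phi> x))"
      by (intro continuous_intros continuous_on_compose2[OF _ assms, of UNIV]) auto
    show "cmod (apply_bcontfun w x * apply_bcontfun f (\<phi> x)) \<le> norm w * norm f" for x
      by (simp add: norm_mult mult_mono norm_bounded)
  qed
  then show ?thesis
    by (simp add: weighted_comp_def Bcontfun_inverse)
qed

lemma apply_weighted_rotation:
  assumes \<alpha>: "cmod \<alpha>\<^sub>1 = 1" "cmod \<alpha>\<^sub>2 = 1"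
  shows "apply_bcontfun (bidisc_fun (weighted_rotation \<alpha>\<^sub>1 \<alpha>\<^sub>2 w f)) p =
    apply_bcontfun (bidisc_fun w) p * apply_bcontfun (bidisc_fun f) (rotation_bidisc \<alpha>\<^sub>1 \<alpha>\<^sub>2 p)"
proof -
  let ?U = "ball 0 1 \<times> ball 0 1 :: (complex \<times> complex) set"
  let ?g = "weighted_comp (bidisc_fun w) (rotation_bidisc \<alpha>\<^sub>1 \<alpha>\<^sub>2) (bidisc_fun f)"
  note app = apply_weighted_comp[OF continuous_on_rotation_bidisc[OF \<alpha>]]
  have hol: "holomorphic2_on (\<lambda>z. apply_bcontfun (bidisc_fun w) (Bidisc z) *
      apply_bcontfun (bidisc_fun f) (Bidisc (rotation \<alpha>\<^sub>1 \<alpha>\<^sub>2 z))) ?U"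
    by (intro holomorphic2_on_mult holomorphic2_bidisc_fun holomorphic2_on_rotation
        [where f = "\<lambda>z. apply_bcontfun (bidisc_fun f) (Bidisc z)"])
      (auto simp: rotation_def norm_mult \<alpha>)
  have "apply_bcontfun (bidisc_fun w) (Bidisc z) *
      apply_bcontfun (bidisc_fun f) (Bidisc (rotation \<alpha>\<^sub>1 \<alpha>\<^sub>2 z)) =
      apply_bcontfun ?g (Bidisc z)" if "z \<in> ?U" for z
    using that by (auto simp: app rotation_bidisc_def Bidisc_inverse)
  then have "holomorphic2_on (\<lambda>z. apply_bcontfun ?g (Bidisc z)) ?U"
    by (rule holomorphic2_on_transform[OF hol open_Times[OF open_ball open_ball]])
  then show ?thesis
    by (simp add: weighted_rotation_def Bidisc_algebra_inverse app)
qed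

lemma apply_restrict_torus:
  "apply_bcontfun (restrict_torus w) t = apply_bcontfun (bidisc_fun w) (torus_to_bidisc t)"
proof -
  have "(\<lambda>t. apply_bcontfun (bidisc_fun w) (torus_to_bidisc t)) \<in> bcontfun"
    by (rule bcontfun_normI[OF continuous_on_compose2[OF _ continuous_on_torus_to_bidisc, of UNIV]
          norm_bounded]) auto
  then show ?thesis
    by (simp add: restrict_torus_def Bcontfun_inverse)
qed

lemma apply_weighted_rotation_torus:
  assumes "cmod \<alpha>\<^sub>1 = 1" "cmod \<alpha>\<^sub>2 = 1"
  shows "apply_bcontfun (weighted_rotation_torus \<alpha>\<^sub>1 \<alpha>\<^sub>2 w f) t =
    apply_bcontfun (restrict_torus w) t * apply_bcontfun f (rotation_torus \<alpha>\<^sub>1 \<alpha>\<^sub>2 t)"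
  unfolding weighted_rotation_torus_def
  by (rule apply_weighted_comp[OF continuous_on_rotation_torus[OF assms]])

end

theory Submission
  imports Defs
begin

text \<open>
  Write \<open>W\<close> for \<open>w\<close> as a function on the closed bidisc, \<open>\<phi>\<close> for the rotation, and
  \<open>P n t = \<bar>W t\<bar> \<cdot> \<bar>W (\<phi> t)\<bar> \<cdots> \<bar>W (\<phi>\<^sup>n\<^sup>-\<^sup>1 t)\<bar>\<close> for the cocycle on the torus. By the maximum principle the norm
  of the bidisc algebra is the supremum over the torus, so \<open>T\<^sup>n\<close> expands norms by at least \<open>min P n\<close>
  and at most \<open>max P n\<close>. Let \<open>R\<close> be the largest \<open>r\<close> with \<open>r\<^sup>n \<le> max P n\<close> for all \<open>n\<close>, and \<open>r\<^sub>0\<close> the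
  least \<open>r\<close> with \<open>min P n \<le> r\<^sup>n\<close> for all \<open>n\<close>. For \<open>\<bar>\<mu>\<bar> > R\<close> some power of \<open>T / \<mu>\<close> is a strict
  contraction and \<open>\<mu> - T\<close> is invertible. For \<open>\<bar>\<mu>\<bar> < r\<^sub>0\<close> some power of \<open>T / \<mu>\<close> is strictly expanding
  and \<open>\<mu> - T\<close> is bounded below; it is invertible as soon as \<open>T\<close> is.

  The annulus \<open>r\<^sub>0 \<le> \<bar>\<mu>\<bar> \<le> R\<close> consists of non-semi-Fredholm points. The key is a connectedness
  argument (\<open>rise_then_fall\<close>): for fixed \<open>n\<close> and slightly separated thresholds, the points whose orbit
  meets the set where \<open>P n\<close> is large and the points whose orbit meets the set where \<open>P n\<close> is small form
  two nonempty open sets that cover the connected torus, so one orbit meets both sets; since a rotation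
  returns arbitrarily close to the identity, the second visit can be placed after the first. Along this
  orbit the products of \<open>W / \<mu>\<close>, after a small perturbation of the factors, first grow and then decay
  by large factors. This yields a finitely supported sequence \<open>y\<close>, an orbit profile, with
  \<open>W q\<^sub>i \<cdot> y\<^sub>i \<approx> \<mu> \<cdot> y\<^sub>i\<^sub>+\<^sub>1\<close> along the orbit \<open>q\<^sub>i\<close> of a point (\<open>orbit_profile_exists\<close>).

  An orbit profile has two readings. As coefficients of point evaluations it gives a functional that
  almost annihilates the range of \<open>\<mu> - T\<close>; subtracting the same functional for a nearby orbit makes it
  weakly small, which is impossible if the range has finite codimension. For the inverse rotation, and
  read backwards, it gives coefficients of high powers of peak functions whose combination is almost in
  the kernel of \<open>\<mu> - T\<close>; as the power grows these elements tend to zero off a finite set, which is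
  impossible if the range is closed and the kernel finite-dimensional. Both impossibilities rest on
  the open mapping theorem and on compactness in finite-dimensional spaces.

  If \<open>W\<close> vanishes on the torus, then \<open>r\<^sub>0 = 0\<close> and the annulus is the disc of radius \<open>R\<close>. If \<open>W\<close> vanishes
  on the closed bidisc but not on the torus, then by Hurwitz's theorem it has infinitely many zeros, so
  the range of \<open>T\<close> has infinite codimension. On the disc \<open>\<bar>\<mu>\<bar> < r\<^sub>0\<close>, where \<open>\<mu> - T\<close> is bounded below,
  the codimension of the range is locally constant, hence infinite throughout
  (\<open>not_lower_semi_Fredholm_on_connected\<close>). Finally \<open>R\<close> is the spectral radius of \<open>T\<close>, and \<open>r\<^sub>0\<close> is the
  minimal spectral radius of the operator on the continuous functions on the torus, and of \<open>T\<close> itself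
  when \<open>w\<close> is invertible in the bidisc algebra.
\<close>

section \<open>Finite-dimensional subspaces and the open mapping theorem\<close>

lemma bounded_clinear_imp_bounded_linear: "bounded_clinear T \<Longrightarrow> bounded_linear T"
  by (simp add: bounded_clinear_def)

lemma bounded_clinear_scaleC: "bounded_clinear T \<Longrightarrow> T (c *\<^sub>C x) = c *\<^sub>C T x"
  by (simp add: bounded_clinear_def)

lemma bounded_linear_scaleC_right: "bounded_linear (\<lambda>x::'a::complex_normed_vector. c *\<^sub>C x)"
  by (rule bounded_linear_intro[where K = "cmod c"])
    (auto simp: scaleC_add_right scaleR_scaleC scaleC_scaleC norm_scaleC mult.commute)

lemma tendsto_scaleC_left:
  assumes "(f \<longlongrightarrow> l) F"
  shows "((\<lambda>x. f x *\<^sub>C (a::'a::complex_normed_vector)) \<longlongrightarrow> l *\<^sub>C a) F"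
proof -
  have "bounded_linear (\<lambda>c. c *\<^sub>C a)"
    by (rule bounded_linear_intro[where K = "norm a"])
      (auto simp: scaleC_add_left scaleR_scaleC scaleC_scaleC norm_scaleC scaleC_complex_def)
  from bounded_linear.tendsto[OF this assms] show ?thesis .
qed

lemma bounded_clinear_id: "bounded_clinear (\<lambda>x. x)"
  by (simp add: bounded_clinear_def)

lemma bounded_clinear_compose:
  "bounded_clinear S \<Longrightarrow> bounded_clinear T \<Longrightarrow> bounded_clinear (\<lambda>x. S (T x))"
  by (auto simp: bounded_clinear_def intro: bounded_linear_compose)

lemma bounded_clinear_funpow:
  fixes T :: "'a::complex_normed_vector \<Rightarrow> 'a"
  shows "bounded_clinear T \<Longrightarrow> bounded_clinear (T ^^ n)"
  by (induction n) (auto simp: o_def id_def intro: bounded_clinear_id bounded_clinear_compose)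

lemma bounded_clinear_resolvent_op:
  fixes T :: "'a::complex_banach \<Rightarrow> 'a"
  assumes T: "bounded_clinear T"
  shows "bounded_clinear (resolvent_op \<mu> T)"
  unfolding bounded_clinear_def resolvent_op_def
proof (intro conjI allI)
  show "bounded_linear (\<lambda>x. \<mu> *\<^sub>C x - T x)"
    by (rule bounded_linear_sub[OF bounded_linear_scaleC_right bounded_clinear_imp_bounded_linear[OF T]])
  show "\<mu> *\<^sub>C c *\<^sub>C x - T (c *\<^sub>C x) = c *\<^sub>C (\<mu> *\<^sub>C x - T x)" for c x
    by (simp add: bounded_clinear_scaleC[OF T] scaleC_diff_right scaleC_scaleC mult.commute)
qed

lemma csubspace_range:
  fixes S :: "'a::complex_normed_vector \<Rightarrow> 'b::complex_normed_vector"
  assumes S: "bounded_clinear S"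
  shows "complex_vector.subspace (range S)"
proof (unfold complex_vector.subspace_def, intro conjI ballI allI)
  interpret bounded_linear S using S by (rule bounded_clinear_imp_bounded_linear)
  show "0 \<in> range S" by (auto simp: zero image_iff intro!: exI[of _ 0])
  show "x + y \<in> range S" if "x \<in> range S" "y \<in> range S" for x y
    using that by (auto simp flip: add)
  show "c *\<^sub>C x \<in> range S" if "x \<in> range S" for c x
    using that by (auto simp flip: bounded_clinear_scaleC[OF S])
qed

text \<open>A convergent sequence in \<open>V\<close> is bounded, so a subsequence converges inside \<open>V\<close>, to the same limit.\<close>

lemma closed_if_bounded_sequences_subconverge:
  fixes V :: "'a::real_normed_vector set"
  assumes sub: "\<And>(x :: nat \<Rightarrow> 'a) M. (\<And>n. x n \<in> V) \<Longrightarrow> (\<And>n. norm (x n) \<le> M) \<Longrightarrow>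
    \<exists>l\<in>V. \<exists>r. strict_mono r \<and> (x \<circ> r) \<longlonglongrightarrow> l"
  shows "closed V"
  unfolding closed_sequential_limits
proof (intro allI impI, elim conjE)
  fix y :: "nat \<Rightarrow> 'a" and l assume y: "\<forall>n. y n \<in> V" and lim: "y \<longlonglongrightarrow> l"
  obtain M where "\<And>n. norm (y n) \<le> M"
    using convergent_imp_Bseq[OF convergentI[OF lim]] BseqE by blast
  from sub[of y M] y this obtain l' r where "l' \<in> V" "strict_mono r" "(y \<circ> r) \<longlonglongrightarrow> l'" by blast
  then show "l \<in> V"
    using LIMSEQ_subseq_LIMSEQ[OF lim] LIMSEQ_unique by metis
qed

text \<open>Induction on \<open>B\<close>: a new vector \<open>b\<close> outside the span \<open>V\<close> of the others has positive distance \<open>d\<close>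
  to the closed set \<open>V\<close>, and \<open>norm (v + c b) \<ge> \<bar>c\<bar> d\<close> keeps the coefficients of \<open>b\<close> in a bounded
  sequence bounded.\<close>

lemma bounded_cspan_finite_convergent_subsequence:
  fixes x :: "nat \<Rightarrow> 'a::complex_normed_vector"
  assumes "finite B" "\<And>n. x n \<in> cspan B" "\<And>n. norm (x n) \<le> M"
  shows "\<exists>l\<in>cspan B. \<exists>r. strict_mono r \<and> (x \<circ> r) \<longlonglongrightarrow> l"
  using assms
proof (induction B arbitrary: x M rule: finite_induct)
  case empty
  then have "x = (\<lambda>n. 0)" by auto
  then show ?case
    by (auto simp: o_def intro!: exI[of _ id] strict_mono_id)
next
  case (insert b B)
  show ?case
  proof (cases "b \<in> cspan B")
    case True
    then have "cspan (insert b B) = cspan B"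
      by (simp add: complex_vector.span_redundant)
    then show ?thesis using insert.IH[of x M] insert.prems by simp
  next
    case False
    have "closed (cspan B)"
      by (rule closed_if_bounded_sequences_subconverge) (use insert.IH in blast)
    then have d: "infdist b (cspan B) > 0"
      using False complex_vector.span_zero infdist_pos_not_in_closed by blast
    define d where "d = infdist b (cspan B)"
    obtain c where c: "\<And>n. x n - c n *\<^sub>C b \<in> cspan B"
      using insert.prems(1) unfolding complex_vector.span_breakdown_eq by metis
    have cb: "cmod (c n) * d \<le> norm (x n)" for n
    proof (cases "c n = 0")
      case False
      let ?u = "- ((1 / c n) *\<^sub>C (x n - c n *\<^sub>C b))"
      have "?u \<in> cspan B"
        by (intro complex_vector.span_neg complex_vector.span_scale c)
      then have "d \<le> dist b ?u" unfolding d_def by (rule infdist_le)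
      moreover have "b - ?u = (1 / c n) *\<^sub>C x n"
        using False by (simp add: scaleC_diff_right scaleC_scaleC scaleC_one)
      ultimately have "d \<le> cmod (1 / c n) * norm (x n)"
        by (simp add: dist_norm norm_scaleC)
      then show ?thesis using False by (simp add: norm_divide field_simps)
    qed simp
    have cM: "cmod (c n) \<le> M / d" for n
      using cb[of n] insert.prems(2)[of n] d by (simp add: d_def field_simps)
    then have "bounded (range c)" by (auto simp: bounded_iff)
    then obtain c0 r where r: "strict_mono r" "(c \<circ> r) \<longlonglongrightarrow> c0"
      using bounded_imp_convergent_subsequence by blast
    let ?v = "\<lambda>n. x (r n) - c (r n) *\<^sub>C b"
    have "norm (?v n) \<le> M + M / d * norm b" for n
    proof -
      have "norm (?v n) \<le> norm (x (r n)) + norm (c (r n) *\<^sub>C b)"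
        by (rule norm_triangle_ineq4)
      also have "\<dots> \<le> M + M / d * norm b"
        using insert.prems(2) cM by (intro add_mono) (auto simp: norm_scaleC simp del: times_divide_eq_left intro!: mult_right_mono)
      finally show ?thesis .
    qed
    with insert.IH[of ?v "M + M / d * norm b"] c obtain l r' where l: "l \<in> cspan B" "strict_mono r'" "(?v \<circ> r') \<longlonglongrightarrow> l"
      by blast
    have "(c \<circ> r \<circ> r') \<longlonglongrightarrow> c0"
      by (rule LIMSEQ_subseq_LIMSEQ[OF r(2) l(2)])
    then have "(\<lambda>n. (?v \<circ> r') n + (c \<circ> r \<circ> r') n *\<^sub>C b) \<longlonglongrightarrow> l + c0 *\<^sub>C b"
      by (intro tendsto_add l(3) tendsto_scaleC_left)
    then have "(x \<circ> (r \<circ> r')) \<longlonglongrightarrow> l + c0 *\<^sub>C b"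
      by (simp add: o_def)
    moreover have "l + c0 *\<^sub>C b \<in> cspan (insert b B)"
      using l(1) unfolding complex_vector.span_breakdown_eq by (intro exI[of _ c0]) simp
    ultimately show ?thesis
      using strict_mono_o[OF r(1) l(2)] by blast
  qed
qed

lemma closed_cspan_finite:
  fixes B :: "'a::complex_normed_vector set"
  assumes "finite B"
  shows "closed (cspan B)"
  by (rule closed_if_bounded_sequences_subconverge)
    (use bounded_cspan_finite_convergent_subsequence[OF assms] in blast)

text \<open>The usual iteration: solve approximately, then solve for the remainder, and sum the geometrically
  decreasing solutions. The corrections from the finite-dimensional space are controlled indirectly: their
  partial sums converge because all other terms do, and that space is closed. The approximate form of the hypothesis
  makes the conclusion stable under perturbations of \<open>S\<close>.\<close>

lemma solvable_if_approximately_solvable: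
  fixes S :: "'a::complex_banach \<Rightarrow> 'b::complex_banach"
  assumes S: "bounded_linear S" and B: "finite B" and K: "0 \<le> K" and q: "0 \<le> q" "q < 1"
    and approx: "\<And>y. y \<in> V \<Longrightarrow> \<exists>x b. b \<in> cspan B \<and> norm x \<le> K * norm y \<and>
      norm (y - S x - b) \<le> q * norm y \<and> y - S x - b \<in> V"
    and y: "y \<in> V"
  shows "\<exists>x b. b \<in> cspan B \<and> y = S x + b \<and> norm x \<le> K / (1 - q) * norm y"
proof -
  interpret S: bounded_linear S by (rule S)
  obtain X C where XC: "\<And>y. y \<in> V \<Longrightarrow> C y \<in> cspan B \<and> norm (X y) \<le> K * norm y \<and>
      norm (y - S (X y) - C y) \<le> q * norm y \<and> y - S (X y) - C y \<in> V"
    using approx by metis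
  define z where "z n = ((\<lambda>y. y - S (X y) - C y) ^^ n) y" for n
  have z_Suc: "z (Suc n) = z n - S (X (z n)) - C (z n)" for n by (simp add: z_def)
  have zV: "z n \<in> V" for n
  proof (induction n)
    case 0
    show ?case using y by (simp add: z_def)
  next
    case (Suc n)
    then show ?case using XC by (simp add: z_Suc)
  qed
  have zn: "norm (z n) \<le> q ^ n * norm y" for n
  proof (induction n)
    case (Suc n)
    have "norm (z (Suc n)) \<le> q * norm (z n)" using XC[OF zV] by (simp add: z_Suc)
    also have "\<dots> \<le> q * (q ^ n * norm y)" using Suc q by (intro mult_left_mono)
    finally show ?case by simp
  qed (simp add: z_def)
  have Xn: "norm (X (z n)) \<le> K * norm y * q ^ n" for n
  proof -
    have "norm (X (z n)) \<le> K * norm (z n)" using XC[OF zV] by blast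
    also have "\<dots> \<le> K * (q ^ n * norm y)" using zn K by (intro mult_left_mono)
    finally show ?thesis by (simp add: mult_ac)
  qed
  have sg: "summable (\<lambda>n. K * norm y * q ^ n)"
    using q by (intro summable_mult summable_geometric) simp
  have sX: "summable (\<lambda>n. X (z n))"
    by (rule summable_comparison_test'[OF sg]) (rule Xn)
  let ?x = "suminf (\<lambda>n. X (z n))"
  have eq: "(\<Sum>k<n. C (z k)) = y - z n - S (\<Sum>k<n. X (z k))" for n
  proof (induction n)
    case 0
    show ?case by (simp add: z_def S.zero)
  next
    case (Suc n)
    then show ?case by (simp add: z_Suc S.add)
  qed
  have "(\<lambda>n. y - z n - S (\<Sum>k<n. X (z k))) \<longlonglongrightarrow> y - 0 - S ?x"
  proof (intro tendsto_diff tendsto_const S.tendsto summable_LIMSEQ sX)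
    have "(\<lambda>n. q ^ n * norm y) \<longlonglongrightarrow> 0"
      using tendsto_mult_right[OF LIMSEQ_power_zero[of q], of "norm y"] q by simp
    then show "z \<longlonglongrightarrow> 0"
      by (rule Lim_null_comparison[rotated]) (simp add: zn)
  qed
  then have "y - 0 - S ?x \<in> cspan B"
  proof (rule closed_sequentially[OF closed_cspan_finite[OF B], rotated])
    show "y - z n - S (\<Sum>k<n. X (z k)) \<in> cspan B" for n
      unfolding eq[symmetric] using XC[OF zV] by (intro complex_vector.span_sum) blast
  qed
  moreover have "norm ?x \<le> (\<Sum>n. K * norm y * q ^ n)"
    by (rule norm_suminf_le[OF Xn sg])
  moreover have "(\<Sum>n. K * norm y * q ^ n) = K / (1 - q) * norm y"
  proof -
    have "(\<Sum>n. K * norm y * q ^ n) = K * norm y * (\<Sum>n. q ^ n)"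
      using q by (intro suminf_mult summable_geometric) simp
    then show ?thesis using q by (simp add: suminf_geometric)
  qed
  ultimately have "y - S ?x \<in> cspan B \<and> y = S ?x + (y - S ?x) \<and> norm ?x \<le> K / (1 - q) * norm y"
    by simp
  then show ?thesis by blast
qed

text \<open>Baire's theorem in \<open>V\<close>, applied to the closures of \<open>{S x + b | norm x \<le> n}\<close>: one of them contains a
  relative ball, and differences of its points give approximate solutions with a uniform bound.\<close>

lemma approximately_solvable_Baire:
  fixes S :: "'a::complex_banach \<Rightarrow> 'b::complex_banach"
  assumes S: "bounded_clinear S" and B: "finite B" and V: "closed V"
    and V_eq: "V = {S x + b | x b. b \<in> cspan B}"
  shows "\<exists>K\<ge>0. \<forall>y\<in>V. \<exists>x b. b \<in> cspan B \<and> norm x \<le> K * norm y \<and> norm (y - S x - b) \<le> 1 / 2 * norm y"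
proof -
  interpret S: bounded_linear S using S by (rule bounded_clinear_imp_bounded_linear)
  define E where "E n = {S x + b | x b. b \<in> cspan B \<and> norm x \<le> real n}" for n
  have EV: "closure (E n) \<subseteq> V" for n
    using V by (intro closure_minimal) (auto simp: E_def V_eq)
  have "V \<subseteq> (\<Union>n. closure (E n))"
  proof
    fix y assume "y \<in> V"
    then obtain x b where "y = S x + b" "b \<in> cspan B" by (auto simp: V_eq)
    moreover obtain n where "norm x \<le> real n" using real_arch_simple by blast
    ultimately have "y \<in> E n" by (auto simp: E_def)
    then show "y \<in> (\<Union>n. closure (E n))" using closure_subset by blast
  qed
  then have U: "(\<Union>n. closure (E n)) = V" using EV by blast
  have "0 \<in> V" unfolding V_eq using S.zero complex_vector.span_zero by (intro CollectI exI[of _ 0]) auto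
  have "\<exists>n. top_of_set V interior_of closure (E n) \<noteq> {}"
  proof (rule ccontr)
    assume no: "\<not> ?thesis"
    have "top_of_set V interior_of \<Union>(range (\<lambda>n. closure (E n))) = {}"
    proof (rule Baire_category_alt)
      show "completely_metrizable_space (top_of_set V) \<or>
          locally_compact_space (top_of_set V) \<and> regular_space (top_of_set V)"
        using V by (simp add: completely_metrizable_space_closedin completely_metrizable_space_euclidean
            flip: closed_closedin)
      show "closedin (top_of_set V) T \<and> top_of_set V interior_of T = {}"
        if "T \<in> range (\<lambda>n. closure (E n))" for T
        using that no closed_subset[OF EV closed_closure] by blast
    qed auto
    then have "top_of_set V interior_of V = {}" by (simp add: U)
    then show False using \<open>0 \<in> V\<close> interior_of_topspace[of "top_of_set V"] by simp
  qed
  then obtain n z where "z \<in> top_of_set V interior_of closure (E n)" by blast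
  then obtain W where W: "openin (top_of_set V) W" "z \<in> W" "W \<subseteq> closure (E n)"
    by (auto simp: interior_of_def)
  then obtain e where e: "e > 0" "ball z e \<inter> V \<subseteq> closure (E n)"
    by (metis openin_contains_ball subset_trans)
  have z: "z \<in> V" using W by (meson openin_imp_subset subsetD)
  have main: "\<exists>x b. b \<in> cspan B \<and> norm x \<le> (4 * n / e) * norm y \<and> norm (y - S x - b) \<le> 1 / 2 * norm y"
    if y: "y \<in> V" "y \<noteq> 0" for y
  proof -
    define t where "t = 2 * norm y / e"
    have t: "t > 0" using y e by (simp add: t_def)
    define z1 where "z1 = z + (1 / t) *\<^sub>R y"
    have "z1 \<in> V"
    proof -
      obtain x b where 1: "z = S x + b" "b \<in> cspan B" using z by (auto simp: V_eq)
      obtain x' b' where 2: "y = S x' + b'" "b' \<in> cspan B" using y by (auto simp: V_eq)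
      have "z1 = S (x + (1 / t) *\<^sub>R x') + (b + (1 / t) *\<^sub>R b')"
        by (simp add: z1_def 1 2 S.add S.scaleR scaleR_add_right)
      moreover have "b + (1 / t) *\<^sub>R b' \<in> cspan B"
        unfolding scaleR_scaleC by (intro complex_vector.span_add complex_vector.span_scale 1 2)
      ultimately show ?thesis unfolding V_eq by blast
    qed
    moreover have "dist z z1 < e"
      using y e by (simp add: z1_def dist_norm t_def)
    ultimately have z1: "z1 \<in> closure (E n)" using e by auto
    have "z \<in> closure (E n)" using e z by auto
    have e8: "e / 8 > 0" using e by simp
    obtain x b where 1: "b \<in> cspan B" "norm x \<le> n" "dist (S x + b) z < e / 8"
      using \<open>z \<in> closure (E n)\<close>[unfolded closure_approachable, rule_format, OF e8]
      by (auto simp: E_def)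
    obtain x' b' where 2: "b' \<in> cspan B" "norm x' \<le> n" "dist (S x' + b') z1 < e / 8"
      using z1[unfolded closure_approachable, rule_format, OF e8]
      by (auto simp: E_def)
    define x2 where "x2 = t *\<^sub>R (x' - x)"
    define b2 where "b2 = t *\<^sub>R (b' - b)"
    have "b2 \<in> cspan B" unfolding b2_def scaleR_scaleC
      by (intro complex_vector.span_diff complex_vector.span_scale 1 2)
    moreover have "norm x2 \<le> (4 * n / e) * norm y"
    proof -
      have "norm (x' - x) \<le> 2 * n" using norm_triangle_ineq4[of x' x] 1 2 by linarith
      then have "t * norm (x' - x) \<le> t * (2 * n)" using t by (intro mult_left_mono) auto
      then have "norm x2 \<le> t * (2 * n)" using t by (simp add: x2_def)
      then show ?thesis by (simp add: t_def mult_ac)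
    qed
    moreover have "norm (y - S x2 - b2) \<le> 1 / 2 * norm y"
    proof -
      have "y - S x2 - b2 = t *\<^sub>R ((z1 - (S x' + b')) - (z - (S x + b)))"
        using t by (simp add: x2_def b2_def z1_def S.scaleR S.diff algebra_simps)
      then have "norm (y - S x2 - b2) = t * norm ((z1 - (S x' + b')) - (z - (S x + b)))"
        using t by simp
      also have "\<dots> \<le> t * (e / 8 + e / 8)"
        using t 1(3) 2(3) norm_triangle_ineq4[of "z1 - (S x' + b')" "z - (S x + b)"]
        by (intro mult_left_mono) (auto simp: dist_norm norm_minus_commute)
      finally show ?thesis using e by (simp add: t_def)
    qed
    ultimately show ?thesis by blast
  qed
  show ?thesis
  proof (intro exI[of _ "4 * n / e"] conjI ballI)
    fix y assume "y \<in> V"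
    then show "\<exists>x b. b \<in> cspan B \<and> norm x \<le> (4 * n / e) * norm y \<and> norm (y - S x - b) \<le> 1 / 2 * norm y"
      using main[of y] S.zero complex_vector.span_zero
      by (cases "y = 0") (auto intro!: exI[of _ 0])
  qed (use e in auto)
qed

lemma bounded_solution_mod_finite:
  fixes S :: "'a::complex_banach \<Rightarrow> 'b::complex_banach"
  assumes S: "bounded_clinear S" and B: "finite B" and V: "closed V"
    and V_eq: "V = {S x + b | x b. b \<in> cspan B}"
  shows "\<exists>K\<ge>0. \<forall>y\<in>V. \<exists>x b. b \<in> cspan B \<and> y = S x + b \<and> norm x \<le> K * norm y"
proof -
  interpret S: bounded_linear S using S by (rule bounded_clinear_imp_bounded_linear)
  obtain K where K: "K \<ge> 0" "\<And>y. y \<in> V \<Longrightarrow> \<exists>x b. b \<in> cspan B \<and> norm x \<le> K * norm y \<and>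
      norm (y - S x - b) \<le> 1 / 2 * norm y"
    using approximately_solvable_Baire[OF assms] by blast
  have sub: "y - S x - b \<in> V" if yV: "y \<in> V" and b: "b \<in> cspan B" for y x b
  proof -
    obtain x' b' where "y = S x' + b'" "b' \<in> cspan B" using yV unfolding V_eq by blast
    then have "y - S x - b = S (x' - x) + (b' - b)" "b' - b \<in> cspan B"
      using b by (auto simp: S.diff intro: complex_vector.span_diff)
    then show ?thesis unfolding V_eq by blast
  qed
  show ?thesis
  proof (intro exI[of _ "K / (1 - 1/2)"] conjI ballI)
    fix y assume y: "y \<in> V"
    show "\<exists>x b. b \<in> cspan B \<and> y = S x + b \<and> norm x \<le> K / (1 - 1/2) * norm y"
    proof (rule solvable_if_approximately_solvable[OF _ B K(1), where V = V])
      fix y assume "y \<in> V"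
      then show "\<exists>x b. b \<in> cspan B \<and> norm x \<le> K * norm y \<and>
          norm (y - S x - b) \<le> 1 / 2 * norm y \<and> y - S x - b \<in> V"
        using K(2) sub by blast
    qed (use y S.bounded_linear_axioms in simp_all)
  qed (use K(1) in simp)
qed

lemma upper_semi_Fredholm_imp_bounded_solution:
  fixes S :: "'a::complex_banach \<Rightarrow> 'a"
  assumes S: "bounded_clinear S" and "upper_semi_Fredholm S"
  shows "\<exists>K\<ge>0. \<forall>y. \<exists>x. S x = S y \<and> norm x \<le> K * norm (S y)"
proof -
  have "closed (range S)" using assms(2) by (simp add: upper_semi_Fredholm_def)
  moreover have "range S = {S x + b |x b. b \<in> cspan {}}" by auto
  ultimately obtain K where K: "K \<ge> 0"
      "\<forall>y\<in>range S. \<exists>x b. b \<in> cspan {} \<and> y = S x + b \<and> norm x \<le> K * norm y"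
    using bounded_solution_mod_finite[OF S finite.emptyI] by blast
  have "\<exists>x. S x = S y \<and> norm x \<le> K * norm (S y)" for y
  proof -
    obtain x b where "b \<in> cspan {}" "S y = S x + b" "norm x \<le> K * norm (S y)"
      using K(2) by blast
    then show ?thesis by (intro exI[of _ x]) simp
  qed
  with K(1) show ?thesis by blast
qed

lemma cspan_range_Un_eq_UNIV_iff:
  fixes S :: "'a::complex_normed_vector \<Rightarrow> 'a"
  assumes S: "bounded_clinear S"
  shows "cspan (range S \<union> B) = UNIV \<longleftrightarrow> (\<forall>y. \<exists>x b. b \<in> cspan B \<and> y = S x + b)"
proof -
  have "cspan (range S) = range S"
    using csubspace_range[OF S] complex_vector.span_eq_iff by blast
  then have "cspan (range S \<union> B) = {x + y |x y. x \<in> range S \<and> y \<in> cspan B}"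
    by (simp only: complex_vector.span_Un)
  also have "\<dots> = {S x + b |x b. b \<in> cspan B}" by blast
  finally have "cspan (range S \<union> B) = {S x + b |x b. b \<in> cspan B}" .
  then have "y \<in> cspan (range S \<union> B) \<longleftrightarrow> (\<exists>x b. b \<in> cspan B \<and> y = S x + b)" for y
    by auto
  then show ?thesis by blast
qed

lemma cspan_range_Un_imp_bounded_solution:
  fixes S :: "'a::complex_banach \<Rightarrow> 'a"
  assumes S: "bounded_clinear S" and B: "finite B" and span: "cspan (range S \<union> B) = UNIV"
  shows "\<exists>K\<ge>0. \<forall>y. \<exists>x b. b \<in> cspan B \<and> y = S x + b \<and> norm x \<le> K * norm y"
proof -
  have "UNIV = {S x + b |x b. b \<in> cspan B}"
    using span unfolding cspan_range_Un_eq_UNIV_iff[OF S] by blast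
  from bounded_solution_mod_finite[OF S B closed_UNIV this] show ?thesis by simp
qed


section \<open>Excluding semi-Fredholm operators by weakly null sequences\<close>

text \<open>If the range is closed and the kernel \<open>N\<close> finite-dimensional, elements with small image are close to
  \<open>N\<close>, so a subsequence of the \<open>x n\<close> stays close to one element \<open>l\<close> of \<open>N\<close>. The condition on such \<open>l\<close> is a
  quantitative substitute for weak convergence to zero: it makes \<open>l\<close>, and hence \<open>x n\<close>, too small.\<close>

lemma not_upper_semi_Fredholm_if_singular_sequence:
  fixes S :: "'a::complex_banach \<Rightarrow> 'a"
  assumes S: "bounded_clinear S"
    and sing: "\<And>\<epsilon>. \<epsilon> > 0 \<Longrightarrow> \<exists>(x :: nat \<Rightarrow> 'a) M. (\<forall>n. 1 \<le> norm (x n) \<and> norm (x n) \<le> M \<and> norm (S (x n)) \<le> \<epsilon>)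
      \<and> (\<forall>l. (\<exists>\<^sub>F n in sequentially. norm (x n - l) \<le> 1 / 4) \<longrightarrow> norm l \<le> 1 / 2)"
  shows "\<not> upper_semi_Fredholm S"
proof
  assume up: "upper_semi_Fredholm S"
  interpret S: bounded_linear S using S by (rule bounded_clinear_imp_bounded_linear)
  obtain K where K: "K \<ge> 0" "\<And>y. \<exists>x. S x = S y \<and> norm x \<le> K * norm (S y)"
    using upper_semi_Fredholm_imp_bounded_solution[OF S up] by blast
  obtain B where B: "finite B" "{x. S x = 0} \<subseteq> cspan B"
    using up by (auto simp: upper_semi_Fredholm_def)
  define \<epsilon> where "\<epsilon> = 1 / (8 * (K + 1))"
  have \<epsilon>: "\<epsilon> > 0" "K * \<epsilon> \<le> 1 / 8" using K(1) by (auto simp: \<epsilon>_def field_simps)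
  from sing[OF \<epsilon>(1)] obtain x M where
    xM: "\<forall>n. 1 \<le> norm (x n) \<and> norm (x n) \<le> M \<and> norm (S (x n)) \<le> \<epsilon>"
    and l: "\<forall>l. (\<exists>\<^sub>F n in sequentially. norm (x n - l) \<le> 1 / 4) \<longrightarrow> norm l \<le> 1 / 2"
    by (elim exE conjE)
  have x: "1 \<le> norm (x n)" "norm (x n) \<le> M" "norm (S (x n)) \<le> \<epsilon>" for n
    using xM by auto
  have "\<forall>n. \<exists>z. S z = S (x n) \<and> norm z \<le> K * norm (S (x n))" using K(2) by blast
  then obtain z where "\<forall>n. S (z n) = S (x n) \<and> norm (z n) \<le> K * norm (S (x n))"
    by (rule choice[THEN exE])
  then have z: "S (z n) = S (x n)" "norm (z n) \<le> K * norm (S (x n))" for n by auto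
  have zn: "norm (z n) \<le> 1 / 8" for n
    using z(2)[of n] mult_left_mono[OF x(3)[of n] K(1)] \<epsilon>(2) by linarith
  have "\<exists>l\<in>cspan B. \<exists>r. strict_mono r \<and> ((\<lambda>n. x n - z n) \<circ> r) \<longlonglongrightarrow> l"
  proof (rule bounded_cspan_finite_convergent_subsequence[OF B(1)])
    show "x n - z n \<in> cspan B" for n using B(2) z(1) by (auto simp: S.diff)
    show "norm (x n - z n) \<le> M + 1 / 8" for n
      using norm_triangle_ineq4[of "x n" "z n"] x(2)[of n] zn[of n] by linarith
  qed
  then obtain l0 r where r: "strict_mono r" "(\<lambda>n. x (r n) - z (r n)) \<longlonglongrightarrow> l0"
    by (auto simp: o_def)
  have "\<forall>\<^sub>F n in sequentially. norm (x (r n) - z (r n) - l0) < 1 / 8"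
    using r(2)[unfolded tendsto_iff dist_norm] by (elim allE[of _ "1/8"]) simp
  then have ev: "\<forall>\<^sub>F n in sequentially. norm (x (r n) - l0) \<le> 1 / 4"
  proof eventually_elim
    case (elim n)
    then show ?case
      using norm_triangle_ineq[of "x (r n) - z (r n) - l0" "z (r n)"] zn[of "r n"] by simp
  qed
  then have fr: "\<exists>\<^sub>F n in sequentially. norm (x n - l0) \<le> 1 / 4"
  proof -
    obtain N where N: "\<And>n. n \<ge> N \<Longrightarrow> norm (x (r n) - l0) \<le> 1 / 4"
      using ev by (auto simp: eventually_sequentially)
    show ?thesis unfolding frequently_sequentially
    proof
      fix m
      have "r (max N m) \<ge> m" using seq_suble[OF r(1), of "max N m"] by simp
      then show "\<exists>n\<ge>m. norm (x n - l0) \<le> 1 / 4" using N[of "max N m"] by auto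
    qed
  qed
  then obtain n where "norm (x n - l0) \<le> 1 / 4" using frequently_ex by blast
  then show False
    using l[rule_format, OF fr] x(1)[of n] norm_triangle_sub[of "x n" l0] by linarith
qed

text \<open>If finitely many vectors \<open>B\<close> span a complement of the range, write \<open>g m = S (x m) + b m\<close> with bounded
  \<open>x m\<close>. The functionals are small on the first summand, and on the bounded second summand they tend to zero,
  because there pointwise convergence is uniform by compactness.\<close>

lemma not_lower_semi_Fredholm_if_weakly_null_functionals:
  fixes S :: "'a::complex_banach \<Rightarrow> 'a"
  assumes S: "bounded_clinear S"
    and sing: "\<And>\<epsilon>. \<epsilon> > 0 \<Longrightarrow> \<exists>(\<Lambda> :: nat \<Rightarrow> 'a \<Rightarrow> complex) C g.
      (\<forall>m x y. \<Lambda> m (x + y) = \<Lambda> m x + \<Lambda> m y) \<and> (\<forall>m x. cmod (\<Lambda> m x) \<le> C * norm x) \<and>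
      (\<forall>x. (\<lambda>m. \<Lambda> m x) \<longlonglongrightarrow> 0) \<and> (\<forall>m x. cmod (\<Lambda> m (S x)) \<le> \<epsilon> * norm x) \<and>
      (\<forall>m. norm (g m) \<le> 1 \<and> 1 \<le> cmod (\<Lambda> m (g m)))"
  shows "\<not> lower_semi_Fredholm S"
proof
  interpret S: bounded_linear S using S by (rule bounded_clinear_imp_bounded_linear)
  assume "lower_semi_Fredholm S"
  then obtain B where B: "finite B" "cspan (range S \<union> B) = UNIV"
    by (auto simp: lower_semi_Fredholm_def)
  obtain K where K: "K \<ge> 0" "\<And>y. \<exists>x b. b \<in> cspan B \<and> y = S x + b \<and> norm x \<le> K * norm y"
    using cspan_range_Un_imp_bounded_solution[OF S B] by blast
  define \<epsilon> where "\<epsilon> = 1 / (2 * (K + 1))"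
  have \<epsilon>: "\<epsilon> > 0" "\<epsilon> * K \<le> 1 / 2" using K(1) by (auto simp: \<epsilon>_def field_simps)
  from sing[OF \<epsilon>(1)] obtain \<Lambda> :: "nat \<Rightarrow> 'a \<Rightarrow> complex" and C g where
    add: "\<forall>m x y. \<Lambda> m (x + y) = \<Lambda> m x + \<Lambda> m y" and C: "\<forall>m x. cmod (\<Lambda> m x) \<le> C * norm x" and
    lim: "\<forall>x. (\<lambda>m. \<Lambda> m x) \<longlonglongrightarrow> 0" and small: "\<forall>m x. cmod (\<Lambda> m (S x)) \<le> \<epsilon> * norm x" and
    g: "\<forall>m. norm (g m) \<le> 1 \<and> 1 \<le> cmod (\<Lambda> m (g m))"
    by (elim exE conjE)
  note add = add[rule_format] and C = C[rule_format] and lim = lim[rule_format]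
    and small = small[rule_format]
  have g: "norm (g m) \<le> 1" "1 \<le> cmod (\<Lambda> m (g m))" for m using g by auto
  have "\<forall>m. \<exists>x. g m - S x \<in> cspan B \<and> norm x \<le> K * norm (g m)"
  proof
    fix m
    obtain x b where "b \<in> cspan B" "g m = S x + b" "norm x \<le> K * norm (g m)"
      using K(2)[of "g m"] by blast
    then show "\<exists>x. g m - S x \<in> cspan B \<and> norm x \<le> K * norm (g m)"
      by (intro exI[of _ x]) simp
  qed
  then obtain x where x: "\<forall>m. g m - S (x m) \<in> cspan B \<and> norm (x m) \<le> K * norm (g m)"
    by (rule choice[THEN exE])
  define b where "b m = g m - S (x m)" for m
  have xb: "b m \<in> cspan B" "g m = S (x m) + b m" "norm (x m) \<le> K * norm (g m)" for m
    using x by (auto simp: b_def)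
  have xn: "norm (x m) \<le> K" for m
    using xb(3)[of m] mult_left_mono[OF g(1)[of m] K(1)] by simp
  have lb: "1 / 2 \<le> cmod (\<Lambda> m (b m))" for m
  proof -
    have "1 \<le> cmod (\<Lambda> m (S (x m))) + cmod (\<Lambda> m (b m))"
      using g(2)[of m] unfolding xb(2)[of m] add using norm_triangle_ineq order_trans by blast
    moreover have "cmod (\<Lambda> m (S (x m))) \<le> \<epsilon> * K"
      using small[of m "x m"] mult_left_mono[OF xn[of m] less_imp_le[OF \<epsilon>(1)]] by linarith
    ultimately show ?thesis using \<epsilon>(2) by linarith
  qed
  obtain N where N: "\<And>x. norm (S x) \<le> norm x * N" using S.nonneg_bounded by blast
  have N0: "norm (S (x m)) \<le> K * \<bar>N\<bar>" for m
    using N[of "x m"] mult_mono[OF xn[of m] abs_ge_self[of N]] K(1)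
      mult_left_mono[OF abs_ge_self[of N] norm_ge_zero[of "x m"]]
      mult_right_mono[OF xn[of m] abs_ge_zero[of N]] by linarith
  have bn: "norm (b m) \<le> 1 + K * \<bar>N\<bar>" for m
  proof -
    have "b m = g m - S (x m)" by (simp add: xb(2))
    then have "norm (b m) \<le> norm (g m) + norm (S (x m))" by (simp add: norm_triangle_ineq4)
    then show ?thesis using g(1)[of m] N0[of m] by linarith
  qed
  obtain b0 r where r: "strict_mono r" "(\<lambda>n. b (r n)) \<longlonglongrightarrow> b0"
    using bounded_cspan_finite_convergent_subsequence[OF B(1), of b, OF xb(1) bn]
    by (auto simp: o_def)
  have "(\<lambda>n. \<Lambda> (r n) (b (r n))) \<longlonglongrightarrow> 0"
  proof (rule Lim_null_comparison)
    show "\<forall>\<^sub>F n in sequentially. cmod (\<Lambda> (r n) (b (r n))) \<le>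
        cmod (\<Lambda> (r n) b0) + C * norm (b (r n) - b0)"
    proof (intro always_eventually allI)
      fix n
      have "\<Lambda> (r n) (b (r n)) = \<Lambda> (r n) b0 + \<Lambda> (r n) (b (r n) - b0)"
        by (simp flip: add)
      then show "cmod (\<Lambda> (r n) (b (r n))) \<le> cmod (\<Lambda> (r n) b0) + C * norm (b (r n) - b0)"
        using C[of "r n" "b (r n) - b0"] norm_triangle_ineq[of "\<Lambda> (r n) b0" "\<Lambda> (r n) (b (r n) - b0)"]
        by simp
    qed
    have "(\<lambda>n. \<Lambda> (r n) b0) \<longlonglongrightarrow> 0"
      using LIMSEQ_subseq_LIMSEQ[OF lim r(1), of b0] by (simp add: o_def)
    moreover have "(\<lambda>n. norm (b (r n) - b0)) \<longlonglongrightarrow> 0"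
      using tendsto_norm_zero[OF LIM_zero[OF r(2)]] .
    ultimately show "(\<lambda>n. cmod (\<Lambda> (r n) b0) + C * norm (b (r n) - b0)) \<longlonglongrightarrow> 0"
      using tendsto_add[OF tendsto_norm_zero tendsto_mult_right_zero] by fastforce
  qed
  then have "\<forall>\<^sub>F n in sequentially. cmod (\<Lambda> (r n) (b (r n))) < 1 / 2"
    unfolding tendsto_iff by (elim allE[of _ "1 / 2"]) simp
  then obtain n where "cmod (\<Lambda> (r n) (b (r n))) < 1 / 2" by (auto simp: eventually_sequentially)
  then show False using lb[of "r n"] by simp
qed


section \<open>Bounded inverses, powers and spectra\<close>

lemma invertible_opI:
  fixes T :: "'a::complex_banach \<Rightarrow> 'a"
  assumes T: "bounded_clinear T" and c: "c > 0" and low: "\<And>x. c * norm x \<le> norm (T x)" and surj: "surj T"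
  shows "invertible_op T"
proof -
  interpret T: bounded_linear T using T by (rule bounded_clinear_imp_bounded_linear)
  have inj: "inj T"
  proof (rule injI)
    fix x y assume "T x = T y"
    then have "c * norm (x - y) \<le> 0" using low[of "x - y"] by (simp add: T.diff)
    then show "x = y" using c by (simp add: mult_le_0_iff)
  qed
  have TV: "T (inv T y) = y" for y using surj by (simp add: surj_f_inv_f)
  have VT: "inv T (T x) = x" for x using inj by simp
  have sc: "inv T (a *\<^sub>C y) = a *\<^sub>C inv T y" for a y
    using VT[of "a *\<^sub>C inv T y"] by (simp add: bounded_clinear_scaleC[OF T] TV)
  have "bounded_linear (inv T)"
  proof (rule bounded_linear_intro[where K = "1 / c"])
    show "inv T (x + y) = inv T x + inv T y" for x y
      using VT[of "inv T x + inv T y"] by (simp add: T.add TV)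
    show "inv T (r *\<^sub>R x) = r *\<^sub>R inv T x" for r x by (simp add: scaleR_scaleC sc)
    show "norm (inv T x) \<le> norm x * (1 / c)" for x
      using low[of "inv T x"] c by (simp add: TV field_simps)
  qed
  then have "bounded_clinear (inv T)" by (simp add: bounded_clinear_def sc)
  then show ?thesis unfolding invertible_op_def
    by (intro exI[of _ "inv T"]) (auto simp: TV VT fun_eq_iff)
qed

lemma invertible_opD:
  fixes T :: "'a::complex_banach \<Rightarrow> 'a"
  assumes "invertible_op T"
  shows "surj T" "inj T" "bounded_clinear (inv T)" "\<exists>c>0. \<forall>x. c * norm x \<le> norm (T x)"
proof -
  obtain S where S: "bounded_clinear S" "S \<circ> T = id" "T \<circ> S = id"
    using assms by (auto simp: invertible_op_def)
  show "surj T" "inj T" using S(2,3) by (metis comp_surj surj_id surjI o_apply id_apply, metis inj_on_id inj_on_imageI2)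
  have "inv T = S" using S(2,3) by (metis inv_unique_comp)
  with S(1) show "bounded_clinear (inv T)" by simp
  obtain K where K: "K > 0" "\<And>x. norm (S x) \<le> norm x * K"
    using bounded_linear.pos_bounded[OF bounded_clinear_imp_bounded_linear[OF S(1)]] by blast
  have "1 / K * norm x \<le> norm (T x)" for x
    using K(2)[of "T x"] S(2) K(1) by (simp add: fun_eq_iff field_simps)
  then show "\<exists>c>0. \<forall>x. c * norm x \<le> norm (T x)" using K(1) by (intro exI[of _ "1 / K"]) auto
qed

lemma invertible_op_imp_lower_semi_Fredholm: "invertible_op T \<Longrightarrow> lower_semi_Fredholm T"
  unfolding lower_semi_Fredholm_def using invertible_opD(1)[of T] by (intro exI[of _ "{}"]) simp

lemma upper_semi_Fredholm_if_bounded_below: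
  fixes S :: "'a::complex_banach \<Rightarrow> 'a"
  assumes S: "bounded_clinear S" and c: "c > 0" "\<And>x. c * norm x \<le> norm (S x)"
  shows "upper_semi_Fredholm S"
proof -
  have "complete (range S)"
    by (rule complete_isometric_image[OF c(1) subspace_UNIV bounded_clinear_imp_bounded_linear[OF S] _ complete_UNIV])
      (use c in auto)
  then have "closed (range S)" by (rule complete_imp_closed)
  moreover have "{x. S x = 0} \<subseteq> cspan {}"
  proof
    fix x assume "x \<in> {x. S x = 0}"
    then have "norm x \<le> 0" using c(2)[of x] c(1) by (simp add: mult_le_0_iff)
    then show "x \<in> cspan {}" by simp
  qed
  ultimately show ?thesis unfolding upper_semi_Fredholm_def by blast
qed

lemma not_approx_point_if_bounded_below:
  fixes T :: "'a::complex_banach \<Rightarrow> 'a"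
  assumes c: "c > 0" "\<And>x. c * norm x \<le> norm (resolvent_op \<mu> T x)"
  shows "\<mu> \<notin> approx_point_spectrum T"
proof
  assume "\<mu> \<in> approx_point_spectrum T"
  then obtain x where x: "\<And>n. norm (x n) = 1" "(\<lambda>n. T (x n) - \<mu> *\<^sub>C x n) \<longlonglongrightarrow> 0"
    by (auto simp: approx_point_spectrum_def)
  have "\<forall>\<^sub>F n in sequentially. norm (T (x n) - \<mu> *\<^sub>C x n) < c"
    using x(2) c(1) by (auto simp: tendsto_iff)
  then obtain n where "norm (T (x n) - \<mu> *\<^sub>C x n) < c" by (auto simp: eventually_sequentially)
  then show False using c(2)[of "x n"] x(1)[of n] by (simp add: resolvent_op_def norm_minus_commute)
qed

text \<open>The cofactor of \<open>\<mu> - T\<close> in \<open>\<mu>\<^sup>n - T\<^sup>n\<close>.\<close>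

primrec geometric_op :: "nat \<Rightarrow> complex \<Rightarrow> ('a::complex_banach \<Rightarrow> 'a) \<Rightarrow> 'a \<Rightarrow> 'a" where
  "geometric_op 0 \<mu> T x = 0"
| "geometric_op (Suc n) \<mu> T x = (T ^^ n) x + \<mu> *\<^sub>C geometric_op n \<mu> T x"

lemma bounded_linear_geometric_op:
  assumes T: "bounded_clinear T"
  shows "bounded_linear (geometric_op n \<mu> T)"
proof (induction n)
  case (Suc n)
  then show ?case
    using bounded_linear_add[OF bounded_clinear_imp_bounded_linear[OF bounded_clinear_funpow[OF T, of n]]
        bounded_linear_compose[OF bounded_linear_scaleC_right Suc]]
    by (simp add: o_def)
qed simp

lemma resolvent_op_geometric_op:
  assumes T: "bounded_clinear T"
  shows "resolvent_op \<mu> T (geometric_op n \<mu> T x) = (\<mu> ^ n) *\<^sub>C x - (T ^^ n) x"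
    and "geometric_op n \<mu> T (resolvent_op \<mu> T x) = (\<mu> ^ n) *\<^sub>C x - (T ^^ n) x"
proof -
  interpret T: bounded_linear T using T by (rule bounded_clinear_imp_bounded_linear)
  show "resolvent_op \<mu> T (geometric_op n \<mu> T x) = (\<mu> ^ n) *\<^sub>C x - (T ^^ n) x"
  proof (induction n)
    case 0
    then show ?case by (simp add: resolvent_op_def T.zero scaleC_one)
  next
    case (Suc n)
    then have "\<mu> *\<^sub>C (\<mu> *\<^sub>C geometric_op n \<mu> T x - T (geometric_op n \<mu> T x)) = \<mu> *\<^sub>C ((\<mu> ^ n) *\<^sub>C x - (T ^^ n) x)"
      by (simp add: resolvent_op_def)
    then show ?case
      by (simp add: resolvent_op_def T.add bounded_clinear_scaleC[OF T] scaleC_add_right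
          scaleC_diff_right scaleC_scaleC algebra_simps)
  qed
  show "geometric_op n \<mu> T (resolvent_op \<mu> T x) = (\<mu> ^ n) *\<^sub>C x - (T ^^ n) x"
  proof (induction n)
    case 0
    then show ?case by (simp add: scaleC_one)
  next
    case (Suc n)
    interpret Tn: bounded_linear "T ^^ n"
      using bounded_clinear_funpow[OF T] by (rule bounded_clinear_imp_bounded_linear)
    show ?case
      using Suc by (simp add: resolvent_op_def Tn.diff bounded_clinear_scaleC[OF bounded_clinear_funpow[OF T]]
          scaleC_diff_right scaleC_scaleC funpow_swap1)
  qed
qed

lemma resolvent_op_bounded_below_if_power_bounded_below:
  fixes T :: "'a::complex_banach \<Rightarrow> 'a"
  assumes T: "bounded_clinear T" and d: "d > 0" and low: "\<And>x. d * norm x \<le> norm ((\<mu> ^ n) *\<^sub>C x - (T ^^ n) x)"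
  shows "\<exists>c>0. \<forall>x. c * norm x \<le> norm (resolvent_op \<mu> T x)"
proof -
  obtain K where K: "K > 0" "\<And>x. norm (geometric_op n \<mu> T x) \<le> norm x * K"
    using bounded_linear.pos_bounded[OF bounded_linear_geometric_op[OF T]] by blast
  have "d / K * norm x \<le> norm (resolvent_op \<mu> T x)" for x
    using low[of x] K(2)[of "resolvent_op \<mu> T x"] K(1)
    by (simp add: resolvent_op_geometric_op(2)[OF T] field_simps)
  then show ?thesis using d K(1) by (intro exI[of _ "d / K"]) auto
qed

lemma resolvent_op_bounded_below_if_power_large:
  fixes T :: "'a::complex_banach \<Rightarrow> 'a"
  assumes T: "bounded_clinear T" and s: "cmod \<mu> ^ n < s" "\<And>x. s * norm x \<le> norm ((T ^^ n) x)"
  shows "\<exists>c>0. \<forall>x. c * norm x \<le> norm (resolvent_op \<mu> T x)"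
proof (rule resolvent_op_bounded_below_if_power_bounded_below[OF T])
  show "s - cmod \<mu> ^ n > 0" using s by simp
  show "(s - cmod \<mu> ^ n) * norm x \<le> norm ((\<mu> ^ n) *\<^sub>C x - (T ^^ n) x)" for x
    using s(2)[of x] norm_triangle_ineq2[of "(T ^^ n) x" "(\<mu> ^ n) *\<^sub>C x"]
    by (simp add: norm_scaleC norm_power norm_minus_commute left_diff_distrib)
qed

text \<open>A solution of \<open>\<mu>\<^sup>n z - T\<^sup>n z = y\<close>, found by contraction, yields one of \<open>\<mu> x - T x = y\<close> by applying
  the cofactor.\<close>

lemma invertible_resolvent_op_if_power_small:
  fixes T :: "'a::complex_banach \<Rightarrow> 'a"
  assumes T: "bounded_clinear T" and s: "0 \<le> s" "s < cmod \<mu> ^ n" "\<And>x. norm ((T ^^ n) x) \<le> s * norm x"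
  shows "invertible_op (resolvent_op \<mu> T)"
proof -
  interpret Tn: bounded_linear "T ^^ n"
    using bounded_clinear_funpow[OF T] by (rule bounded_clinear_imp_bounded_linear)
  have "\<exists>c>0. \<forall>x. c * norm x \<le> norm (resolvent_op \<mu> T x)"
  proof (rule resolvent_op_bounded_below_if_power_bounded_below[OF T])
    show "cmod \<mu> ^ n - s > 0" using s by simp
    show "(cmod \<mu> ^ n - s) * norm x \<le> norm ((\<mu> ^ n) *\<^sub>C x - (T ^^ n) x)" for x
      using s(3)[of x] norm_triangle_ineq2[of "(\<mu> ^ n) *\<^sub>C x" "(T ^^ n) x"]
      by (simp add: norm_scaleC norm_power left_diff_distrib)
  qed
  moreover have "\<exists>x. y = resolvent_op \<mu> T x" for y
  proof -
    define a where "a = inverse (\<mu> ^ n)"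
    have "0 < cmod (\<mu> ^ n)" using s(1,2) by (simp add: norm_power)
    then have \<mu>n: "\<mu> ^ n \<noteq> 0" by simp
    have "\<exists>!z. a *\<^sub>C ((T ^^ n) z + y) = z"
    proof (rule banach_fix_type[where c = "s / cmod \<mu> ^ n"])
      show "0 \<le> s / cmod \<mu> ^ n" "s / cmod \<mu> ^ n < 1" using s by (auto simp: field_simps)
      show "\<forall>u v. dist (a *\<^sub>C ((T ^^ n) u + y)) (a *\<^sub>C ((T ^^ n) v + y)) \<le> s / cmod \<mu> ^ n * dist u v"
      proof (intro allI)
        fix u v
        have "a *\<^sub>C ((T ^^ n) u + y) - a *\<^sub>C ((T ^^ n) v + y) = a *\<^sub>C (T ^^ n) (u - v)"
          by (simp add: Tn.diff flip: scaleC_diff_right)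
        then have "dist (a *\<^sub>C ((T ^^ n) u + y)) (a *\<^sub>C ((T ^^ n) v + y)) = cmod a * norm ((T ^^ n) (u - v))"
          by (simp add: dist_norm norm_scaleC)
        also have "\<dots> \<le> cmod a * (s * norm (u - v))"
          by (intro mult_left_mono s(3)) auto
        finally show "dist (a *\<^sub>C ((T ^^ n) u + y)) (a *\<^sub>C ((T ^^ n) v + y)) \<le> s / cmod \<mu> ^ n * dist u v"
          by (simp add: a_def norm_inverse norm_power dist_norm divide_inverse mult_ac)
      qed
    qed
    then obtain z where "a *\<^sub>C ((T ^^ n) z + y) = z" by blast
    then have "(\<mu> ^ n) *\<^sub>C z = (\<mu> ^ n) *\<^sub>C a *\<^sub>C ((T ^^ n) z + y)" by simp
    then have "(\<mu> ^ n) *\<^sub>C z = (T ^^ n) z + y"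
      using \<mu>n by (simp add: scaleC_scaleC a_def scaleC_one)
    then have "y = resolvent_op \<mu> T (geometric_op n \<mu> T z)"
      by (simp add: resolvent_op_geometric_op(1)[OF T])
    then show ?thesis by blast
  qed
  then have "surj (resolvent_op \<mu> T)" by (auto simp: surj_def)
  ultimately show ?thesis using invertible_opI[OF bounded_clinear_resolvent_op[OF T]] by blast
qed

lemma resolvent_op_inv_factor:
  fixes T :: "'a::complex_banach \<Rightarrow> 'a"
  assumes T: "bounded_clinear T" "surj T" "inj T" and "\<mu> \<noteq> 0"
  shows "resolvent_op \<mu> T x = - (\<mu> *\<^sub>C T (resolvent_op (1 / \<mu>) (inv T) x))"
proof -
  interpret T: bounded_linear T using T(1) by (rule bounded_clinear_imp_bounded_linear)
  show ?thesis using assms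
    by (simp add: resolvent_op_def T.diff bounded_clinear_scaleC[OF T(1)] scaleC_diff_right
        scaleC_scaleC scaleC_one surj_f_inv_f)
qed

lemma invertible_resolvent_op_if_inv:
  fixes T :: "'a::complex_banach \<Rightarrow> 'a"
  assumes T: "bounded_clinear T" "invertible_op T" and \<mu>: "\<mu> \<noteq> 0"
    and inv: "invertible_op (resolvent_op (1 / \<mu>) (inv T))"
  shows "invertible_op (resolvent_op \<mu> T)"
proof -
  note T2 = invertible_opD[OF T(2)]
  note fac = resolvent_op_inv_factor[OF T(1) T2(1,2) \<mu>]
  obtain c where c: "c > 0" "\<And>x. c * norm x \<le> norm (T x)" using T2(4) by blast
  obtain c' where c': "c' > 0" "\<And>x. c' * norm x \<le> norm (resolvent_op (1 / \<mu>) (inv T) x)"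
    using invertible_opD(4)[OF inv] by blast
  show ?thesis
  proof (rule invertible_opI[OF bounded_clinear_resolvent_op[OF T(1)]])
    show "cmod \<mu> * (c * c') > 0" using c c' \<mu> by simp
    show "cmod \<mu> * (c * c') * norm x \<le> norm (resolvent_op \<mu> T x)" for x
    proof -
      have "c * (c' * norm x) \<le> c * norm (resolvent_op (1 / \<mu>) (inv T) x)"
        using c c' by (intro mult_left_mono) auto
      also have "\<dots> \<le> norm (T (resolvent_op (1 / \<mu>) (inv T) x))" by (rule c)
      finally show ?thesis
        by (simp add: fac norm_scaleC mult.assoc mult_left_mono)
    qed
    show "surj (resolvent_op \<mu> T)"
      unfolding surj_def
    proof
      fix y
      obtain u where "- ((1 / \<mu>) *\<^sub>C y) = T u" using T2(1) by (metis surj_def)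
      moreover obtain x where "u = resolvent_op (1 / \<mu>) (inv T) x"
        using invertible_opD(1)[OF inv] by (metis surj_def)
      ultimately have "resolvent_op \<mu> T x = - (\<mu> *\<^sub>C (- ((1 / \<mu>) *\<^sub>C y)))"
        by (simp only: fac)
      also have "\<dots> = y"
        using \<mu> by (simp add: complex_vector.scale_minus_right scaleC_scaleC scaleC_one)
      finally show "\<exists>x. y = resolvent_op \<mu> T x" by blast
    qed
  qed
qed

lemma invertible_op_inv:
  fixes T :: "'a::complex_banach \<Rightarrow> 'a"
  assumes "bounded_clinear T" "invertible_op T"
  shows "invertible_op (inv T)"
  unfolding invertible_op_def using assms invertible_opD[OF assms(2)]
  by (intro exI[of _ T]) (auto simp: fun_eq_iff surj_f_inv_f)

lemma resolvent_op_0: "resolvent_op 0 T = (\<lambda>x. - T x)"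
  by (simp add: resolvent_op_def)

lemma invertible_resolvent_op_0:
  fixes T :: "'a::complex_banach \<Rightarrow> 'a"
  assumes T: "bounded_clinear T" "invertible_op T"
  shows "invertible_op (resolvent_op 0 T)"
proof -
  obtain c where c: "c > 0" "\<And>x. c * norm x \<le> norm (T x)" using invertible_opD(4)[OF T(2)] by blast
  have "surj (resolvent_op 0 T)"
    using invertible_opD(1)[OF T(2)] unfolding resolvent_op_0 surj_def by (metis minus_minus)
  moreover have "c * norm x \<le> norm (resolvent_op 0 T x)" for x
    using c(2) by (simp add: resolvent_op_0)
  ultimately show ?thesis
    using invertible_opI[OF bounded_clinear_resolvent_op[OF T(1)] c(1)] by blast
qed

text \<open>Both inclusions come from \<open>\<mu> - T = - \<mu> T (1 / \<mu> - T\<^sup>-\<^sup>1)\<close>.\<close>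

lemma spectrum_inv:
  fixes T :: "'a::complex_banach \<Rightarrow> 'a"
  assumes T: "bounded_clinear T" "invertible_op T"
  shows "spectrum (inv T) = (\<lambda>\<mu>. 1 / \<mu>) ` spectrum T"
proof -
  note T2 = invertible_opD[OF T(2)]
  note iT = invertible_op_inv[OF T]
  have inv_inv: "inv (inv T) = T" using T2(1,2) by (simp add: inv_inv_eq bij_def)
  have "0 \<notin> spectrum (inv T)" "0 \<notin> spectrum T"
    using invertible_resolvent_op_0 iT T2(3) T by (auto simp: spectrum_def)
  moreover have "\<mu> \<in> spectrum (inv T) \<longleftrightarrow> 1 / \<mu> \<in> spectrum T" if "\<mu> \<noteq> 0" for \<mu>
    using invertible_resolvent_op_if_inv[OF T(1,2), of "1 / \<mu>"]
      invertible_resolvent_op_if_inv[OF T2(3) iT, of \<mu>] that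
    by (auto simp: spectrum_def inv_inv)
  moreover have "\<mu> \<in> (\<lambda>\<mu>. 1 / \<mu>) ` spectrum T \<longleftrightarrow> 1 / \<mu> \<in> spectrum T" if "\<mu> \<noteq> 0" for \<mu>
    using that by (auto intro!: image_eqI[of _ _ "1 / \<mu>"])
  moreover have "0 \<notin> (\<lambda>\<mu>. 1 / \<mu>) ` spectrum T"
    using \<open>0 \<notin> spectrum T\<close> by (auto simp: image_iff)
  ultimately have "\<mu> \<in> spectrum (inv T) \<longleftrightarrow> \<mu> \<in> (\<lambda>\<mu>. 1 / \<mu>) ` spectrum T" for \<mu>
    by (cases "\<mu> = 0") auto
  then show ?thesis by blast
qed

text \<open>The powers of the inverse are small, so the previous criterion applies to \<open>1 / \<mu>\<close> and the inverse.\<close>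

lemma invertible_resolvent_op_if_power_large:
  fixes T :: "'a::complex_banach \<Rightarrow> 'a"
  assumes T: "bounded_clinear T" "invertible_op T"
    and s: "cmod \<mu> ^ n < s" "\<And>x. s * norm x \<le> norm ((T ^^ n) x)"
  shows "invertible_op (resolvent_op \<mu> T)"
proof (cases "\<mu> = 0")
  case True
  then show ?thesis using invertible_resolvent_op_0[OF T] by simp
next
  case False
  note T2 = invertible_opD[OF T(2)]
  have s0: "s > 0" using s(1) by (meson norm_ge_zero zero_le_power order.strict_trans1)
  have "(T ^^ n) ((inv T ^^ n) x) = x" for x
    using T2(1) by (induction n arbitrary: x) (auto simp: funpow_swap1 surj_f_inv_f)
  then have "norm ((inv T ^^ n) x) \<le> (1 / s) * norm x" for x
    using s(2)[of "(inv T ^^ n) x"] s0 by (simp add: field_simps)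
  moreover have "1 / s < cmod (1 / \<mu>) ^ n"
    using s s0 False by (simp add: norm_divide power_divide field_simps)
  ultimately have "invertible_op (resolvent_op (1 / \<mu>) (inv T))"
    using s0 by (intro invertible_resolvent_op_if_power_small[OF T2(3), of "1 / s"]) auto
  then show ?thesis by (rule invertible_resolvent_op_if_inv[OF T False])
qed

lemma spectral_radius_eqI:
  assumes "\<And>\<mu>. \<mu> \<in> spectrum T \<Longrightarrow> cmod \<mu> \<le> R" "\<mu> \<in> spectrum T" "cmod \<mu> = R"
  shows "spectral_radius T = R"
  unfolding spectral_radius_def using assms by (intro cSup_eq_maximum) auto

lemma min_spectral_radius_eqI:
  fixes T :: "'a::complex_banach \<Rightarrow> 'a"
  assumes T: "bounded_clinear T" "invertible_op T" and r: "r > 0"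
    and ge: "\<And>\<mu>. \<mu> \<in> spectrum T \<Longrightarrow> r \<le> cmod \<mu>" and \<mu>: "\<mu> \<in> spectrum T" "cmod \<mu> = r"
  shows "min_spectral_radius T = r"
proof -
  have "spectral_radius (inv T) = 1 / r"
  proof (rule spectral_radius_eqI)
    show "1 / \<mu> \<in> spectrum (inv T)" using \<mu> unfolding spectrum_inv[OF T] by blast
    show "cmod (1 / \<mu>) = 1 / r" using \<mu> by (simp add: norm_divide)
    fix \<nu> assume "\<nu> \<in> spectrum (inv T)"
    then obtain \<nu>' where "\<nu> = 1 / \<nu>'" "\<nu>' \<in> spectrum T" unfolding spectrum_inv[OF T] by blast
    then show "cmod \<nu> \<le> 1 / r" using ge[of \<nu>'] r by (simp add: norm_divide frac_le)
  qed
  then show ?thesis using T(2) r by (simp add: min_spectral_radius_def)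
qed

lemma scaled_disc: "0 \<le> R \<Longrightarrow> (\<lambda>z. complex_of_real R * z) ` cball 0 1 = {\<mu>. cmod \<mu> \<le> R}"
proof (cases "R = 0")
  case True
  have "(\<lambda>z. 0) ` cball (0::complex) 1 = {0}" by (auto intro!: image_eqI[of _ _ 0])
  then show ?thesis using True by auto
next
  case False
  assume "0 \<le> R"
  then have R: "R > 0" using False by simp
  show ?thesis
  proof (intro set_eqI iffI)
    fix \<mu> assume "\<mu> \<in> (\<lambda>z. complex_of_real R * z) ` cball 0 1"
    then show "\<mu> \<in> {\<mu>. cmod \<mu> \<le> R}" using R by (auto simp: norm_mult mult_left_le)
  next
    fix \<mu> assume "\<mu> \<in> {\<mu>. cmod \<mu> \<le> R}"
    then show "\<mu> \<in> (\<lambda>z. complex_of_real R * z) ` cball 0 1"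
      using R by (intro image_eqI[of _ _ "\<mu> / of_real R"]) (auto simp: norm_divide)
  qed
qed


section \<open>Local constancy of the codimension of the range\<close>

text \<open>Gaussian elimination, one equation at a time.\<close>

lemma underdetermined_system_solution:
  fixes a :: "'i \<Rightarrow> 'b \<Rightarrow> complex"
  assumes "finite B" "finite I" "card B < card I"
  shows "\<exists>c. (\<exists>i\<in>I. c i \<noteq> 0) \<and> (\<forall>b\<in>B. (\<Sum>i\<in>I. c i * a i b) = 0)"
  using assms
proof (induction B arbitrary: I a rule: finite_induct)
  case empty
  then have "I \<noteq> {}" by auto
  then show ?case by (auto intro!: exI[of _ "\<lambda>i. 1"])
next
  case (insert b B)
  show ?case
  proof (cases "\<forall>i\<in>I. a i b = 0")
    case True
    have "card B < card I" using insert.prems insert.hyps by simp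
    from insert.IH[OF insert.prems(1) this, of a] obtain c where
      "\<exists>i\<in>I. c i \<noteq> 0" "\<forall>b\<in>B. (\<Sum>i\<in>I. c i * a i b) = 0" by blast
    moreover have "(\<Sum>i\<in>I. c i * a i b) = 0" using True by (intro sum.neutral) simp
    ultimately show ?thesis by (intro exI[of _ c]) simp
  next
    case False
    then obtain j where j: "j \<in> I" "a j b \<noteq> 0" by blast
    define J where "J = I - {j}"
    have J: "finite J" "card B < card J" "I = insert j J" "j \<notin> J"
      using insert.prems insert.hyps j by (auto simp: J_def)
    obtain c where c: "\<exists>i\<in>J. c i \<noteq> 0"
        "\<And>b'. b' \<in> B \<Longrightarrow> (\<Sum>i\<in>J. c i * (a i b' - a i b / a j b * a j b')) = 0"
      using insert.IH[OF J(1,2), of "\<lambda>i b'. a i b' - a i b / a j b * a j b'"] by blast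
    define c' where "c' = c(j := - (\<Sum>i\<in>J. c i * (a i b / a j b)))"
    have sum: "(\<Sum>i\<in>I. c' i * a i b') = (\<Sum>i\<in>J. c i * (a i b' - a i b / a j b * a j b'))" for b'
    proof -
      have "(\<Sum>i\<in>J. c' i * a i b') = (\<Sum>i\<in>J. c i * a i b')"
        using J(4) by (intro sum.cong) (auto simp: c'_def)
      then show ?thesis
        using J(1,4) by (simp add: J(3) c'_def right_diff_distrib sum_subtractf sum_distrib_right mult.assoc)
    qed
    have "(\<Sum>i\<in>J. c i * (a i b - a i b / a j b * a j b)) = 0" using j by simp
    then have "\<forall>b'\<in>insert b B. (\<Sum>i\<in>I. c' i * a i b') = 0"
      using c(2) by (auto simp: sum)
    moreover have "\<exists>i\<in>I. c' i \<noteq> 0" using c(1) J(3,4) by (auto simp: c'_def)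
    ultimately show ?thesis by blast
  qed
qed

text \<open>The components of the vectors of \<open>Y\<close> along \<open>B\<close> form an underdetermined system; a nontrivial solution
  gives a combination of \<open>Y\<close> without component along \<open>B\<close>.\<close>

lemma independent_meets_range_if_small_codimension:
  fixes S :: "'a::complex_normed_vector \<Rightarrow> 'a"
  assumes S: "bounded_clinear S" and B: "finite B" "cspan (range S \<union> B) = UNIV"
    and Y: "finite Y" "complex_vector.independent Y" "card B < card Y"
  shows "\<exists>v\<in>cspan Y. v \<noteq> 0 \<and> v \<in> range S"
proof -
  have "\<exists>x u. y = S x + (\<Sum>b\<in>B. u b *\<^sub>C b)" for y
  proof -
    obtain x b where "b \<in> cspan B" "y = S x + b"
      using B(2) unfolding cspan_range_Un_eq_UNIV_iff[OF S] by blast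
    moreover from this(1) obtain u where "b = (\<Sum>b\<in>B. u b *\<^sub>C b)"
      unfolding complex_vector.span_finite[OF B(1)] by blast
    ultimately show ?thesis by blast
  qed
  then have "\<forall>y. \<exists>x. \<exists>u. y = S x + (\<Sum>b\<in>B. u b *\<^sub>C b)" by blast
  then obtain X where "\<forall>y. \<exists>u. y = S (X y) + (\<Sum>b\<in>B. u b *\<^sub>C b)" by (rule choice[THEN exE])
  then obtain u where Xu: "\<forall>y. y = S (X y) + (\<Sum>b\<in>B. u y b *\<^sub>C b)" by (rule choice[THEN exE])
  obtain c where c: "\<exists>y\<in>Y. c y \<noteq> 0" "\<forall>b\<in>B. (\<Sum>y\<in>Y. c y * u y b) = 0"
    using underdetermined_system_solution[OF B(1) Y(1,3), of u] by blast
  define v where "v = (\<Sum>y\<in>Y. c y *\<^sub>C y)"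
  have "v \<noteq> 0"
    using Y(1,2) c(1) unfolding complex_vector.dependent_finite[OF Y(1)] v_def by blast
  moreover have "v \<in> cspan Y"
    unfolding v_def by (intro complex_vector.span_sum complex_vector.span_scale complex_vector.span_base)
  moreover have "v \<in> range S"
  proof -
    interpret S: bounded_linear S using S by (rule bounded_clinear_imp_bounded_linear)
    have "v = (\<Sum>y\<in>Y. c y *\<^sub>C (S (X y) + (\<Sum>b\<in>B. u y b *\<^sub>C b)))"
      unfolding v_def by (intro sum.cong refl arg_cong2[where f = scaleC] Xu[rule_format])
    also have "\<dots> = (\<Sum>y\<in>Y. c y *\<^sub>C S (X y)) + (\<Sum>b\<in>B. (\<Sum>y\<in>Y. c y * u y b) *\<^sub>C b)"
      by (simp add: scaleC_add_right sum.distrib complex_vector.scale_sum_right scaleC_scaleC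
          complex_vector.scale_sum_left sum.swap[of _ B])
    also have "\<dots> = (\<Sum>y\<in>Y. c y *\<^sub>C S (X y))" using c(2) by simp
    also have "\<dots> = S (\<Sum>y\<in>Y. c y *\<^sub>C X y)" by (simp add: S.sum bounded_clinear_scaleC[OF S])
    finally show ?thesis by blast
  qed
  ultimately show ?thesis by blast
qed

definition codim_range_le :: "('a::complex_banach \<Rightarrow> 'a) \<Rightarrow> nat \<Rightarrow> bool"
  where "codim_range_le S n \<longleftrightarrow> (\<exists>B. finite B \<and> card B \<le> n \<and> cspan (range S \<union> B) = UNIV)"

lemma independent_complement_if_large_codimension:
  fixes S :: "'a::complex_banach \<Rightarrow> 'a"
  assumes S: "bounded_clinear S" and n: "\<not> codim_range_le S n" and "k \<le> Suc n"
  shows "\<exists>Y. finite Y \<and> card Y = k \<and> complex_vector.independent Y \<and> cspan Y \<inter> range S \<subseteq> {0}"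
  using assms(3)
proof (induction k)
  case 0
  then show ?case by (intro exI[of _ "{}"]) (auto simp: complex_vector.independent_empty)
next
  case (Suc k)
  then obtain Y where Y: "finite Y" "card Y = k" "complex_vector.independent Y" "cspan Y \<inter> range S \<subseteq> {0}"
    by auto
  have "card Y \<le> n" using Y Suc by simp
  then have "cspan (range S \<union> Y) \<noteq> UNIV" using n Y(1) by (auto simp: codim_range_le_def)
  then obtain y where y: "y \<notin> cspan (range S \<union> Y)" by blast
  have yY: "y \<notin> cspan Y" using y complex_vector.span_mono[of Y "range S \<union> Y"] by blast
  then have "y \<notin> Y" using complex_vector.span_base by blast
  have "cspan (insert y Y) \<inter> range S \<subseteq> {0}"
  proof
    fix v assume v: "v \<in> cspan (insert y Y) \<inter> range S"
    then obtain c where c: "v - c *\<^sub>C y \<in> cspan Y" by (auto simp: complex_vector.span_breakdown_eq)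
    have "c = 0"
    proof (rule ccontr)
      assume "c \<noteq> 0"
      have "v \<in> cspan (range S \<union> Y)" using v by (intro complex_vector.span_base) auto
      moreover have "v - c *\<^sub>C y \<in> cspan (range S \<union> Y)"
        using c complex_vector.span_mono[of Y "range S \<union> Y"] by blast
      ultimately have "(1 / c) *\<^sub>C (v - (v - c *\<^sub>C y)) \<in> cspan (range S \<union> Y)"
        by (rule complex_vector.span_scale[OF complex_vector.span_diff])
      moreover have "(1 / c) *\<^sub>C (v - (v - c *\<^sub>C y)) = y"
        using \<open>c \<noteq> 0\<close> by (simp add: scaleC_scaleC scaleC_one)
      ultimately show False using y by simp
    qed
    then show "v \<in> {0}" using c v Y(4) by auto
  qed
  moreover have "complex_vector.independent (insert y Y)"
    using Y(3) yY by (simp add: complex_vector.independent_insert)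
  ultimately show ?case
    using Y(1,2) \<open>y \<notin> Y\<close> by (intro exI[of _ "insert y Y"]) auto
qed

lemma resolvent_op_diff:
  "resolvent_op \<mu> T x - resolvent_op \<nu> T x = (\<mu> - \<nu>) *\<^sub>C x"
  by (simp add: resolvent_op_def complex_vector.scale_left_diff_distrib)

text \<open>Surjectivity modulo a fixed finite set is an open condition: an exact solution for \<open>\<mu>\<close> is an
  approximate one for nearby \<open>\<nu>\<close>.\<close>

lemma codim_range_le_stable:
  fixes T :: "'a::complex_banach \<Rightarrow> 'a"
  assumes T: "bounded_clinear T" and n: "codim_range_le (resolvent_op \<mu> T) n"
  shows "\<exists>\<eta>>0. \<forall>\<nu>\<in>ball \<mu> \<eta>. codim_range_le (resolvent_op \<nu> T) n"
proof -
  note R = bounded_clinear_resolvent_op[OF T]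
  obtain B where B: "finite B" "card B \<le> n" "cspan (range (resolvent_op \<mu> T) \<union> B) = UNIV"
    using n by (auto simp: codim_range_le_def)
  obtain K where K: "K \<ge> 0"
      "\<And>y. \<exists>x b. b \<in> cspan B \<and> y = resolvent_op \<mu> T x + b \<and> norm x \<le> K * norm y"
    using cspan_range_Un_imp_bounded_solution[OF R B(1,3)] by blast
  define \<eta> where "\<eta> = 1 / (2 * (K + 1))"
  have \<eta>: "\<eta> > 0" "\<eta> * K \<le> 1 / 2" using K(1) by (auto simp: \<eta>_def field_simps)
  have "codim_range_le (resolvent_op \<nu> T) n" if \<nu>: "\<nu> \<in> ball \<mu> \<eta>" for \<nu>
  proof -
    have "\<exists>x b. b \<in> cspan B \<and> y = resolvent_op \<nu> T x + b" for y
    proof -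
      have "\<exists>x b. b \<in> cspan B \<and> y = resolvent_op \<nu> T x + b \<and> norm x \<le> K / (1 - 1 / 2) * norm y"
      proof (rule solvable_if_approximately_solvable[OF _ B(1) K(1), where V = UNIV])
        show "bounded_linear (resolvent_op \<nu> T)" by (rule bounded_clinear_imp_bounded_linear[OF R])
        fix y
        obtain x b where xb: "b \<in> cspan B" "y = resolvent_op \<mu> T x + b" "norm x \<le> K * norm y"
          using K(2) by blast
        have "y - resolvent_op \<nu> T x - b = (\<mu> - \<nu>) *\<^sub>C x"
          using xb(2) resolvent_op_diff[of \<mu> T x \<nu>] by simp
        then have "norm (y - resolvent_op \<nu> T x - b) = cmod (\<mu> - \<nu>) * norm x"
          by (simp add: norm_scaleC)
        also have "\<dots> \<le> \<eta> * (K * norm y)"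
          using \<nu> \<eta>(1) xb(3) by (intro mult_mono) (auto simp: dist_norm)
        also have "\<dots> \<le> 1 / 2 * norm y"
          using mult_right_mono[OF \<eta>(2) norm_ge_zero[of y]] by (simp add: mult.assoc)
        finally show "\<exists>x b. b \<in> cspan B \<and> norm x \<le> K * norm y \<and>
            norm (y - resolvent_op \<nu> T x - b) \<le> 1 / 2 * norm y \<and> y - resolvent_op \<nu> T x - b \<in> UNIV"
          using xb by blast
      qed auto
      then show ?thesis by blast
    qed
    then have "cspan (range (resolvent_op \<nu> T) \<union> B) = UNIV"
      unfolding cspan_range_Un_eq_UNIV_iff[OF R] by blast
    then show ?thesis using B by (auto simp: codim_range_le_def)
  qed
  then show ?thesis using \<eta>(1) by blast
qed

text \<open>Fix \<open>n + 1\<close> vectors \<open>Y\<close> independent modulo the range. If \<open>\<nu>\<close> tends to \<open>\<mu>\<close> and the codimension at \<open>\<nu>\<close> is at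
  most \<open>n\<close>, unit vectors of the span of \<open>Y\<close> lie in the range at \<open>\<nu>\<close>, with bounded preimages because of
  the lower bound. By compactness they accumulate at a unit vector in the closed range at \<open>\<mu>\<close>.\<close>

lemma not_codim_range_le_stable:
  fixes T :: "'a::complex_banach \<Rightarrow> 'a"
  assumes T: "bounded_clinear T" and c: "c > 0" "\<And>x. c * norm x \<le> norm (resolvent_op \<mu> T x)"
    and n: "\<not> codim_range_le (resolvent_op \<mu> T) n"
  shows "\<exists>\<eta>>0. \<forall>\<nu>\<in>ball \<mu> \<eta>. \<not> codim_range_le (resolvent_op \<nu> T) n"
proof (rule ccontr)
  assume neg: "\<not> ?thesis"
  note R = bounded_clinear_resolvent_op[OF T]
  obtain Y where Y: "finite Y" "card Y = Suc n" "complex_vector.independent Y"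
      "cspan Y \<inter> range (resolvent_op \<mu> T) \<subseteq> {0}"
    using independent_complement_if_large_codimension[OF R n le_refl] by blast
  have "\<exists>f. norm (resolvent_op \<mu> T f) \<ge> 1 - e \<and> norm (resolvent_op \<mu> T f) \<le> 1 + e \<and>
      (\<exists>v\<in>cspan Y. norm v = 1 \<and> norm (v - resolvent_op \<mu> T f) \<le> e)" if e: "0 < e" for e
  proof -
    define \<eta> where "\<eta> = min (c / 2) (e * c / 2)"
    have "\<eta> > 0" using c e by (simp add: \<eta>_def)
    then obtain \<nu> where \<nu>: "\<nu> \<in> ball \<mu> \<eta>" "codim_range_le (resolvent_op \<nu> T) n" using neg by blast
    then obtain B where B: "finite B" "card B \<le> n" "cspan (range (resolvent_op \<nu> T) \<union> B) = UNIV"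
      by (auto simp: codim_range_le_def)
    have "card B < card Y" using B Y by simp
    then obtain v0 where v0: "v0 \<in> cspan Y" "v0 \<noteq> 0" "v0 \<in> range (resolvent_op \<nu> T)"
      using independent_meets_range_if_small_codimension[OF R B(1,3) Y(1,3)] by blast
    define v where "v = complex_of_real (1 / norm v0) *\<^sub>C v0"
    have v: "v \<in> cspan Y" "norm v = 1" "v \<in> range (resolvent_op \<nu> T)"
      using v0 complex_vector.subspace_scale[OF csubspace_range[OF R]]
      by (auto simp: v_def norm_scaleC norm_divide intro: complex_vector.span_scale)
    then obtain f where f: "v = resolvent_op \<nu> T f" by blast
    have d: "v - resolvent_op \<mu> T f = (\<nu> - \<mu>) *\<^sub>C f"
      unfolding f resolvent_op_diff ..
    have nd: "norm (v - resolvent_op \<mu> T f) \<le> \<eta> * norm f"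
      unfolding d using \<nu> by (auto simp: norm_scaleC dist_norm norm_minus_commute intro!: mult_right_mono)
    have "c * norm f \<le> 1 + \<eta> * norm f"
      using c(2)[of f] nd v(2) norm_triangle_sub[of "resolvent_op \<mu> T f" v]
      by (simp add: norm_minus_commute)
    also have "\<dots> \<le> 1 + c / 2 * norm f" by (intro add_left_mono mult_right_mono) (auto simp: \<eta>_def)
    finally have "c / 2 * norm f \<le> 1" by simp
    then have "e * (c / 2 * norm f) \<le> e" using e by (simp add: mult_left_le)
    moreover have "\<eta> * norm f \<le> e * c / 2 * norm f" by (intro mult_right_mono) (auto simp: \<eta>_def)
    ultimately have "norm (v - resolvent_op \<mu> T f) \<le> e" using nd by (simp add: mult.assoc)
    then show ?thesis
      using v(1,2) norm_triangle_sub[of v "resolvent_op \<mu> T f"] norm_triangle_sub[of "resolvent_op \<mu> T f" v]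
      by (intro exI[of _ f]) (auto simp: norm_minus_commute)
  qed
  then have "\<forall>k. \<exists>f. \<exists>v. v \<in> cspan Y \<and> norm v = 1 \<and> norm (v - resolvent_op \<mu> T f) \<le> 1 / real (Suc k)"
    by (meson divide_pos_pos of_nat_0_less_iff zero_less_Suc zero_less_one)
  then obtain f where "\<forall>k. \<exists>v. v \<in> cspan Y \<and> norm v = 1 \<and> norm (v - resolvent_op \<mu> T (f k)) \<le> 1 / real (Suc k)"
    by (rule choice[THEN exE])
  then obtain v where vf: "\<forall>k. v k \<in> cspan Y \<and> norm (v k) = 1 \<and> norm (v k - resolvent_op \<mu> T (f k)) \<le> 1 / real (Suc k)"
    by (rule choice[THEN exE])
  then have v: "v k \<in> cspan Y" "norm (v k) \<le> 1" for k by auto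
  obtain l r where l: "l \<in> cspan Y" "strict_mono r" "(v \<circ> r) \<longlonglongrightarrow> l"
    using bounded_cspan_finite_convergent_subsequence[OF Y(1), of v, OF v] by blast
  have "(\<lambda>k. norm ((v \<circ> r) k)) \<longlonglongrightarrow> norm l" by (rule tendsto_norm[OF l(3)])
  then have "norm l = 1" using vf by (simp add: LIMSEQ_const_iff)
  have "(\<lambda>k. v k - resolvent_op \<mu> T (f k)) \<longlonglongrightarrow> 0"
    using vf by (intro Lim_null_comparison[OF _ LIMSEQ_Suc[OF lim_1_over_n]]) (auto intro: always_eventually)
  then have "(\<lambda>k. (v \<circ> r) k - ((\<lambda>k. v k - resolvent_op \<mu> T (f k)) \<circ> r) k) \<longlonglongrightarrow> l - 0"
    by (intro tendsto_diff l(3) LIMSEQ_subseq_LIMSEQ[OF _ l(2)])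
  then have "(\<lambda>k. resolvent_op \<mu> T (f (r k))) \<longlonglongrightarrow> l" by (simp add: o_def)
  moreover have "closed (range (resolvent_op \<mu> T))"
    using upper_semi_Fredholm_if_bounded_below[OF R c] by (simp add: upper_semi_Fredholm_def)
  ultimately have "l \<in> range (resolvent_op \<mu> T)"
    by (rule closed_sequentially[rotated 2]) auto
  then have "l = 0" using Y(4) l(1) by blast
  then show False using \<open>norm l = 1\<close> by simp
qed

text \<open>For every \<open>n\<close>, the conditions that the codimension is at most \<open>n\<close> and that it exceeds \<open>n\<close> are both open.\<close>

lemma not_lower_semi_Fredholm_on_connected:
  fixes T :: "'a::complex_banach \<Rightarrow> 'a"
  assumes T: "bounded_clinear T" and D: "open D" "connected D" "\<mu>\<^sub>0 \<in> D" "\<mu> \<in> D"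
    and low: "\<And>\<nu>. \<nu> \<in> D \<Longrightarrow> \<exists>c>0. \<forall>x. c * norm x \<le> norm (resolvent_op \<nu> T x)"
    and n: "\<And>n. \<not> codim_range_le (resolvent_op \<mu>\<^sub>0 T) n"
  shows "\<not> lower_semi_Fredholm (resolvent_op \<mu> T)"
proof
  assume "lower_semi_Fredholm (resolvent_op \<mu> T)"
  then obtain n where n': "codim_range_le (resolvent_op \<mu> T) n"
    by (auto simp: lower_semi_Fredholm_def codim_range_le_def)
  define O1 where "O1 = {\<nu>\<in>D. codim_range_le (resolvent_op \<nu> T) n}"
  define O2 where "O2 = {\<nu>\<in>D. \<not> codim_range_le (resolvent_op \<nu> T) n}"
  have "open O1"
    unfolding open_contains_ball
  proof
    fix \<nu> assume \<nu>: "\<nu> \<in> O1"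
    then obtain \<eta> where "\<eta> > 0" "\<forall>\<nu>'\<in>ball \<nu> \<eta>. codim_range_le (resolvent_op \<nu>' T) n"
      using codim_range_le_stable[OF T] unfolding O1_def by blast
    moreover obtain \<eta>' where "\<eta>' > 0" "ball \<nu> \<eta>' \<subseteq> D" using D(1) \<nu> by (auto simp: O1_def elim: openE)
    ultimately show "\<exists>e>0. ball \<nu> e \<subseteq> O1"
      by (intro exI[of _ "min \<eta> \<eta>'"]) (auto simp: O1_def subset_iff)
  qed
  moreover have "open O2"
    unfolding open_contains_ball
  proof
    fix \<nu> assume \<nu>: "\<nu> \<in> O2"
    then obtain c where "c > 0" "\<forall>x. c * norm x \<le> norm (resolvent_op \<nu> T x)"
      using low by (auto simp: O2_def)
    then obtain \<eta> where "\<eta> > 0" "\<forall>\<nu>'\<in>ball \<nu> \<eta>. \<not> codim_range_le (resolvent_op \<nu>' T) n"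
      using not_codim_range_le_stable[OF T] \<nu> unfolding O2_def by blast
    moreover obtain \<eta>' where "\<eta>' > 0" "ball \<nu> \<eta>' \<subseteq> D" using D(1) \<nu> by (auto simp: O2_def elim: openE)
    ultimately show "\<exists>e>0. ball \<nu> e \<subseteq> O2"
      by (intro exI[of _ "min \<eta> \<eta>'"]) (auto simp: O2_def subset_iff)
  qed
  moreover have "O1 \<inter> O2 \<inter> D = {}" "D \<subseteq> O1 \<union> O2" "O1 \<inter> D \<noteq> {}" "O2 \<inter> D \<noteq> {}"
    using D(3,4) n n' by (auto simp: O1_def O2_def)
  ultimately show False using D(2) unfolding connected_def by blast
qed


section \<open>Orbits of torus rotations and the cocycle of a weight\<close>

abbreviation torus2 :: "(complex \<times> complex) set"
  where "torus2 \<equiv> sphere 0 1 \<times> sphere 0 1"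

lemma compact_torus2: "compact torus2"
  by (intro compact_Times compact_sphere)

lemma connected_torus2: "connected torus2"
  by (intro connected_Times connected_sphere) simp_all

text \<open>The \<open>n\<close>-th iterate of the rotation by \<open>(a, b)\<close>.\<close>

definition rot :: "complex \<Rightarrow> complex \<Rightarrow> nat \<Rightarrow> complex \<times> complex \<Rightarrow> complex \<times> complex"
  where "rot a b n z = (a ^ n * fst z, b ^ n * snd z)"

lemma rot_0 [simp]: "rot a b 0 z = z"
  by (simp add: rot_def)

lemma rot_rot: "rot a b m (rot a b n z) = rot a b (m + n) z"
  by (simp add: rot_def power_add mult.assoc)

lemma rot_torus2:
  "cmod a = 1 \<Longrightarrow> cmod b = 1 \<Longrightarrow> z \<in> torus2 \<Longrightarrow> rot a b n z \<in> torus2"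
  by (auto simp: rot_def norm_mult norm_power)

lemma rot_image_torus2: "cmod a = 1 \<Longrightarrow> cmod b = 1 \<Longrightarrow> rot a b n ` torus2 \<subseteq> torus2"
  using rot_torus2 by blast

lemma continuous_on_rot: "continuous_on S (rot a b n)"
  unfolding rot_def by (intro continuous_intros)

lemma rot_inverse:
  assumes "cmod a = 1" "cmod b = 1"
  shows "rot (inverse a) (inverse b) n (rot a b n z) = z" "rot a b n (rot (inverse a) (inverse b) n z) = z"
proof -
  have "a \<noteq> 0" "b \<noteq> 0" using assms by auto
  then show "rot (inverse a) (inverse b) n (rot a b n z) = z" "rot a b n (rot (inverse a) (inverse b) n z) = z"
    by (auto simp: rot_def power_inverse simp flip: mult.assoc)
qed

lemma rot_inverse_le:
  assumes "cmod a = 1" "cmod b = 1" "k \<le> n"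
  shows "rot a b k (rot (inverse a) (inverse b) n z) = rot (inverse a) (inverse b) (n - k) z"
proof -
  have "rot (inverse a) (inverse b) n z = rot (inverse a) (inverse b) k (rot (inverse a) (inverse b) (n - k) z)"
    using assms(3) by (simp add: rot_rot)
  then show ?thesis using rot_inverse(2)[OF assms(1,2)] by simp
qed

text \<open>The points \<open>(a\<^sup>n, b\<^sup>n)\<close> accumulate in the compact torus, and quotients of close ones are close to
  \<open>(1, 1)\<close>.\<close>

lemma rot_recurrent:
  assumes ab: "cmod a = 1" "cmod b = 1" and e: "e > 0"
  shows "\<exists>k\<ge>N. \<forall>z\<in>torus2. dist (rot a b k z) z < e"
proof -
  define f where "f n = (a ^ n, b ^ n)" for n
  have "\<forall>n. f n \<in> torus2" using ab by (auto simp: f_def norm_power)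
  then obtain l r where r: "strict_mono r" "(f \<circ> r) \<longlonglongrightarrow> l"
    using compact_torus2 unfolding compact_def by blast
  from LIMSEQ_imp_Cauchy[OF r(2)] have "Cauchy (f \<circ> r)" .
  then obtain M where M: "\<And>m n. m \<ge> M \<Longrightarrow> n \<ge> M \<Longrightarrow> dist ((f \<circ> r) m) ((f \<circ> r) n) < e"
    using e unfolding Cauchy_def by blast
  define k where "k = r (M + N) - r M"
  have rN: "r (M + N) \<ge> r M + N"
  proof (induction N)
    case (Suc N)
    have "r (M + N) < r (M + Suc N)" using r(1) by (simp add: strict_mono_def)
    with Suc show ?case by simp
  qed simp
  have "dist (rot a b k z) z < e" if z: "z \<in> torus2" for z
  proof -
    have 1: "dist (c ^ k * x) x = dist (c ^ r (M + N)) (c ^ r M)" if "cmod c = 1" "cmod x = 1" for c x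
    proof -
      have "c ^ r (M + N) = c ^ k * c ^ r M" using rN by (simp add: k_def flip: power_add)
      then have "dist (c ^ r (M + N)) (c ^ r M) = cmod ((c ^ k - 1) * c ^ r M)"
        by (simp add: dist_norm left_diff_distrib)
      also have "\<dots> = cmod (c ^ k - 1)" using that by (simp add: norm_mult norm_power)
      also have "\<dots> = cmod ((c ^ k - 1) * x)" using that by (simp add: norm_mult)
      finally show ?thesis by (simp add: dist_norm left_diff_distrib)
    qed
    have "dist (rot a b k z) z = dist (f (r (M + N))) (f (r M))"
      using 1[OF ab(1), of "fst z"] 1[OF ab(2), of "snd z"] z
      by (cases z) (auto simp: rot_def f_def dist_Pair_Pair)
    also have "\<dots> < e" using M[of "M + N" M] by simp
    finally show ?thesis .
  qed
  moreover have "k \<ge> N" using rN by (simp add: k_def)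
  ultimately show ?thesis by blast
qed

definition cocycle :: "complex \<Rightarrow> complex \<Rightarrow> (complex \<times> complex \<Rightarrow> complex) \<Rightarrow> nat \<Rightarrow> complex \<times> complex \<Rightarrow> real"
  where "cocycle a b W n z = (\<Prod>k<n. cmod (W (rot a b k z)))"

lemma cocycle_nonneg: "cocycle a b W n z \<ge> 0"
  by (simp add: cocycle_def prod_nonneg)

lemma continuous_on_cocycle:
  assumes "cmod a = 1" "cmod b = 1" "continuous_on torus2 W"
  shows "continuous_on torus2 (cocycle a b W n)"
  unfolding cocycle_def
  by (intro continuous_intros continuous_on_compose2[OF assms(3) continuous_on_rot]
      rot_image_torus2 assms)

text \<open>A backward orbit segment is a forward segment started at its far end.\<close>

lemma cocycle_inverse:
  assumes ab: "cmod a = 1" "cmod b = 1"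
  shows "cocycle (inverse a) (inverse b) W n z = cocycle a b W n (rot (inverse a) (inverse b) (n - 1) z)"
proof -
  have "cocycle a b W n (rot (inverse a) (inverse b) (n - 1) z)
      = (\<Prod>k<n. cmod (W (rot (inverse a) (inverse b) (n - Suc k) z)))"
    unfolding cocycle_def
    by (intro prod.cong refl arg_cong[where f = "\<lambda>x. cmod (W x)"]) (auto simp: rot_inverse_le[OF ab])
  also have "\<dots> = cocycle (inverse a) (inverse b) W n z"
    unfolding cocycle_def by (rule prod.nat_diff_reindex)
  finally show ?thesis ..
qed

text \<open>The sets \<open>A\<close> and \<open>B\<close> of points whose orbits meet \<open>{P > c1}\<close> and \<open>{P < c2}\<close> are open and, as \<open>c1 < c2\<close>,
  cover the torus, so connectedness gives a common point. Recurrence postpones the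
  visit to \<open>{P < c2}\<close> until after the first \<open>n\<close> steps following the visit to \<open>{P > c1}\<close>.\<close>

lemma rise_then_fall:
  assumes ab: "cmod a = 1" "cmod b = 1" and W: "continuous_on torus2 W"
    and c: "c1 < c2"
    and large: "\<exists>t\<in>torus2. c1 < cocycle a b W n t" and small: "\<exists>t\<in>torus2. cocycle a b W n t < c2"
  shows "\<exists>u\<in>torus2. \<exists>d. c1 < cocycle a b W n u \<and> cocycle a b W n (rot a b (n + d) u) < c2"
proof -
  let ?P = "cocycle a b W n"
  define A where "A = {t\<in>torus2. \<exists>i. c1 < ?P (rot a b i t)}"
  define B where "B = {t\<in>torus2. \<exists>i. ?P (rot a b i t) < c2}"
  have cont: "continuous_on torus2 (\<lambda>t. ?P (rot a b i t))" for i
    by (intro continuous_on_compose2[OF continuous_on_cocycle[OF ab W] continuous_on_rot]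
        rot_image_torus2 ab)
  have op: "openin (top_of_set torus2) {t\<in>torus2. ?P (rot a b i t) \<in> V}" if "open V" for i V
    using continuous_openin_preimage_gen[OF cont that, of i] by (simp add: vimage_def Int_def)
  have "openin (top_of_set torus2) A"
  proof -
    have "A = (\<Union>i. {t\<in>torus2. ?P (rot a b i t) \<in> {c1<..}})" by (auto simp: A_def)
    also have "openin (top_of_set torus2) \<dots>"
      using op[of "{c1<..}"] by (intro openin_Union) auto
    finally show ?thesis .
  qed
  moreover have "openin (top_of_set torus2) B"
  proof -
    have "B = (\<Union>i. {t\<in>torus2. ?P (rot a b i t) \<in> {..<c2}})" by (auto simp: B_def)
    also have "openin (top_of_set torus2) \<dots>"
      using op[of "{..<c2}"] by (intro openin_Union) auto
    finally show ?thesis .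
  qed
  moreover have "torus2 \<subseteq> A \<union> B"
  proof
    fix t assume "t \<in> torus2"
    moreover have "c1 < ?P (rot a b 0 t) \<or> ?P (rot a b 0 t) < c2" using c by linarith
    ultimately show "t \<in> A \<union> B" unfolding A_def B_def by blast
  qed
  moreover have "A \<noteq> {}" "B \<noteq> {}"
  proof -
    obtain t t' where "t \<in> torus2" "c1 < ?P (rot a b 0 t)" "t' \<in> torus2" "?P (rot a b 0 t') < c2"
      using large small by auto
    then show "A \<noteq> {}" "B \<noteq> {}" unfolding A_def B_def by blast+
  qed
  ultimately have "A \<inter> B \<noteq> {}"
    using connected_torus2 unfolding connected_openin by blast
  then obtain t i j where t: "t \<in> torus2" "c1 < ?P (rot a b i t)" "?P (rot a b j t) < c2"
    unfolding A_def B_def by blast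
  have "uniformly_continuous_on torus2 ?P"
    by (intro compact_uniformly_continuous continuous_on_cocycle ab W compact_torus2)
  then obtain e where e: "e > 0" "\<And>x y. x \<in> torus2 \<Longrightarrow> y \<in> torus2 \<Longrightarrow> dist y x < e \<Longrightarrow>
      dist (?P y) (?P x) < c2 - ?P (rot a b j t)"
    unfolding uniformly_continuous_on_def using t(3) by (metis diff_gt_0_iff_gt)
  obtain k where k: "k \<ge> i + n" "\<And>z. z \<in> torus2 \<Longrightarrow> dist (rot a b k z) z < e"
    using rot_recurrent[OF ab e(1), of "i + n"] by blast
  (* \<open>k\<close> is at least \<open>i + n\<close>, so no truncation occurs *)
  define d where "d = k + j - i - n"
  have eq: "rot a b (n + d) (rot a b i t) = rot a b k (rot a b j t)"
    using k(1) by (simp add: rot_rot d_def)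
  have "dist (?P (rot a b k (rot a b j t))) (?P (rot a b j t)) < c2 - ?P (rot a b j t)"
    by (intro e k rot_torus2 ab t)
  then have "?P (rot a b (n + d) (rot a b i t)) < c2"
    unfolding eq by (simp add: dist_real_def)
  then show ?thesis using t(2) rot_torus2[OF ab t(1)] by blast
qed


section \<open>Orbit profiles\<close>

text \<open>A finitely supported approximate solution of \<open>W q\<^sub>i \<cdot> y\<^sub>i = \<mu> \<cdot> y\<^sub>i\<^sub>+\<^sub>1\<close> along the orbit of \<open>q\<close>. The error is
  small both in the maximum norm, which governs combinations of peak functions, and in the sum norm,
  which governs combinations of point evaluations.\<close>

definition orbit_profile :: "complex \<Rightarrow> complex \<Rightarrow> (complex \<times> complex \<Rightarrow> complex) \<Rightarrow> complex \<Rightarrow> real \<Rightarrow>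
    complex \<times> complex \<Rightarrow> nat \<Rightarrow> (nat \<Rightarrow> complex) \<Rightarrow> bool"
  where "orbit_profile a b W \<mu> \<epsilon> q L y \<longleftrightarrow> q \<in> torus2 \<and> y 0 = 0 \<and> (\<forall>i>L. y i = 0) \<and>
    (\<forall>i. cmod (y i) \<le> 1) \<and> (\<exists>k\<le>L. cmod (y k) = 1) \<and>
    (\<forall>i. cmod (W (rot a b i q) * y i - \<mu> * y (Suc i)) \<le> \<epsilon>) \<and>
    (\<Sum>i\<le>L. cmod (W (rot a b i q) * y i - \<mu> * y (Suc i))) \<le> \<epsilon> * (\<Sum>i\<le>L. cmod (y i))"

text \<open>Cut the solution off at both ends. The two errors made there are of the size of the end values, which
  are small compared to the maximum if the sequence has risen and fallen by a factor \<open>K\<close>. The profile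
  starts one step before \<open>u\<close>, since it has to begin with \<open>0\<close>.\<close>

lemma orbit_profile_if_bump:
  assumes ab: "cmod a = 1" "cmod b = 1" and u: "u \<in> torus2"
    and C: "\<And>z. z \<in> torus2 \<Longrightarrow> cmod (W z) \<le> C" and K: "K > 0" "(cmod \<mu> + C) / K \<le> \<eta>" and \<eta>: "\<eta> \<ge> 0"
    and Y0: "cmod (Y 0) = 1" and err: "\<And>j. j < N \<Longrightarrow> cmod (W (rot a b j u) * Y j - \<mu> * Y (Suc j)) \<le> \<eta> * cmod (Y j)"
    and rise: "n \<le> N" "K \<le> cmod (Y n)" and fall: "m \<le> N" "K * cmod (Y N) \<le> cmod (Y m)"
  shows "\<exists>q L y. orbit_profile a b W \<mu> (2 * \<eta>) q L y"
proof -
  define q where "q = rot (inverse a) (inverse b) 1 u"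
  have q: "q \<in> torus2" unfolding q_def by (rule rot_torus2) (use ab u in \<open>auto simp: norm_inverse\<close>)
  have rq: "rot a b (Suc j) q = rot a b j u" for j
  proof -
    have "rot a b (Suc j) q = rot a b j (rot a b 1 q)" by (simp add: rot_rot)
    then show ?thesis using rot_inverse(2)[OF ab] by (simp add: q_def)
  qed
  define y0 where "y0 i = (case i of 0 \<Rightarrow> 0 | Suc j \<Rightarrow> if j \<le> N then Y j else 0)" for i
  define M where "M = Max ((\<lambda>i. cmod (y0 i)) ` {..Suc N})"
  have y0M: "cmod (y0 i) \<le> M" if "i \<le> Suc N" for i
    unfolding M_def using that by (intro Max_ge) auto
  have "M \<in> (\<lambda>i. cmod (y0 i)) ` {..Suc N}" unfolding M_def by (intro Max_in) auto
  then obtain k where k: "k \<le> Suc N" "cmod (y0 k) = M" by auto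
  have MK: "K \<le> M" using y0M[of "Suc n"] rise by (simp add: y0_def)
  then have M: "M > 0" using K by simp
  have YN: "cmod (Y N) \<le> M / K"
    using y0M[of "Suc m"] fall K(1) by (simp add: y0_def field_simps)
  have C0: "C \<ge> 0" using C[OF u] by (meson norm_ge_zero order_trans)
  define \<beta> where "\<beta> i = \<eta> * cmod (y0 i) + (if i = 0 then cmod \<mu> * (M / K) else 0) +
      (if i = Suc N then C * (M / K) else 0)" for i
  have e0: "cmod (W (rot a b i q) * y0 i - \<mu> * y0 (Suc i)) \<le> \<beta> i" for i
  proof (cases i)
    case 0
    have "cmod \<mu> * 1 \<le> cmod \<mu> * (M / K)" using MK K(1) by (intro mult_left_mono) auto
    then show ?thesis using Y0 0 by (simp add: \<beta>_def y0_def norm_mult)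
  next
    case (Suc j)
    consider "j < N" | "j = N" | "j > N" by linarith
    then show ?thesis
    proof cases
      case 1
      then show ?thesis using err[of j] Suc by (simp add: \<beta>_def y0_def rq)
    next
      case 2
      have "cmod (W (rot a b N u)) * cmod (Y N) \<le> C * (M / K)"
        using C[OF rot_torus2[OF ab u]] YN C0 by (intro mult_mono) auto
      then show ?thesis using 2 Suc \<eta> by (simp add: \<beta>_def y0_def rq norm_mult add_increasing)
    next
      case 3
      then show ?thesis using Suc by (simp add: \<beta>_def y0_def)
    qed
  qed
  have K2: "cmod \<mu> * (M / K) + C * (M / K) \<le> \<eta> * M"
    using mult_right_mono[OF K(2), of M] M by (simp add: field_simps add_divide_distrib)
  have "cmod \<mu> * (M / K) \<ge> 0" "C * (M / K) \<ge> 0" using M K(1) C0 by auto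
  then have \<beta>M: "\<beta> i \<le> 2 * \<eta> * M" for i
  proof (cases "i \<le> Suc N")
    case True
    have "\<eta> * cmod (y0 i) \<le> \<eta> * M" using \<eta> y0M[OF True] by (intro mult_left_mono)
    moreover have "2 * \<eta> * M = \<eta> * M + \<eta> * M" by simp
    ultimately show ?thesis using K2 \<open>cmod \<mu> * (M / K) \<ge> 0\<close> \<open>C * (M / K) \<ge> 0\<close>
      by (auto simp: \<beta>_def simp del: times_divide_eq_right)
  next
    case False
    then have "y0 i = 0" by (auto simp: y0_def split: nat.split)
    then show ?thesis using False \<eta> M by (simp add: \<beta>_def)
  qed
  define y where "y i = y0 i / of_real M" for i
  have ye: "cmod (W (rot a b i q) * y i - \<mu> * y (Suc i)) = cmod (W (rot a b i q) * y0 i - \<mu> * y0 (Suc i)) / M" for i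
  proof -
    have "W (rot a b i q) * y i - \<mu> * y (Suc i) = (W (rot a b i q) * y0 i - \<mu> * y0 (Suc i)) / of_real M"
      by (simp add: y_def diff_divide_distrib)
    then show ?thesis using M by (simp add: norm_divide)
  qed
  have yn: "cmod (y i) = cmod (y0 i) / M" for i using M by (simp add: y_def norm_divide)
  have "(\<Sum>i\<le>Suc N. \<beta> i) = \<eta> * (\<Sum>i\<le>Suc N. cmod (y0 i)) + cmod \<mu> * (M / K) + C * (M / K)"
    by (simp add: \<beta>_def sum.distrib sum_distrib_left sum.delta del: sum.atMost_Suc)
  also have "\<dots> \<le> \<eta> * (\<Sum>i\<le>Suc N. cmod (y0 i)) + \<eta> * M" using K2 by simp
  also have "M \<le> (\<Sum>i\<le>Suc N. cmod (y0 i))"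
    using member_le_sum[of k "{..Suc N}" "\<lambda>i. cmod (y0 i)"] k by auto
  finally have sum\<beta>: "(\<Sum>i\<le>Suc N. \<beta> i) \<le> 2 * \<eta> * (\<Sum>i\<le>Suc N. cmod (y0 i))"
    using \<eta> by (simp add: mult_left_mono)
  have "orbit_profile a b W \<mu> (2 * \<eta>) q (Suc N) y"
    unfolding orbit_profile_def
  proof (intro conjI allI impI)
    show "q \<in> torus2" by (rule q)
    show "y 0 = 0" by (simp add: y_def y0_def)
    show y_out: "y i = 0" if "Suc N < i" for i
      using that by (cases i) (auto simp: y_def y0_def)
    show "cmod (y i) \<le> 1" for i
      using y0M[of i] y_out[of i] M by (cases "i \<le> Suc N") (auto simp: yn)
    show "\<exists>k\<le>Suc N. cmod (y k) = 1" using k M by (auto simp: yn)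
    show "cmod (W (rot a b i q) * y i - \<mu> * y (Suc i)) \<le> 2 * \<eta>" for i
      unfolding ye pos_divide_le_eq[OF M] using order_trans[OF e0 \<beta>M, of i] .
    have "(\<Sum>i\<le>Suc N. cmod (W (rot a b i q) * y0 i - \<mu> * y0 (Suc i))) \<le> 2 * \<eta> * (\<Sum>i\<le>Suc N. cmod (y0 i))"
      by (rule order_trans[OF sum_mono sum\<beta>]) (rule e0)
    then have "(\<Sum>i\<le>Suc N. cmod (W (rot a b i q) * y0 i - \<mu> * y0 (Suc i))) / M
        \<le> 2 * \<eta> * (\<Sum>i\<le>Suc N. cmod (y0 i)) / M"
      using M by (intro divide_right_mono) auto
    then show "(\<Sum>i\<le>Suc N. cmod (W (rot a b i q) * y i - \<mu> * y (Suc i))) \<le> 2 * \<eta> * (\<Sum>i\<le>Suc N. cmod (y i))"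
      unfolding ye yn sum_divide_distrib[symmetric] by simp
  qed
  then show ?thesis by blast
qed

text \<open>On a stretch where \<open>P n\<close> is not much smaller than \<open>\<bar>\<mu>\<bar>\<^sup>n\<close>, multiplying every factor by \<open>(1 + \<delta>)\<^sup>2\<close> makes
  the products of \<open>W / \<mu>\<close> grow by \<open>(1 + \<delta>)\<^sup>n\<close>; dividing makes them decay on a stretch where \<open>P n\<close> is not
  much larger. A rise followed by a fall gives a bump, and the modified factors cost only an error
  proportional to \<open>\<delta>\<close>.\<close>

lemma orbit_profile_exists:
  assumes ab: "cmod a = 1" "cmod b = 1" and W: "continuous_on torus2 W" and \<mu>: "\<mu> \<noteq> 0"
    and large: "\<And>n. \<exists>t\<in>torus2. cmod \<mu> ^ n \<le> cocycle a b W n t"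
    and small: "\<And>n. \<exists>t\<in>torus2. cocycle a b W n t \<le> cmod \<mu> ^ n"
    and \<epsilon>: "\<epsilon> > 0"
  shows "\<exists>q L y. orbit_profile a b W \<mu> \<epsilon> q L y"
proof -
  define r where "r = cmod \<mu>"
  have r: "r > 0" using \<mu> by (simp add: r_def)
  have "bounded (W ` torus2)"
    by (intro compact_imp_bounded compact_continuous_image W compact_torus2)
  then obtain C where C: "C > 0" "\<And>z. z \<in> torus2 \<Longrightarrow> cmod (W z) \<le> C"
    unfolding bounded_pos by blast
  (* changing a factor by \<open>(1 + \<delta>)\<^sup>2\<close> costs a relative error of at most \<open>3 * \<delta>\<close>, and the factors are at most \<open>C\<close> *)
  define \<delta> where "\<delta> = min 1 (\<epsilon> / (6 * C))"
  have \<delta>: "\<delta> > 0" "\<delta> \<le> 1" "3 * \<delta> * C \<le> \<epsilon> / 2"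
    using \<epsilon> C by (auto simp: \<delta>_def min_def field_simps)
  define K where "K = max 2 ((r + C) / (\<epsilon> / 2))"
  have K: "K > 1" "(r + C) / K \<le> \<epsilon> / 2"
    using r C \<epsilon> by (auto simp: K_def max_def field_simps)
  obtain n where n: "K < (1 + \<delta>) ^ n" using real_arch_pow[of "1 + \<delta>" K] \<delta> by auto
  have "n \<noteq> 0" using n K(1) by (intro notI) simp
  have pos: "r / (1 + \<delta>) > 0" "r / (1 + \<delta>) < r" "r < r * (1 + \<delta>)" using r \<delta> by (auto simp: field_simps)
  have c12: "(r / (1 + \<delta>)) ^ n < r ^ n" "r ^ n < (r * (1 + \<delta>)) ^ n"
    using pos r \<open>n \<noteq> 0\<close> by (auto intro!: power_strict_mono)
  have "\<exists>u\<in>torus2. \<exists>d. (r / (1 + \<delta>)) ^ n < cocycle a b W n u \<and>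
      cocycle a b W n (rot a b (n + d) u) < (r * (1 + \<delta>)) ^ n"
    by (rule rise_then_fall[OF ab W])
      (use c12 large[of n] small[of n] in \<open>auto simp: r_def intro: less_le_trans le_less_trans\<close>)
  then obtain u d where u: "u \<in> torus2" "(r / (1 + \<delta>)) ^ n < cocycle a b W n u"
      "cocycle a b W n (rot a b (n + d) u) < (r * (1 + \<delta>)) ^ n" by blast
  define s where "s k = (if k < n then (1 + \<delta>)\<^sup>2 else if n + d \<le> k then 1 / (1 + \<delta>)\<^sup>2 else 1)" for k
  have s1: "\<bar>1 - s k\<bar> \<le> 3 * \<delta>" for k
  proof -
    have d2: "\<delta>\<^sup>2 \<le> \<delta>" using \<delta> by (simp add: power2_eq_square mult_left_le)
    have "(1 + \<delta>)\<^sup>2 - 1 = 2 * \<delta> + \<delta>\<^sup>2" by (simp add: power2_eq_square algebra_simps)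
    then have 1: "(1 + \<delta>)\<^sup>2 - 1 \<le> 3 * \<delta>" "(1 + \<delta>)\<^sup>2 \<ge> 1" using d2 \<delta> by auto
    have "1 - 1 / (1 + \<delta>)\<^sup>2 \<le> (1 + \<delta>)\<^sup>2 - 1"
      using 1(2) mult_mono[of 1 "(1 + \<delta>)\<^sup>2" 1 "(1 + \<delta>)\<^sup>2"] sum_squares_ge_zero
        zero_le_power2[of "(1 + \<delta>)\<^sup>2 - 1"]
      by (simp add: field_simps power2_eq_square)
    moreover have "0 < (1 + \<delta>)\<^sup>2" using 1(2) by linarith
    then have "1 / (1 + \<delta>)\<^sup>2 \<le> 1" using 1(2) by (simp only: divide_le_eq_1_pos)
    ultimately show ?thesis using 1 \<delta> by (auto simp: s_def)
  qed
  define Y where "Y j = (\<Prod>k<j. of_real (s k) * W (rot a b k u) / \<mu>)" for j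
  have sp: "s k > 0" for k using \<delta> by (auto simp: s_def)
  have Yn: "cmod (Y j) = (\<Prod>k<j. s k * cmod (W (rot a b k u)) / r)" for j
    using sp by (simp add: Y_def r_def norm_mult norm_divide less_imp_le flip: prod_norm)
  have "cmod (Y n) = ((1 + \<delta>)\<^sup>2 / r) ^ n * cocycle a b W n u"
  proof -
    have "cmod (Y n) = (\<Prod>k<n. (1 + \<delta>)\<^sup>2 / r * cmod (W (rot a b k u)))"
      unfolding Yn by (intro prod.cong) (auto simp: s_def)
    then show ?thesis by (simp add: prod.distrib cocycle_def del: times_divide_eq_left)
  qed
  also have "\<dots> \<ge> ((1 + \<delta>)\<^sup>2 / r) ^ n * (r / (1 + \<delta>)) ^ n"
    using u(2) r by (intro mult_left_mono) auto
  also have "((1 + \<delta>)\<^sup>2 / r) ^ n * (r / (1 + \<delta>)) ^ n = (1 + \<delta>) ^ n"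
    unfolding power_mult_distrib[symmetric] using r \<delta> by (simp add: power2_eq_square)
  finally have rise: "K \<le> cmod (Y n)" using n by simp
  define N where "N = n + d + n"
  have split: "(\<Prod>k<p + m. g k) = (\<Prod>k<p. g k) * (\<Prod>k<m. g (p + k))" for g :: "nat \<Rightarrow> real" and p m
    by (induction m) (auto simp: mult.assoc)
  have "cmod (Y N) = cmod (Y (n + d)) * ((1 / ((1 + \<delta>)\<^sup>2 * r)) ^ n * cocycle a b W n (rot a b (n + d) u))"
  proof -
    have "cmod (Y N) = cmod (Y (n + d)) * (\<Prod>k<n. s (n + d + k) * cmod (W (rot a b (n + d + k) u)) / r)"
      unfolding Yn N_def by (rule split) 
    also have "(\<Prod>k<n. s (n + d + k) * cmod (W (rot a b (n + d + k) u)) / r) =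
        (\<Prod>k<n. (1 / ((1 + \<delta>)\<^sup>2 * r)) * cmod (W (rot a b k (rot a b (n + d) u))))"
      by (intro prod.cong) (auto simp: s_def rot_rot add_ac)
    finally show ?thesis by (simp only: prod.distrib prod_constant card_lessThan cocycle_def)
  qed
  also have "\<dots> \<le> cmod (Y (n + d)) * ((1 / ((1 + \<delta>)\<^sup>2 * r)) ^ n * (r * (1 + \<delta>)) ^ n)"
    using u(3) r by (intro mult_left_mono) auto
  also have "(1 / ((1 + \<delta>)\<^sup>2 * r)) ^ n * (r * (1 + \<delta>)) ^ n = 1 / (1 + \<delta>) ^ n"
  proof -
    have "1 / ((1 + \<delta>)\<^sup>2 * r) * (r * (1 + \<delta>)) = 1 / (1 + \<delta>)"
      using r \<delta> by (simp add: power2_eq_square)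
    then show ?thesis unfolding power_mult_distrib[symmetric] by (simp add: power_one_over)
  qed
  finally have "(1 + \<delta>) ^ n * cmod (Y N) \<le> cmod (Y (n + d))"
    using \<delta> by (simp add: field_simps)
  then have fall: "K * cmod (Y N) \<le> cmod (Y (n + d))"
    using n mult_right_mono[of K "(1 + \<delta>) ^ n" "cmod (Y N)"] by simp
  have "\<exists>q L y. orbit_profile a b W \<mu> (2 * (\<epsilon> / 2)) q L y"
  proof (rule orbit_profile_if_bump[OF ab u(1) C(2), where K = K and Y = Y and N = N and n = n and m = "n + d"])
    show "cmod (W (rot a b j u) * Y j - \<mu> * Y (Suc j)) \<le> \<epsilon> / 2 * cmod (Y j)" for j
    proof -
      have "W (rot a b j u) * Y j - \<mu> * Y (Suc j) = of_real (1 - s j) * W (rot a b j u) * Y j"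
        using \<mu> by (simp add: Y_def algebra_simps)
      then have "cmod (W (rot a b j u) * Y j - \<mu> * Y (Suc j)) = \<bar>1 - s j\<bar> * cmod (W (rot a b j u)) * cmod (Y j)"
        by (simp add: norm_mult del: of_real_diff)
      also have "\<dots> \<le> 3 * \<delta> * C * cmod (Y j)"
        using s1[of j] C rot_torus2[OF ab u(1)] \<delta> by (intro mult_right_mono mult_mono) auto
      also have "\<dots> \<le> \<epsilon> / 2 * cmod (Y j)" using \<delta>(3) by (intro mult_right_mono) auto
      finally show ?thesis .
    qed
  qed (use K rise fall \<epsilon> in \<open>auto simp: r_def N_def Y_def\<close>)
  then show ?thesis by simp
qed

text \<open>For \<open>\<mu> = 0\<close> a single point mass at a zero of the weight is an exact solution.\<close>

lemma orbit_profile_at_zero: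
  assumes ab: "cmod a = 1" "cmod b = 1" and t: "t \<in> torus2" "W t = 0" and "\<epsilon> \<ge> 0"
  shows "\<exists>q L y. orbit_profile a b W 0 \<epsilon> q L y"
proof -
  define q where "q = rot (inverse a) (inverse b) 1 t"
  have "q \<in> torus2" unfolding q_def by (rule rot_torus2) (use ab t in \<open>auto simp: norm_inverse\<close>)
  moreover have "rot a b 1 q = t" unfolding q_def by (rule rot_inverse(2)[OF ab])
  ultimately have "orbit_profile a b W 0 \<epsilon> q 1 (\<lambda>i. if i = 1 then 1 else 0)"
    using assms(4,5) by (auto simp: orbit_profile_def)
  then show ?thesis by blast
qed

text \<open>Reading a profile of the inverse rotation backwards turns \<open>W q\<^sub>i \<cdot> y\<^sub>i = \<mu> \<cdot> y\<^sub>i\<^sub>+\<^sub>1\<close> into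
  \<open>W q\<^sub>i \<cdot> y\<^sub>i\<^sub>+\<^sub>1 = \<mu> \<cdot> y\<^sub>i\<close>, the eigenvector equation of the operator instead of that of its adjoint.\<close>

lemma reversed_orbit_profile:
  assumes ab: "cmod a = 1" "cmod b = 1" and p: "orbit_profile (inverse a) (inverse b) W \<mu> \<epsilon> q L y"
  shows "\<exists>q\<in>torus2. \<exists>y. y 0 = 0 \<and> y (Suc L) = 0 \<and> (\<exists>k\<le>L. cmod (y k) = 1) \<and>
    (\<forall>i\<le>L. cmod (W (rot a b i q) * y (Suc i) - \<mu> * y i) \<le> \<epsilon>)"
proof -
  note p = p[unfolded orbit_profile_def]
  define q' where "q' = rot (inverse a) (inverse b) L q"
  have q': "q' \<in> torus2" unfolding q'_def by (rule rot_torus2) (use ab p in \<open>auto simp: norm_inverse\<close>)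
  have rq: "rot a b i q' = rot (inverse a) (inverse b) (L - i) q" if "i \<le> L" for i
    unfolding q'_def using rot_inverse_le[OF ab that] .
  have e: "cmod (W (rot a b i q') * y (Suc L - Suc i) - \<mu> * y (Suc L - i)) \<le> \<epsilon>" if "i \<le> L" for i
    using p that by (simp add: rq Suc_diff_le)
  obtain k where k: "k \<le> L" "cmod (y k) = 1" using p by blast
  then have "k \<noteq> 0" using p by (intro notI) simp
  then have "Suc L - k \<le> L" "Suc L - (Suc L - k) = k" using k(1) by auto
  then show ?thesis
    using p q' k e by (intro bexI[of _ q'] exI[of _ "\<lambda>i. y (Suc L - i)"]) (auto intro!: exI[of _ "Suc L - k"])
qed


section \<open>Growth rates of the cocycle\<close>

lemma cocycle_add:
  "cocycle a b W (n + k) t = cocycle a b W n t * cocycle a b W k (rot a b n t)"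
  by (induction k) (simp_all add: cocycle_def rot_rot add.commute mult.assoc)

lemma cocycle_mult_ge:
  assumes ab: "cmod a = 1" "cmod b = 1" and s: "\<And>t. t \<in> torus2 \<Longrightarrow> s \<le> cocycle a b W n t" "0 \<le> s"
    and t: "t \<in> torus2"
  shows "s ^ m \<le> cocycle a b W (n * m) t"
  using t
proof (induction m arbitrary: t)
  case (Suc m)
  have "s * s ^ m \<le> cocycle a b W n t * cocycle a b W (n * m) (rot a b n t)"
    using s Suc rot_torus2[OF ab] by (intro mult_mono cocycle_nonneg) auto
  then show ?case by (simp add: cocycle_add)
qed (simp add: cocycle_def)

lemma cocycle_mult_le:
  assumes ab: "cmod a = 1" "cmod b = 1" and s: "\<And>t. t \<in> torus2 \<Longrightarrow> cocycle a b W n t \<le> s"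
    and t: "t \<in> torus2"
  shows "cocycle a b W (n * m) t \<le> s ^ m"
  using t
proof (induction m arbitrary: t)
  case (Suc m)
  have "0 \<le> s" using order_trans[OF cocycle_nonneg s[OF t]] .
  then have "cocycle a b W n t * cocycle a b W (n * m) (rot a b n t) \<le> s * s ^ m"
    using s Suc rot_torus2[OF ab] by (intro mult_mono cocycle_nonneg) auto
  then show ?case by (simp add: cocycle_add)
qed (simp add: cocycle_def)

text \<open>With \<open>P n\<close> for the cocycle this is the infimum of the \<open>n\<close>-th roots of \<open>max P n\<close>, and by submultiplicativity their
  limit; written as a supremum it matches the condition under which orbit profiles exist.\<close>

definition upper_rate :: "complex \<Rightarrow> complex \<Rightarrow> (complex \<times> complex \<Rightarrow> complex) \<Rightarrow> real"
  where "upper_rate a b W = Sup {r. 0 \<le> r \<and> (\<forall>n. \<exists>t\<in>torus2. r ^ n \<le> cocycle a b W n t)}"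

definition lower_rate :: "complex \<Rightarrow> complex \<Rightarrow> (complex \<times> complex \<Rightarrow> complex) \<Rightarrow> real"
  where "lower_rate a b W = Inf {r. 0 \<le> r \<and> (\<forall>n. \<exists>t\<in>torus2. cocycle a b W n t \<le> r ^ n)}"

context
  fixes a b :: complex and W :: "complex \<times> complex \<Rightarrow> complex"
  assumes ab: "cmod a = 1" "cmod b = 1" and W: "continuous_on torus2 W"
begin

lemma cocycle_attains:
  "\<exists>t\<in>torus2. \<forall>t'\<in>torus2. cocycle a b W n t' \<le> cocycle a b W n t"
  "\<exists>t\<in>torus2. \<forall>t'\<in>torus2. cocycle a b W n t \<le> cocycle a b W n t'"
proof -
  have "torus2 \<noteq> {}" by (auto simp: ex_in_conv[symmetric] intro!: exI[of _ 1])
  then show "\<exists>t\<in>torus2. \<forall>t'\<in>torus2. cocycle a b W n t' \<le> cocycle a b W n t"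
    "\<exists>t\<in>torus2. \<forall>t'\<in>torus2. cocycle a b W n t \<le> cocycle a b W n t'"
    using continuous_attains_sup[OF compact_torus2 _ continuous_on_cocycle[OF ab W]]
      continuous_attains_inf[OF compact_torus2 _ continuous_on_cocycle[OF ab W]] by blast+
qed

lemma le_upper_rate_iff:
  assumes r: "0 \<le> r"
  shows "r \<le> upper_rate a b W \<longleftrightarrow> (\<forall>n. \<exists>t\<in>torus2. r ^ n \<le> cocycle a b W n t)"
proof -
  let ?I = "{r. 0 \<le> r \<and> (\<forall>n. \<exists>t\<in>torus2. r ^ n \<le> cocycle a b W n t)}"
  obtain t0 where t0: "t0 \<in> torus2" "\<And>t. t \<in> torus2 \<Longrightarrow> cocycle a b W 1 t \<le> cocycle a b W 1 t0"
    using cocycle_attains(1) by blast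
  have bdd: "bdd_above ?I"
  proof (rule bdd_aboveI)
    fix r assume "r \<in> ?I"
    then obtain t where "t \<in> torus2" "r ^ 1 \<le> cocycle a b W 1 t" by blast
    then show "r \<le> cocycle a b W 1 t0" using t0(2)[of t] by simp
  qed
  have "0 ^ n \<le> cocycle a b W n t0" for n
    by (cases n) (simp add: cocycle_def, simp add: cocycle_nonneg)
  then have 0: "0 \<in> ?I" using t0(1) by blast
  have R0: "0 \<le> upper_rate a b W" unfolding upper_rate_def by (rule cSup_upper[OF 0 bdd])
  have top: "\<exists>t\<in>torus2. upper_rate a b W ^ n \<le> cocycle a b W n t" for n
  proof (cases "n = 0")
    case True
    then show ?thesis using t0(1) by (intro bexI[of _ t0]) (auto simp: cocycle_def)
  next
    case False
    obtain t where t: "t \<in> torus2" "\<And>t'. t' \<in> torus2 \<Longrightarrow> cocycle a b W n t' \<le> cocycle a b W n t"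
      using cocycle_attains(1) by blast
    have "upper_rate a b W \<le> root n (cocycle a b W n t)"
      unfolding upper_rate_def
    proof (rule cSup_least)
      fix r assume "r \<in> ?I"
      then obtain t' where "0 \<le> r" "t' \<in> torus2" "r ^ n \<le> cocycle a b W n t'" by blast
      then have "r ^ n \<le> cocycle a b W n t" using t(2) order_trans by blast
      then have "root n (r ^ n) \<le> root n (cocycle a b W n t)" using False by simp
      then show "r \<le> root n (cocycle a b W n t)"
        using False \<open>0 \<le> r\<close> by (simp add: real_root_power_cancel)
    qed (use 0 in blast)
    then have "upper_rate a b W ^ n \<le> root n (cocycle a b W n t) ^ n" by (intro power_mono R0)
    then show ?thesis using False t(1) cocycle_nonneg[of a b W n t]
      by (intro bexI[of _ t]) (auto simp: real_root_pow_pos2)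
  qed
  show ?thesis
  proof
    assume le: "r \<le> upper_rate a b W"
    show "\<forall>n. \<exists>t\<in>torus2. r ^ n \<le> cocycle a b W n t"
    proof
      fix n
      obtain t where "t \<in> torus2" "upper_rate a b W ^ n \<le> cocycle a b W n t" using top by blast
      then show "\<exists>t\<in>torus2. r ^ n \<le> cocycle a b W n t"
        using power_mono[OF le r, of n] by (intro bexI[of _ t]) auto
    qed
  next
    assume "\<forall>n. \<exists>t\<in>torus2. r ^ n \<le> cocycle a b W n t"
    then show "r \<le> upper_rate a b W"
      unfolding upper_rate_def using r by (intro cSup_upper[OF _ bdd]) blast
  qed
qed

lemma lower_rate_le_iff:
  assumes r: "0 \<le> r"
  shows "lower_rate a b W \<le> r \<longleftrightarrow> (\<forall>n. \<exists>t\<in>torus2. cocycle a b W n t \<le> r ^ n)"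
    and "0 \<le> lower_rate a b W"
proof -
  let ?J = "{r. 0 \<le> r \<and> (\<forall>n. \<exists>t\<in>torus2. cocycle a b W n t \<le> r ^ n)}"
  obtain t0 where t0: "t0 \<in> torus2" "\<And>t. t \<in> torus2 \<Longrightarrow> cocycle a b W 1 t \<le> cocycle a b W 1 t0"
    using cocycle_attains(1) by blast
  have bdd: "bdd_below ?J" by (rule bdd_belowI[of _ 0]) blast
  have "cocycle a b W n t0 \<le> cocycle a b W 1 t0 ^ n" for n
    using cocycle_mult_le[OF ab t0(2) t0(1), of n] by simp
  then have C: "cocycle a b W 1 t0 \<in> ?J" using t0(1) cocycle_nonneg by blast
  show R0: "0 \<le> lower_rate a b W"
    unfolding lower_rate_def by (rule cInf_greatest) (use C in blast)+
  have bot: "\<exists>t\<in>torus2. cocycle a b W n t \<le> lower_rate a b W ^ n" for n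
  proof (cases "n = 0")
    case True
    then show ?thesis using t0(1) by (intro bexI[of _ t0]) (auto simp: cocycle_def)
  next
    case False
    obtain t where t: "t \<in> torus2" "\<And>t'. t' \<in> torus2 \<Longrightarrow> cocycle a b W n t \<le> cocycle a b W n t'"
      using cocycle_attains(2) by blast
    have "root n (cocycle a b W n t) \<le> lower_rate a b W"
      unfolding lower_rate_def
    proof (rule cInf_greatest)
      fix r assume "r \<in> ?J"
      then obtain t' where "0 \<le> r" "t' \<in> torus2" "cocycle a b W n t' \<le> r ^ n" by blast
      then have "cocycle a b W n t \<le> r ^ n" using t(2) order_trans by blast
      then have "root n (cocycle a b W n t) \<le> root n (r ^ n)" using False by simp
      then show "root n (cocycle a b W n t) \<le> r"
        using False \<open>0 \<le> r\<close> by (simp add: real_root_power_cancel)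
    qed (use C in blast)
    then have "root n (cocycle a b W n t) ^ n \<le> lower_rate a b W ^ n"
      by (intro power_mono real_root_ge_zero cocycle_nonneg)
    then show ?thesis using False t(1) cocycle_nonneg[of a b W n t]
      by (intro bexI[of _ t]) (auto simp: real_root_pow_pos2)
  qed
  show "lower_rate a b W \<le> r \<longleftrightarrow> (\<forall>n. \<exists>t\<in>torus2. cocycle a b W n t \<le> r ^ n)"
  proof
    assume le: "lower_rate a b W \<le> r"
    show "\<forall>n. \<exists>t\<in>torus2. cocycle a b W n t \<le> r ^ n"
    proof
      fix n
      obtain t where "t \<in> torus2" "cocycle a b W n t \<le> lower_rate a b W ^ n" using bot by blast
      then show "\<exists>t\<in>torus2. cocycle a b W n t \<le> r ^ n"
        using power_mono[OF le R0, of n] by (intro bexI[of _ t]) auto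
    qed
  next
    assume "\<forall>n. \<exists>t\<in>torus2. cocycle a b W n t \<le> r ^ n"
    then show "lower_rate a b W \<le> r"
      unfolding lower_rate_def using r by (intro cInf_lower[OF _ bdd]) blast
  qed
qed

lemma upper_rate_nonneg: "0 \<le> upper_rate a b W"
proof -
  obtain t0 where t0: "t0 \<in> torus2" using cocycle_attains(1)[of 0] by blast
  have "0 ^ n \<le> cocycle a b W n t0" for n
    by (cases n) (simp add: cocycle_def, simp add: cocycle_nonneg)
  then show ?thesis using le_upper_rate_iff[of 0] t0 by blast
qed

text \<open>Otherwise \<open>P n > R\<^sup>n\<close> on the torus for some \<open>n\<close>, and by multiplicativity the products grow at a rate
  exceeding the upper rate \<open>R\<close>.\<close>

lemma lower_rate_le_upper_rate: "lower_rate a b W \<le> upper_rate a b W"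
proof (rule ccontr)
  let ?R = "upper_rate a b W"
  assume "\<not> lower_rate a b W \<le> ?R"
  then obtain n where "\<forall>t\<in>torus2. \<not> cocycle a b W n t \<le> ?R ^ n"
    unfolding lower_rate_le_iff(1)[OF upper_rate_nonneg] by blast
  then have n: "?R ^ n < cocycle a b W n t" if "t \<in> torus2" for t using that by (meson not_le)
  obtain t0 where t0: "t0 \<in> torus2" "\<And>t. t \<in> torus2 \<Longrightarrow> cocycle a b W n t0 \<le> cocycle a b W n t"
    using cocycle_attains(2) by blast
  have n0: "n \<noteq> 0" using n[OF t0(1)] by (intro notI) (simp add: cocycle_def)
  define r where "r = root n (cocycle a b W n t0)"
  have r: "0 \<le> r" "r ^ n = cocycle a b W n t0"
    using n0 cocycle_nonneg[of a b W n t0] by (auto simp: r_def real_root_pow_pos2)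
  have "r \<le> ?R"
    unfolding le_upper_rate_iff[OF r(1)]
  proof (rule ccontr)
    assume "\<not> (\<forall>m. \<exists>t\<in>torus2. r ^ m \<le> cocycle a b W m t)"
    then obtain m where "\<forall>t\<in>torus2. \<not> r ^ m \<le> cocycle a b W m t" by blast
    then have m: "cocycle a b W m t < r ^ m" if "t \<in> torus2" for t using that by (meson not_le)
    obtain t1 where t1: "t1 \<in> torus2" "\<And>t. t \<in> torus2 \<Longrightarrow> cocycle a b W m t \<le> cocycle a b W m t1"
      using cocycle_attains(1) by blast
    have "(r ^ n) ^ m \<le> cocycle a b W (n * m) t0"
      unfolding r(2) by (rule cocycle_mult_ge[OF ab t0(2) cocycle_nonneg t0(1)])
    also have "\<dots> = cocycle a b W (m * n) t0" by (simp add: mult.commute)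
    also have "\<dots> \<le> cocycle a b W m t1 ^ n" by (rule cocycle_mult_le[OF ab t1(2) t0(1)])
    also have "\<dots> < (r ^ m) ^ n"
      using m[OF t1(1)] n0 by (intro power_strict_mono cocycle_nonneg) auto
    finally show False by (simp add: mult.commute flip: power_mult)
  qed
  then have "r ^ n \<le> ?R ^ n" using r(1) by (intro power_mono)
  then show False using n[OF t0(1)] r(2) by simp
qed

lemma lower_rate_eq_0_if_zero:
  assumes "t \<in> torus2" "W t = 0"
  shows "lower_rate a b W = 0"
proof -
  have "cocycle a b W n t \<le> 0 ^ n" for n
  proof (cases n)
    case (Suc m)
    have "cocycle a b W n t = 0"
      unfolding cocycle_def Suc by (rule prod_zero) (use assms in \<open>auto intro!: bexI[of _ 0]\<close>)
    then show ?thesis using Suc by simp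
  qed (simp add: cocycle_def)
  then have "lower_rate a b W \<le> 0" using lower_rate_le_iff(1)[of 0] assms(1) by blast
  then show ?thesis using lower_rate_le_iff(2)[of 0] by simp
qed

lemma lower_rate_pos_if_no_zero:
  assumes "\<And>t. t \<in> torus2 \<Longrightarrow> W t \<noteq> 0"
  shows "0 < lower_rate a b W"
proof (rule ccontr)
  assume "\<not> 0 < lower_rate a b W"
  then have "\<forall>n. \<exists>t\<in>torus2. cocycle a b W n t \<le> 0 ^ n" using lower_rate_le_iff(1)[of 0] by simp
  then obtain t where "t \<in> torus2" "cocycle a b W 1 t \<le> 0 ^ 1" by blast
  then show False using assms[of t] by (simp add: cocycle_def)
qed

lemma above_upper_rate:
  assumes "upper_rate a b W < r"
  shows "\<exists>n s. 0 \<le> s \<and> s < r ^ n \<and> (\<forall>t\<in>torus2. cocycle a b W n t \<le> s)"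
proof -
  have r: "0 \<le> r" using assms upper_rate_nonneg by linarith
  obtain n where n: "\<And>t. t \<in> torus2 \<Longrightarrow> cocycle a b W n t < r ^ n"
    using assms le_upper_rate_iff[OF r] by (force simp: not_le)
  obtain t where "t \<in> torus2" "\<And>t'. t' \<in> torus2 \<Longrightarrow> cocycle a b W n t' \<le> cocycle a b W n t"
    using cocycle_attains(1) by blast
  then show ?thesis using n cocycle_nonneg by (intro exI[of _ n] exI[of _ "cocycle a b W n t"]) auto
qed

lemma below_lower_rate:
  assumes "0 \<le> r" "r < lower_rate a b W"
  shows "\<exists>n s. r ^ n < s \<and> (\<forall>t\<in>torus2. s \<le> cocycle a b W n t)"
proof -
  obtain n where n: "\<And>t. t \<in> torus2 \<Longrightarrow> r ^ n < cocycle a b W n t"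
    using assms lower_rate_le_iff(1)[OF assms(1)] by (force simp: not_le)
  obtain t where "t \<in> torus2" "\<And>t'. t' \<in> torus2 \<Longrightarrow> cocycle a b W n t \<le> cocycle a b W n t'"
    using cocycle_attains(2) by blast
  then show ?thesis using n by (intro exI[of _ n] exI[of _ "cocycle a b W n t"]) auto
qed

end


section \<open>Functions in the bidisc algebra\<close>

text \<open>Elements of the algebra as functions of a pair of complex numbers; the values are meaningful on the
  closed bidisc.\<close>

definition ev :: "bidisc_algebra \<Rightarrow> complex \<times> complex \<Rightarrow> complex"
  where "ev f z = apply_bcontfun (bidisc_fun f) (Bidisc z)"

abbreviation disc2 :: "(complex \<times> complex) set"
  where "disc2 \<equiv> cball 0 1 \<times> cball 0 1"

lemma torus2_subset_disc2: "torus2 \<subseteq> disc2"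
  by auto

lemma compact_disc2: "compact disc2"
  by (intro compact_Times compact_cball)

lemma continuous_on_ev: "continuous_on disc2 (ev f)"
  unfolding ev_def by (rule continuous_on_compose2[OF _ continuous_on_Bidisc, of UNIV]) auto

lemma holomorphic2_on_ev: "holomorphic2_on (ev f) (ball 0 1 \<times> ball 0 1)"
  unfolding ev_def[abs_def] by (rule holomorphic2_bidisc_fun)

lemma apply_bidisc_fun_eq_ev: "apply_bcontfun (bidisc_fun f) p = ev f (bidisc_pt p)"
  by (simp add: ev_def bidisc_pt_inverse)

lemma ev_eqI: "(\<And>z. z \<in> disc2 \<Longrightarrow> ev f z = ev g z) \<Longrightarrow> f = g"
  using bidisc_pt by (metis apply_bidisc_fun_eq_ev bcontfun_eqI bidisc_fun_inject)

lemma ev_add: "ev (f + g) z = ev f z + ev g z"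
  by (simp add: ev_def plus_bidisc_algebra.rep_eq)

lemma ev_diff: "ev (f - g) z = ev f z - ev g z"
  by (simp add: ev_def minus_bidisc_algebra.rep_eq)

lemma ev_scaleC: "ev (c *\<^sub>C f) z = c * ev f z"
  by (simp add: ev_def scaleC_bidisc_algebra.rep_eq scaleC_complex_def)

lemma ev_0: "ev 0 z = 0"
  by (simp add: ev_def zero_bidisc_algebra.rep_eq)

lemma ev_sum: "ev (sum f A) z = (\<Sum>i\<in>A. ev (f i) z)"
  by (induction A rule: infinite_finite_induct) (auto simp: ev_0 ev_add)

lemma norm_ev_le: "cmod (ev f z) \<le> norm f"
  by (simp add: ev_def norm_bidisc_algebra.rep_eq norm_bounded)

lemma norm_le_if_ev_le: "(\<And>z. z \<in> disc2 \<Longrightarrow> cmod (ev f z) \<le> M) \<Longrightarrow> norm f \<le> M"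
  unfolding norm_bidisc_algebra.rep_eq
  by (rule norm_bound) (use bidisc_pt in \<open>simp add: apply_bidisc_fun_eq_ev\<close>)

definition mk_bidisc :: "(complex \<times> complex \<Rightarrow> complex) \<Rightarrow> bidisc_algebra"
  where "mk_bidisc F = Bidisc_algebra (Bcontfun (\<lambda>p. F (bidisc_pt p)))"

lemma ev_mk_bidisc:
  assumes cont: "continuous_on disc2 F" and hol: "holomorphic2_on F (ball 0 1 \<times> ball 0 1)" and z: "z \<in> disc2"
  shows "ev (mk_bidisc F) z = F z"
proof -
  have c: "continuous_on UNIV (\<lambda>p. F (bidisc_pt p))"
    by (rule continuous_on_compose2[OF cont continuous_on_bidisc_pt image_subsetI[OF bidisc_pt]])
  have "bounded (F ` disc2)"
    by (intro compact_imp_bounded compact_continuous_image cont compact_disc2)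
  then obtain M where M: "\<And>z. z \<in> disc2 \<Longrightarrow> cmod (F z) \<le> M" unfolding bounded_iff by blast
  have "(\<lambda>p. F (bidisc_pt p)) \<in> bcontfun"
    by (rule bcontfun_normI[OF c, of M]) (use M bidisc_pt in blast)
  then have app: "apply_bcontfun (Bcontfun (\<lambda>p. F (bidisc_pt p))) p = F (bidisc_pt p)" for p
    by (simp add: Bcontfun_inverse)
  have "holomorphic2_on (\<lambda>z. apply_bcontfun (Bcontfun (\<lambda>p. F (bidisc_pt p))) (Bidisc z)) (ball 0 1 \<times> ball 0 1)"
    by (rule holomorphic2_on_transform[OF hol open_Times[OF open_ball open_ball]])
      (auto simp: app Bidisc_inverse)
  then show ?thesis
    using z by (simp add: ev_def mk_bidisc_def Bidisc_algebra_inverse app Bidisc_inverse)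
qed

lemma holomorphic2_on_inverse:
  assumes f: "holomorphic2_on f S" and nz: "\<And>z. z \<in> S \<Longrightarrow> f z \<noteq> 0"
  shows "holomorphic2_on (\<lambda>z. inverse (f z)) S"
  unfolding holomorphic2_on_def
proof
  fix z assume z: "z \<in> S"
  with f obtain a b where d: "(f has_derivative (\<lambda>(h, k). a * h + b * k)) (at z)"
    unfolding holomorphic2_on_def by blast
  have "((\<lambda>z. inverse (f z)) has_derivative (\<lambda>(h, k). (- inverse (f z) * a * inverse (f z)) * h +
      (- inverse (f z) * b * inverse (f z)) * k)) (at z)"
    using Deriv.has_derivative_inverse[OF nz[OF z] d]
    by (rule has_derivative_eq_rhs) (auto simp: fun_eq_iff algebra_simps)
  then show "\<exists>a b. ((\<lambda>z. inverse (f z)) has_derivative (\<lambda>(h, k). a * h + b * k)) (at z)" by blast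
qed

lemma invertible_in_bidisc_algebra_iff:
  "invertible_in_bidisc_algebra w \<longleftrightarrow> (\<forall>z\<in>disc2. ev w z \<noteq> 0)"
proof
  assume "invertible_in_bidisc_algebra w"
  then obtain u where "\<And>p. apply_bcontfun (bidisc_fun w) p * apply_bcontfun (bidisc_fun u) p = 1"
    by (auto simp: invertible_in_bidisc_algebra_def)
  then have "ev w z * ev u z = 1" for z by (simp add: ev_def)
  then show "\<forall>z\<in>disc2. ev w z \<noteq> 0" by (metis mult_zero_left zero_neq_one)
next
  assume nz: "\<forall>z\<in>disc2. ev w z \<noteq> 0"
  have "ev (mk_bidisc (\<lambda>z. inverse (ev w z))) z = inverse (ev w z)" if "z \<in> disc2" for z
  proof (rule ev_mk_bidisc[OF _ _ that])
    show "continuous_on disc2 (\<lambda>z. inverse (ev w z))"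
      by (rule continuous_on_inverse[OF continuous_on_ev]) (use nz in blast)
    show "holomorphic2_on (\<lambda>z. inverse (ev w z)) (ball 0 1 \<times> ball 0 1)"
      by (rule holomorphic2_on_inverse[OF holomorphic2_on_ev]) (use nz in auto)
  qed
  then have "ev w (bidisc_pt p) * ev (mk_bidisc (\<lambda>z. inverse (ev w z))) (bidisc_pt p) = 1" for p
    using bspec[OF nz bidisc_pt[of p]] bidisc_pt[of p] by simp
  then show "invertible_in_bidisc_algebra w"
    unfolding invertible_in_bidisc_algebra_def apply_bidisc_fun_eq_ev by blast
qed

lemma torus_pt_surj: "z \<in> torus2 \<Longrightarrow> \<exists>t. torus_pt t = z"
  by (metis Torus_inverse)

lemma apply_restrict_torus_eq_ev: "apply_bcontfun (restrict_torus w) t = ev w (torus_pt t)"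
  by (simp add: apply_restrict_torus apply_bidisc_fun_eq_ev)

lemma invertible_in_C_torus_iff:
  "invertible_in_C_torus w \<longleftrightarrow> (\<forall>z\<in>torus2. ev w z \<noteq> 0)"
proof
  assume "invertible_in_C_torus w"
  then obtain u where "\<And>t. ev w (torus_pt t) * apply_bcontfun u t = 1"
    by (auto simp: invertible_in_C_torus_def apply_restrict_torus_eq_ev)
  then show "\<forall>z\<in>torus2. ev w z \<noteq> 0" by (metis mult_zero_left torus_pt_surj zero_neq_one)
next
  assume nz: "\<forall>z\<in>torus2. ev w z \<noteq> 0"
  have c: "continuous_on torus2 (\<lambda>z. inverse (ev w z))"
    by (rule continuous_on_inverse[OF continuous_on_subset[OF continuous_on_ev torus2_subset_disc2]])
      (use nz in blast)
  have c': "continuous_on UNIV (\<lambda>t. inverse (ev w (torus_pt t)))"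
    by (rule continuous_on_compose2[OF c continuous_on_torus_pt image_subsetI[OF torus_pt]])
  have "bounded (range (\<lambda>t. inverse (ev w (torus_pt t))))"
    by (intro compact_imp_bounded compact_continuous_image c' compact_UNIV_torus)
  then have "(\<lambda>t. inverse (ev w (torus_pt t))) \<in> bcontfun" using c' by (simp add: bcontfun_def)
  then have "ev w (torus_pt t) * apply_bcontfun (Bcontfun (\<lambda>t. inverse (ev w (torus_pt t)))) t = 1" for t
    using bspec[OF nz torus_pt[of t]] by (simp add: Bcontfun_inverse)
  then show "invertible_in_C_torus w"
    unfolding invertible_in_C_torus_def apply_restrict_torus_eq_ev by blast
qed


section \<open>Boundary slices, maximum principle and zeros\<close>

lemma uniform_limit_ev_slice:
  assumes "x \<in> cball 0 1" "\<And>n. X n \<in> cball 0 1" "X \<longlonglongrightarrow> x"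
  shows "uniform_limit (cball 0 1) (\<lambda>n y. ev f (X n, y)) (\<lambda>y. ev f (x, y)) sequentially"
    and "uniform_limit (cball 0 1) (\<lambda>n y. ev f (y, X n)) (\<lambda>y. ev f (y, x)) sequentially"
proof -
  have uc: "uniformly_continuous_on disc2 (ev f)"
    by (intro compact_uniformly_continuous continuous_on_ev compact_disc2)
  have "\<forall>\<^sub>F n in sequentially. \<forall>y\<in>cball 0 1. dist (ev f (X n, y)) (ev f (x, y)) < e \<and>
      dist (ev f (y, X n)) (ev f (y, x)) < e" if "e > 0" for e
  proof -
    from uc[unfolded uniformly_continuous_on_def, rule_format, OF that]
    obtain d where d: "d > 0" "\<And>p q. p \<in> disc2 \<Longrightarrow> q \<in> disc2 \<Longrightarrow> dist q p < d \<Longrightarrow>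
        dist (ev f q) (ev f p) < e" by blast
    have "\<forall>\<^sub>F n in sequentially. dist (X n) x < d"
      using assms(3) d(1) by (auto simp: tendsto_iff)
    then show ?thesis
    proof eventually_elim
      case (elim n)
      then show ?case using assms(1,2) by (auto intro!: d(2) simp: dist_Pair_Pair)
    qed
  qed
  then show "uniform_limit (cball 0 1) (\<lambda>n y. ev f (X n, y)) (\<lambda>y. ev f (x, y)) sequentially"
    "uniform_limit (cball 0 1) (\<lambda>n y. ev f (y, X n)) (\<lambda>y. ev f (y, x)) sequentially"
    unfolding uniform_limit_iff by (force elim!: eventually_mono)+
qed

lemma approach_from_disc:
  assumes "x \<in> cball 0 1"
  shows "\<exists>X. (\<forall>n. X n \<in> ball (0::complex) 1) \<and> X \<longlonglongrightarrow> x \<and> (x \<noteq> 0 \<longrightarrow> inj X)"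
proof -
  define X where "X n = of_real (1 - 1 / real (Suc (Suc n))) * x" for n
  have "cmod (X n) < 1" for n
  proof -
    have "cmod (X n) = (1 - 1 / real (Suc (Suc n))) * cmod x"
      by (simp add: X_def norm_mult del: of_real_diff of_nat_Suc)
    also have "\<dots> \<le> (1 - 1 / real (Suc (Suc n))) * 1" using assms by (intro mult_left_mono) auto
    also have "\<dots> < 1" by simp
    finally show ?thesis .
  qed
  moreover have "X \<longlonglongrightarrow> x"
  proof -
    have "(\<lambda>n. 1 - 1 / real (Suc (Suc n))) \<longlonglongrightarrow> 1 - 0"
      by (intro tendsto_diff tendsto_const LIMSEQ_Suc[OF LIMSEQ_Suc[OF lim_1_over_n]])
    then have "(\<lambda>n. of_real (1 - 1 / real (Suc (Suc n))) * x) \<longlonglongrightarrow> of_real (1 - 0) * x"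
      by (intro tendsto_mult tendsto_of_real tendsto_const)
    then show ?thesis by (simp add: X_def[abs_def])
  qed
  moreover have "inj X" if "x \<noteq> 0"
    using that by (auto simp: inj_on_def X_def of_real_eq_iff simp del: of_real_diff of_nat_Suc)
  ultimately show ?thesis by (intro exI[of _ X]) auto
qed

text \<open>For a boundary point \<open>x\<close> of the disc the slice is a uniform limit of slices at interior points.\<close>

lemma ev_slice_holomorphic:
  assumes "x \<in> cball 0 1"
  shows "(\<lambda>y. ev f (x, y)) holomorphic_on ball 0 1" "(\<lambda>y. ev f (y, x)) holomorphic_on ball 0 1"
proof -
  obtain X where X: "\<And>n. X n \<in> ball (0::complex) 1" "X \<longlonglongrightarrow> x"
    using approach_from_disc[OF assms] by blast
  have Xc: "X n \<in> cball 0 1" for n using X(1)[of n] by auto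
  note lims = uniform_limit_ev_slice[OF assms Xc X(2), of f]
  have *: "\<exists>d>0. cball u d \<subseteq> ball 0 1 \<and> uniform_limit (cball u d) F g sequentially"
    if u: "u \<in> ball 0 1" and ul: "uniform_limit (cball 0 1) F g sequentially"
    for u :: complex and F :: "nat \<Rightarrow> complex \<Rightarrow> complex" and g
  proof -
    obtain d where "d > 0" "cball u d \<subseteq> ball 0 1"
      using u open_ball[of "0::complex" 1] unfolding open_contains_cball by blast
    moreover from this have "cball u d \<subseteq> cball 0 1" using ball_subset_cball by blast
    ultimately show ?thesis using uniform_limit_on_subset[OF ul] by blast
  qed
  show "(\<lambda>y. ev f (x, y)) holomorphic_on ball 0 1"
    by (rule holomorphic_uniform_sequence[OF open_ball
          holomorphic2_on_imp_holomorphic_on(2)[OF holomorphic2_on_ev X(1)] *[OF _ lims(1)]])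
  show "(\<lambda>y. ev f (y, x)) holomorphic_on ball 0 1"
    by (rule holomorphic_uniform_sequence[OF open_ball
          holomorphic2_on_imp_holomorphic_on(1)[OF holomorphic2_on_ev X(1)] *[OF _ lims(2)]])
qed

lemma continuous_on_ev_slice:
  assumes "x \<in> cball 0 1"
  shows "continuous_on (cball 0 1) (\<lambda>y. ev f (x, y))" "continuous_on (cball 0 1) (\<lambda>y. ev f (y, x))"
  by (rule continuous_on_compose2[OF continuous_on_ev]; use assms in \<open>auto intro!: continuous_intros\<close>)+

text \<open>The maximum principle in one variable at a time, including slices over boundary points.\<close>

lemma norm_le_if_ev_le_torus2:
  assumes "\<And>z. z \<in> torus2 \<Longrightarrow> cmod (ev f z) \<le> M"
  shows "norm f \<le> M"
proof (rule norm_le_if_ev_le)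
  have slice: "cmod (g y) \<le> M" if "g holomorphic_on ball 0 1" "continuous_on (cball 0 1) g"
      "\<And>y. y \<in> sphere 0 1 \<Longrightarrow> cmod (g y) \<le> M" "y \<in> cball 0 1" for g :: "complex \<Rightarrow> complex" and y
    by (rule maximum_modulus_frontier[of g "cball 0 1"]) (use that in auto)
  fix z assume "z \<in> disc2"
  then obtain z1 z2 where z: "z = (z1, z2)" "z1 \<in> cball 0 1" "z2 \<in> cball 0 1" by auto
  have 1: "cmod (ev f (x, y)) \<le> M" if "x \<in> sphere 0 1" "y \<in> cball 0 1" for x y
  proof -
    have x: "x \<in> cball 0 1" using that(1) by simp
    show ?thesis
      by (rule slice[OF ev_slice_holomorphic(1)[OF x] continuous_on_ev_slice(1)[OF x] _ that(2)])
        (use assms that in auto)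
  qed
  show "cmod (ev f z) \<le> M"
    unfolding z(1)
    by (rule slice[OF ev_slice_holomorphic(2)[OF z(3)] continuous_on_ev_slice(2)[OF z(3)] _ z(2)])
      (use 1 z in auto)
qed

lemma norm_attained_torus2: "\<exists>z\<in>torus2. cmod (ev f z) = norm f"
proof -
  have "continuous_on torus2 (\<lambda>z. cmod (ev f z))"
    by (intro continuous_intros continuous_on_subset[OF continuous_on_ev torus2_subset_disc2])
  then obtain z where z: "z \<in> torus2" "\<And>z'. z' \<in> torus2 \<Longrightarrow> cmod (ev f z') \<le> cmod (ev f z)"
    using continuous_attains_sup[OF compact_torus2, of "\<lambda>z. cmod (ev f z)"] by auto
  then have "norm f \<le> cmod (ev f z)" by (intro norm_le_if_ev_le_torus2)
  then show ?thesis using norm_ev_le[of f z] z(1) by (intro bexI[of _ z]) auto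
qed

text \<open>If there were only finitely many zeros, slices \<open>F (X' n)\<close> near \<open>F x\<close> would have none, and by Hurwitz's
  theorem neither would \<open>F x\<close>, unless it is constant, hence zero; but then there are infinitely
  many zeros after all.\<close>

lemma infinite_zeros_if_slice_zero:
  fixes F :: "complex \<Rightarrow> complex \<Rightarrow> complex"
  assumes cont: "\<And>X x. x \<in> cball 0 1 \<Longrightarrow> (\<And>n. X n \<in> cball 0 1) \<Longrightarrow> X \<longlonglongrightarrow> x \<Longrightarrow>
      uniform_limit (cball 0 1) (\<lambda>n y. F (X n) y) (F x) sequentially"
    and hol: "\<And>x. x \<in> cball 0 1 \<Longrightarrow> F x holomorphic_on ball 0 1"
    and zero: "F x y = 0" "x \<in> cball 0 1" "y \<in> ball 0 1"
  shows "infinite {z\<in>disc2. F (fst z) (snd z) = 0}"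
proof
  assume fin: "finite {z\<in>disc2. F (fst z) (snd z) = 0}"
  let ?Z = "{z\<in>disc2. F (fst z) (snd z) = 0}"
  obtain X where X: "\<And>n. X n \<in> cball (0::complex) 1" "X \<longlonglongrightarrow> x" "inj X"
  proof (cases "x = 0")
    case True
    have "(\<lambda>n. complex_of_real (1 / real (Suc n))) \<longlonglongrightarrow> of_real 0"
      by (intro tendsto_of_real LIMSEQ_Suc[OF lim_1_over_n])
    then show thesis
      by (intro that[of "\<lambda>n. of_real (1 / real (Suc n))"])
        (auto simp: True norm_divide inj_on_def simp del: of_real_divide of_nat_Suc)
  next
    case False
    then obtain X where "\<forall>n. X n \<in> ball (0::complex) 1" "X \<longlonglongrightarrow> x" "inj X"
      using approach_from_disc[OF zero(2)] by blast
    then show thesis by (intro that[of X]) (auto intro: less_imp_le)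
  qed
  have "finite (X -` fst ` ?Z)"
    using fin X(3) by (intro finite_vimageI) auto
  then obtain N where Nb: "\<forall>n\<in>X -` fst ` ?Z. n < N"
    unfolding finite_nat_set_iff_bounded by blast
  have N: "n \<notin> X -` fst ` ?Z" if "n \<ge> N" for n
  proof
    assume "n \<in> X -` fst ` ?Z"
    then have "n < N" by (rule Nb[rule_format])
    then show False using that by simp
  qed
  define X' where "X' n = X (n + N)" for n
  have X': "X' n \<in> cball 0 1" "X' \<longlonglongrightarrow> x" for n
    using X by (auto simp: X'_def[abs_def] intro: LIMSEQ_ignore_initial_segment)
  have nz: "F (X' n) u \<noteq> 0" if "u \<in> ball 0 1" for n u
  proof
    assume "F (X' n) u = 0"
    then have "(X' n, u) \<in> ?Z" using X'(1)[of n] that by auto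
    then have "X' n \<in> fst ` ?Z" by force
    then show False using N[of "n + N"] by (auto simp: X'_def)
  qed
  have "F x y \<noteq> 0"
  proof (rule Hurwitz_no_zeros[OF open_ball connected_ball, where \<F> = "\<lambda>n. F (X' n)" and g = "F x"])
    show "F (X' n) holomorphic_on ball 0 1" for n by (rule hol[OF X'(1)])
    show "F x holomorphic_on ball 0 1" by (rule hol[OF zero(2)])
    show "uniform_limit K (\<lambda>n. F (X' n)) (F x) sequentially" if "K \<subseteq> ball 0 1" for K
      by (rule uniform_limit_on_subset[OF cont[OF zero(2) X']]) (use that in auto)
    show "\<not> F x constant_on ball 0 1"
    proof
      assume "F x constant_on ball 0 1"
      then have "F x u = 0" if "u \<in> ball 0 1" for u
        using that zero unfolding constant_on_def by metis
      then have "Pair x ` ball 0 1 \<subseteq> ?Z" using zero(2) by auto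
      then have "finite (Pair x ` ball (0::complex) 1)" using fin by (rule finite_subset)
      then have "finite (ball (0::complex) 1)" by (rule finite_imageD) (auto simp: inj_on_def)
      then show False using uncountable_ball[of 1 "0::complex"] countable_finite by auto
    qed
  qed (use nz zero in auto)
  then show False using zero(1) by simp
qed

lemma infinite_zeros:
  assumes z: "z \<in> disc2" "ev f z = 0" and nt: "\<And>z. z \<in> torus2 \<Longrightarrow> ev f z \<noteq> 0"
  shows "infinite {z\<in>disc2. ev f z = 0}"
proof -
  obtain x y where xy: "z = (x, y)" "x \<in> cball 0 1" "y \<in> cball 0 1" using z by auto
  consider "y \<in> ball 0 1" | "x \<in> ball 0 1" using nt[of z] z xy by fastforce
  then show ?thesis
  proof cases
    case 1
    have "infinite {z\<in>disc2. (\<lambda>x y. ev f (x, y)) (fst z) (snd z) = 0}"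
      by (rule infinite_zeros_if_slice_zero[of "\<lambda>x y. ev f (x, y)" x y, OF uniform_limit_ev_slice(1) ev_slice_holomorphic(1)])
        (use 1 xy z in auto)
    then show ?thesis by simp
  next
    case 2
    let ?Z = "{z\<in>disc2. (\<lambda>x y. ev f (y, x)) (fst z) (snd z) = 0}"
    have "infinite ?Z"
      by (rule infinite_zeros_if_slice_zero[of "\<lambda>x y. ev f (y, x)" y x, OF uniform_limit_ev_slice(2) ev_slice_holomorphic(2)])
        (use 2 xy z in auto)
    moreover have "inj_on prod.swap ?Z" by (auto simp: inj_on_def)
    ultimately have "infinite (prod.swap ` ?Z)" by (simp add: finite_image_iff)
    moreover have "prod.swap ` ?Z \<subseteq> {z\<in>disc2. ev f z = 0}" by auto
    ultimately show ?thesis using finite_subset by blast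
  qed
qed


section \<open>Peak functions\<close>

text \<open>For \<open>q\<close> on the torus it takes the value \<open>1\<close> at \<open>q\<close> and has modulus less than \<open>1\<close> elsewhere on the closed bidisc.\<close>

definition peak :: "complex \<times> complex \<Rightarrow> complex \<times> complex \<Rightarrow> complex"
  where "peak q z = ((1 + cnj (fst q) * fst z) / 2) * ((1 + cnj (snd q) * snd z) / 2)"

lemma norm_one_plus_lt_2:
  fixes u :: complex
  assumes "cmod u \<le> 1" "u \<noteq> 1"
  shows "cmod ((1 + u) / 2) < 1"
proof -
  have "cmod (1 + u) \<noteq> 2"
  proof
    assume eq: "cmod (1 + u) = 2"
    have "(cmod (1 + u))\<^sup>2 = 1 + 2 * Re u + (cmod u)\<^sup>2"
      unfolding cmod_power2 by (simp add: power2_eq_square algebra_simps)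
    moreover have "(cmod u)\<^sup>2 \<le> 1" using assms(1) by (simp add: power_le_one)
    ultimately have "Re u \<ge> 1" using eq by simp
    moreover have "Re u \<le> cmod u" by (rule complex_Re_le_cmod)
    ultimately have "Re u = 1" "cmod u = 1" using assms(1) by auto
    then have "u = 1" using cmod_power2[of u] by (simp add: complex_eq_iff)
    then show False using assms(2) by simp
  qed
  moreover have "cmod (1 + u) \<le> 2" using norm_triangle_ineq[of 1 u] assms(1) by simp
  ultimately show ?thesis by (simp add: norm_divide)
qed

lemma peak_self: "q \<in> torus2 \<Longrightarrow> peak q q = 1"
proof -
  assume "q \<in> torus2"
  then have "cmod (fst q) = 1" "cmod (snd q) = 1" by auto
  then have "cnj (fst q) * fst q = 1" "cnj (snd q) * snd q = 1"
    by (simp_all add: mult.commute flip: complex_norm_square)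
  then show ?thesis by (simp add: peak_def)
qed

lemma norm_half_one_plus_le_1: "cmod u \<le> 1 \<Longrightarrow> cmod ((1 + u) / 2) \<le> 1"
  using norm_one_plus_lt_2[of u] by (cases "u = 1") auto

lemma norm_peak_le_1:
  assumes "q \<in> torus2" "z \<in> disc2"
  shows "cmod (peak q z) \<le> 1"
proof -
  have "cmod (cnj (fst q) * fst z) \<le> 1" "cmod (cnj (snd q) * snd z) \<le> 1"
    using assms by (auto simp: norm_mult)
  from this[THEN norm_half_one_plus_le_1] show ?thesis
    unfolding peak_def norm_mult by (intro mult_le_one) auto
qed

lemma norm_peak_lt_1:
  assumes "q \<in> torus2" "z \<in> disc2" "z \<noteq> q"
  shows "cmod (peak q z) < 1"
proof -
  let ?u = "cnj (fst q) * fst z" and ?v = "cnj (snd q) * snd z"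
  have uv: "cmod ?u \<le> 1" "cmod ?v \<le> 1" using assms by (auto simp: norm_mult)
  have "x = p" if "cnj p * x = 1" "cmod p = 1" for p x :: complex
  proof -
    have "p * cnj p = 1" using that(2) by (simp flip: complex_norm_square)
    then have "p * (cnj p * x) = x" by (simp flip: mult.assoc)
    then show ?thesis using that(1) by simp
  qed
  then have "?u \<noteq> 1 \<or> ?v \<noteq> 1" using assms by (auto simp: prod_eq_iff)
  then show ?thesis
  proof
    assume "?u \<noteq> 1"
    then have "cmod ((1 + ?u) / 2) < 1" using norm_one_plus_lt_2[OF uv(1)] by simp
    moreover have "cmod ((1 + ?v) / 2) \<le> 1" by (rule norm_half_one_plus_le_1[OF uv(2)])
    ultimately have "cmod ((1 + ?u) / 2) * cmod ((1 + ?v) / 2) < 1"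
      using mult_left_le[of "cmod ((1 + ?v) / 2)" "cmod ((1 + ?u) / 2)"] by simp
    then show ?thesis by (simp only: peak_def norm_mult)
  next
    assume "?v \<noteq> 1"
    then have "cmod ((1 + ?v) / 2) < 1" using norm_one_plus_lt_2[OF uv(2)] by simp
    moreover have "cmod ((1 + ?u) / 2) \<le> 1" by (rule norm_half_one_plus_le_1[OF uv(1)])
    ultimately have "cmod ((1 + ?u) / 2) * cmod ((1 + ?v) / 2) < 1"
      using mult_left_le_one_le[of "cmod ((1 + ?v) / 2)" "cmod ((1 + ?u) / 2)"] by simp
    then show ?thesis by (simp only: peak_def norm_mult)
  qed
qed

lemma peak_power_tendsto:
  assumes "q \<in> torus2" "z \<in> disc2"
  shows "(\<lambda>m. peak q z ^ m) \<longlonglongrightarrow> (if z = q then 1 else 0)"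
  using assms norm_peak_lt_1[OF assms] by (auto simp: peak_self intro: LIMSEQ_power_zero)

lemma peak_rot:
  assumes "cmod a = 1" "cmod b = 1"
  shows "peak (rot a b (Suc i) q) (rot a b 1 z) = peak (rot a b i q) z"
proof -
  have "cnj (c * s) * (c * t) = cnj s * t" if "cmod c = 1" for c s t :: complex
  proof -
    have "c * cnj c = 1" using that by (simp flip: complex_norm_square)
    then show ?thesis by (simp add: mult.assoc mult.left_commute flip: mult.assoc[of c "cnj c"]) 
  qed
  from this[OF assms(1), of "a ^ i * fst q" "fst z"] this[OF assms(2), of "b ^ i * snd q" "snd z"]
  show ?thesis by (simp only: peak_def rot_def fst_conv snd_conv power_Suc power_one_right mult.assoc)
qed

lemma holomorphic2_on_fst: "holomorphic2_on fst S"
  unfolding holomorphic2_on_def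
proof
  fix z :: "complex \<times> complex"
  show "\<exists>a b. (fst has_derivative (\<lambda>(h, k). a * h + b * k)) (at z)"
    by (rule exI[of _ 1], rule exI[of _ 0]) (auto intro!: derivative_eq_intros)
qed

lemma holomorphic2_on_snd: "holomorphic2_on snd S"
  unfolding holomorphic2_on_def
proof
  fix z :: "complex \<times> complex"
  show "\<exists>a b. (snd has_derivative (\<lambda>(h, k). a * h + b * k)) (at z)"
    by (rule exI[of _ 0], rule exI[of _ 1]) (auto intro!: derivative_eq_intros)
qed

lemma holomorphic2_on_power: "holomorphic2_on f S \<Longrightarrow> holomorphic2_on (\<lambda>z. f z ^ n) S"
  by (induction n) (auto intro: holomorphic2_on_const holomorphic2_on_mult)

lemma holomorphic2_on_sum:
  "(\<And>i. i \<in> A \<Longrightarrow> holomorphic2_on (f i) S) \<Longrightarrow> holomorphic2_on (\<lambda>z. \<Sum>i\<in>A. f i z) S"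
  by (induction A rule: infinite_finite_induct) (auto intro: holomorphic2_on_const holomorphic2_on_add)

lemma holomorphic2_on_prod:
  "(\<And>i. i \<in> A \<Longrightarrow> holomorphic2_on (f i) S) \<Longrightarrow> holomorphic2_on (\<lambda>z. \<Prod>i\<in>A. f i z) S"
  by (induction A rule: infinite_finite_induct) (auto intro: holomorphic2_on_const holomorphic2_on_mult)

lemma continuous_on_peak: "continuous_on S (peak q)"
  unfolding peak_def by (intro continuous_intros) auto

lemma holomorphic2_on_peak: "holomorphic2_on (peak q) S"
  unfolding peak_def[abs_def] divide_inverse
  by (intro holomorphic2_on_mult holomorphic2_on_add holomorphic2_on_const holomorphic2_on_fst holomorphic2_on_snd)

definition peak_sum :: "nat \<Rightarrow> (nat \<Rightarrow> complex) \<Rightarrow> (nat \<Rightarrow> complex \<times> complex) \<Rightarrow> nat \<Rightarrow> bidisc_algebra"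
  where "peak_sum L c Q m = mk_bidisc (\<lambda>z. \<Sum>i\<le>L. c i * peak (Q i) z ^ m)"

lemma ev_peak_sum: "z \<in> disc2 \<Longrightarrow> ev (peak_sum L c Q m) z = (\<Sum>i\<le>L. c i * peak (Q i) z ^ m)"
  unfolding peak_sum_def
  by (intro ev_mk_bidisc continuous_intros continuous_on_peak holomorphic2_on_sum holomorphic2_on_mult
      holomorphic2_on_const holomorphic2_on_power holomorphic2_on_peak)

lemma ev_peak_sum_tendsto:
  assumes "\<And>i. i \<le> L \<Longrightarrow> Q i \<in> torus2" "z \<in> disc2"
  shows "(\<lambda>m. ev (peak_sum L c Q m) z) \<longlonglongrightarrow> (\<Sum>i\<le>L. c i * (if z = Q i then 1 else 0))"
  unfolding ev_peak_sum[OF assms(2)]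
  by (intro tendsto_sum tendsto_mult tendsto_const peak_power_tendsto) (use assms in auto)

lemma norm_peak_sum_le:
  assumes "\<And>i. i \<le> L \<Longrightarrow> Q i \<in> torus2"
  shows "norm (peak_sum L c Q m) \<le> (\<Sum>i\<le>L. cmod (c i))"
proof (rule norm_le_if_ev_le)
  fix z assume z: "z \<in> disc2"
  show "cmod (ev (peak_sum L c Q m) z) \<le> (\<Sum>i\<le>L. cmod (c i))"
    unfolding ev_peak_sum[OF z]
  proof (rule sum_norm_le)
    fix i assume "i \<in> {..L}"
    then have "cmod (peak (Q i) z) ^ m \<le> 1"
      by (intro power_le_one norm_peak_le_1 assms z) auto
    then show "cmod (c i * peak (Q i) z ^ m) \<le> cmod (c i)"
      by (simp add: norm_mult norm_power mult_left_le)
  qed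
qed

text \<open>The sums decrease in \<open>m\<close> and converge pointwise to the modulus of \<open>h i\<close> at the peak point \<open>Q i\<close> and to \<open>0\<close>
  elsewhere, so compactness makes the bound uniform, as in Dini's theorem.\<close>

lemma eventually_peak_sum_le:
  fixes L :: nat
  assumes Q: "\<And>i. i \<le> L \<Longrightarrow> Q i \<in> torus2" "inj_on Q {..L}"
    and h: "\<And>i. i \<le> L \<Longrightarrow> continuous_on torus2 (h i)"
    and E: "\<And>i. i \<le> L \<Longrightarrow> cmod (h i (Q i)) \<le> E" "E < E'"
  shows "\<exists>m0. \<forall>m\<ge>m0. \<forall>z\<in>torus2. (\<Sum>i\<le>L. cmod (h i z) * cmod (peak (Q i) z) ^ m) \<le> E'"
proof -
  define G where "G m z = (\<Sum>i\<le>L. cmod (h i z) * cmod (peak (Q i) z) ^ m)" for m z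
  define A where "A m = {z\<in>torus2. E' \<le> G m z}" for m
  have G_mono: "G n z \<le> G m z" if "m \<le> n" "z \<in> torus2" for m n z
    unfolding G_def
    by (intro sum_mono mult_left_mono power_decreasing norm_peak_le_1)
      (use that Q subsetD[OF torus2_subset_disc2] in auto)
  have cont: "continuous_on torus2 (G m)" for m
    unfolding G_def by (intro continuous_intros h continuous_on_peak) auto
  have "\<exists>m. A m = {}"
  proof (rule ccontr)
    assume "\<nexists>m. A m = {}"
    moreover have "compact (A m)" for m
    proof -
      have "A m = torus2 \<inter> G m -` {E'..}" by (auto simp: A_def)
      then have "closedin (top_of_set torus2) (A m)"
        using continuous_closedin_preimage[OF cont closed_atLeast] by simp
      then show ?thesis using closedin_compact[OF compact_torus2] by blast
    qed
    moreover have "A n \<subseteq> A m" if "m \<le> n" for m n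
      using G_mono[OF that] unfolding A_def by (auto intro: order_trans)
    ultimately have "\<Inter>(range A) \<noteq> {}" by (intro compact_nest) auto
    then obtain z where "z \<in> \<Inter>(range A)" by blast
    then have z: "z \<in> torus2" "\<And>m. E' \<le> G m z" by (auto simp: A_def)
    have "(\<lambda>m. G m z) \<longlonglongrightarrow> (\<Sum>i\<le>L. cmod (h i z) * cmod (if z = Q i then 1 else 0))"
      unfolding G_def norm_power[symmetric]
      by (intro tendsto_sum tendsto_mult tendsto_const tendsto_norm peak_power_tendsto)
        (use Q z subsetD[OF torus2_subset_disc2] in auto)
    then have "E' \<le> (\<Sum>i\<le>L. cmod (h i z) * cmod (if z = Q i then 1 else 0))"
      by (rule LIMSEQ_le_const) (use z in auto)
    also have "\<dots> \<le> E"
    proof (cases "\<exists>j\<le>L. z = Q j")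
      case True
      then obtain j where j: "j \<le> L" "z = Q j" by blast
      have "(\<Sum>i\<le>L. cmod (h i z) * cmod (if z = Q i then 1 else 0)) = (\<Sum>i\<le>L. if i = j then cmod (h i z) else 0)"
        using Q(2) j by (intro sum.cong) (auto simp: inj_on_def)
      also have "\<dots> = cmod (h j (Q j))"
        using j by simp
      finally show ?thesis using E(1) j by simp
    next
      case False
      then have "(\<Sum>i\<le>L. cmod (h i z) * cmod (if z = Q i then 1 else 0)) = 0"
        by (intro sum.neutral) auto
      then show ?thesis using E(1)[of 0] norm_ge_zero order_trans by (metis le0)
    qed
    finally show False using E(2) by simp
  qed
  then obtain m0 where m0: "A m0 = {}" by blast
  have "G m z \<le> E'" if "m \<ge> m0" "z \<in> torus2" for m z
    using G_mono[OF that] m0 that(2) by (force simp: A_def)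
  then show ?thesis unfolding G_def by blast
qed


section \<open>The weighted rotation on the bidisc algebra\<close>

lemma ev_weighted_rotation:
  assumes ab: "cmod a = 1" "cmod b = 1" and z: "z \<in> disc2"
  shows "ev (weighted_rotation a b w f) z = ev w z * ev f (rot a b 1 z)"
proof -
  have "bidisc_pt (Bidisc z) = z" using z by (rule Bidisc_inverse)
  then show ?thesis
    using apply_weighted_rotation[OF ab, of w f "Bidisc z"]
    by (simp add: apply_bidisc_fun_eq_ev bidisc_pt_rotation_bidisc[OF ab] rotation_def rot_def split_beta)
qed

lemma rot_disc2: "cmod a = 1 \<Longrightarrow> cmod b = 1 \<Longrightarrow> z \<in> disc2 \<Longrightarrow> rot a b n z \<in> disc2"
  by (auto simp: rot_def norm_mult norm_power)

lemma bounded_clinear_weighted_rotation: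
  assumes ab: "cmod a = 1" "cmod b = 1"
  shows "bounded_clinear (weighted_rotation a b w)"
proof -
  let ?T = "weighted_rotation a b w"
  have sc: "?T (c *\<^sub>C f) = c *\<^sub>C ?T f" for c f
    by (rule ev_eqI) (simp add: ev_weighted_rotation[OF ab] ev_scaleC)
  have "bounded_linear ?T"
  proof (rule bounded_linear_intro[where K = "norm w"])
    show "?T (f + g) = ?T f + ?T g" for f g
      by (rule ev_eqI) (simp add: ev_weighted_rotation[OF ab] ev_add algebra_simps)
    show "?T (r *\<^sub>R f) = r *\<^sub>R ?T f" for r f by (simp add: scaleR_scaleC sc)
    show "norm (?T f) \<le> norm f * norm w" for f
    proof (rule norm_le_if_ev_le)
      fix z assume z: "z \<in> disc2"
      then show "cmod (ev (?T f) z) \<le> norm f * norm w"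
        using mult_mono[OF norm_ev_le[of f "rot a b 1 z"] norm_ev_le[of w z]]
        by (simp add: ev_weighted_rotation[OF ab] norm_mult mult.commute)
    qed
  qed
  then show ?thesis using sc by (simp add: bounded_clinear_def)
qed

lemma ev_weighted_rotation_funpow:
  assumes ab: "cmod a = 1" "cmod b = 1" and z: "z \<in> disc2"
  shows "ev ((weighted_rotation a b w ^^ n) f) z = (\<Prod>k<n. ev w (rot a b k z)) * ev f (rot a b n z)"
  using z
proof (induction n arbitrary: z)
  case (Suc n)
  have "(\<Prod>k<Suc n. ev w (rot a b k z)) = ev w z * (\<Prod>k<n. ev w (rot a b k (rot a b 1 z)))"
    by (subst prod.lessThan_Suc_shift) (simp add: rot_rot)
  then show ?case
    using Suc.IH[OF rot_disc2[OF ab Suc.prems, of 1]] Suc.prems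
    by (simp add: ev_weighted_rotation[OF ab] rot_rot mult.assoc)
qed simp

lemma norm_weighted_rotation_funpow_le:
  assumes ab: "cmod a = 1" "cmod b = 1" and s: "\<And>t. t \<in> torus2 \<Longrightarrow> cocycle a b (ev w) n t \<le> s"
  shows "norm ((weighted_rotation a b w ^^ n) f) \<le> s * norm f"
proof (rule norm_le_if_ev_le_torus2)
  fix z assume z: "z \<in> torus2"
  have "cmod (ev ((weighted_rotation a b w ^^ n) f) z) = cocycle a b (ev w) n z * cmod (ev f (rot a b n z))"
    using ev_weighted_rotation_funpow[OF ab subsetD[OF torus2_subset_disc2 z]]
    by (simp add: norm_mult cocycle_def prod_norm)
  also have "\<dots> \<le> s * norm f"
    using s[OF z] cocycle_nonneg[of a b "ev w" n z] norm_ev_le by (intro mult_mono) auto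
  finally show "cmod (ev ((weighted_rotation a b w ^^ n) f) z) \<le> s * norm f" .
qed

text \<open>The rotation maps the torus onto itself, so some \<open>t\<close> is carried to a point where \<open>f\<close> attains its norm.\<close>

lemma norm_weighted_rotation_funpow_ge:
  assumes ab: "cmod a = 1" "cmod b = 1" and s: "\<And>t. t \<in> torus2 \<Longrightarrow> s \<le> cocycle a b (ev w) n t"
  shows "s * norm f \<le> norm ((weighted_rotation a b w ^^ n) f)"
proof -
  obtain z where z: "z \<in> torus2" "cmod (ev f z) = norm f" using norm_attained_torus2 by blast
  define t where "t = rot (inverse a) (inverse b) n z"
  have t: "t \<in> torus2" unfolding t_def by (rule rot_torus2) (use ab z in \<open>auto simp: norm_inverse\<close>)
  have rt: "rot a b n t = z" unfolding t_def by (rule rot_inverse(2)[OF ab])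
  have "s * norm f \<le> cocycle a b (ev w) n t * cmod (ev f (rot a b n t))"
    using s[OF t] by (simp add: rt z mult_right_mono)
  also have "\<dots> = cmod (ev ((weighted_rotation a b w ^^ n) f) t)"
    using ev_weighted_rotation_funpow[OF ab subsetD[OF torus2_subset_disc2 t]]
    by (simp add: norm_mult cocycle_def prod_norm)
  also have "\<dots> \<le> norm ((weighted_rotation a b w ^^ n) f)" by (rule norm_ev_le)
  finally show ?thesis .
qed

lemma inj_power_if_not_root_of_unity:
  fixes a :: complex
  assumes "cmod a = 1" "\<And>n. n > 0 \<Longrightarrow> a ^ n \<noteq> 1"
  shows "inj (\<lambda>n. a ^ n)"
proof -
  have "a \<noteq> 0" using assms(1) by auto
  have "a ^ m \<noteq> a ^ n" if "m < n" for m n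
  proof
    assume "a ^ m = a ^ n"
    moreover have "a ^ n = a ^ m * a ^ (n - m)" using that by (simp flip: power_add)
    ultimately show False using assms(2)[of "n - m"] that \<open>a \<noteq> 0\<close> by simp
  qed
  then show ?thesis by (metis (mono_tags, lifting) injI linorder_neqE_nat)
qed

lemma inj_rot:
  assumes a: "cmod a = 1" "\<And>n. n > 0 \<Longrightarrow> a ^ n \<noteq> 1" and q: "q \<in> torus2"
  shows "inj (\<lambda>i. rot a b i q)"
proof (rule injI)
  fix i j assume "rot a b i q = rot a b j q"
  moreover have "fst q \<noteq> 0" using q by auto
  ultimately have "a ^ i = a ^ j" by (simp add: rot_def)
  then show "i = j" using inj_power_if_not_root_of_unity[OF a] by (simp add: inj_def)
qed

lemma rot_1_eq_rotation: "rot a b 1 = rotation a b"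
  by (auto simp: rot_def rotation_def fun_eq_iff)

lemma surj_weighted_rotation:
  assumes ab: "cmod a = 1" "cmod b = 1" and nz: "\<And>z. z \<in> disc2 \<Longrightarrow> ev w z \<noteq> 0"
  shows "surj (weighted_rotation a b w)"
  unfolding surj_def
proof
  fix g
  let ?r = "rot (inverse a) (inverse b) 1"
  let ?h = "\<lambda>z. inverse (ev w z) * ev g z"
  have ab': "cmod (inverse a) = 1" "cmod (inverse b) = 1" using ab by (auto simp: norm_inverse)
  have im: "?r ` disc2 \<subseteq> disc2" using rot_disc2[OF ab'] by blast
  have imb: "?r ` (ball 0 1 \<times> ball 0 1) \<subseteq> ball 0 1 \<times> ball 0 1"
    using ab' by (auto simp: rot_def norm_mult)
  have c: "continuous_on disc2 ?h"
    by (intro continuous_intros continuous_on_ev) (use nz in blast)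
  have h: "holomorphic2_on ?h (ball 0 1 \<times> ball 0 1)"
    by (intro holomorphic2_on_mult holomorphic2_on_inverse holomorphic2_on_ev) (use nz in auto)
  define f where "f = mk_bidisc (\<lambda>z. ?h (?r z))"
  have ef: "ev f z = ?h (?r z)" if "z \<in> disc2" for z
    unfolding f_def
  proof (rule ev_mk_bidisc[OF _ _ that])
    show "continuous_on disc2 (\<lambda>z. ?h (?r z))"
      by (rule continuous_on_compose2[OF c continuous_on_rot im])
    show "holomorphic2_on (\<lambda>z. ?h (?r z)) (ball 0 1 \<times> ball 0 1)"
      unfolding rot_1_eq_rotation
      by (rule holomorphic2_on_rotation[OF h imb[unfolded rot_1_eq_rotation]])
  qed
  have "g = weighted_rotation a b w f"
  proof (rule ev_eqI)
    fix z assume z: "z \<in> disc2"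
    have "?r (rot a b 1 z) = z" by (rule rot_inverse(1)[OF ab])
    then show "ev g z = ev (weighted_rotation a b w f) z"
      unfolding ev_weighted_rotation[OF ab z] ef[OF rot_disc2[OF ab z]] using nz[OF z] by simp
  qed
  then show "\<exists>x. g = weighted_rotation a b w x" by blast
qed

text \<open>All functions in the range vanish at the zeros of \<open>w\<close>. With codimension at most \<open>n\<close>, some nontrivial
  combination of evaluations at \<open>n + 1\<close> zeros would vanish identically, but products of linear
  polynomials separate points.\<close>

lemma not_codim_range_le_if_infinite_zeros:
  assumes ab: "cmod a = 1" "cmod b = 1" and inf: "infinite {z\<in>disc2. ev w z = 0}"
  shows "\<not> codim_range_le (resolvent_op 0 (weighted_rotation a b w)) n"
proof
  let ?S = "resolvent_op 0 (weighted_rotation a b w)"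
  have S: "bounded_clinear ?S"
    by (intro bounded_clinear_resolvent_op bounded_clinear_weighted_rotation ab)
  assume "codim_range_le ?S n"
  then obtain B where B: "finite B" "card B \<le> n" "cspan (range ?S \<union> B) = UNIV"
    by (auto simp: codim_range_le_def)
  obtain I where I: "I \<subseteq> {z\<in>disc2. ev w z = 0}" "finite I" "card I = Suc n"
    using infinite_arbitrarily_large[OF inf] by blast
  have "card B < card I" using B I by simp
  from underdetermined_system_solution[OF B(1) I(2) this, of "\<lambda>i b. ev b i"]
  obtain c where c: "\<exists>i\<in>I. c i \<noteq> 0" "\<And>b. b \<in> B \<Longrightarrow> (\<Sum>i\<in>I. c i * ev b i) = 0" by blast
  have zero: "(\<Sum>i\<in>I. c i * ev g i) = 0" for g
  proof -
    obtain x b' where b': "b' \<in> cspan B" "g = ?S x + b'"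
      using B(3) unfolding cspan_range_Un_eq_UNIV_iff[OF S] by blast
    obtain u where u: "b' = (\<Sum>b\<in>B. u b *\<^sub>C b)"
      using b'(1) unfolding complex_vector.span_finite[OF B(1)] by blast
    have "(\<Sum>i\<in>I. c i * ev (?S x) i) = 0"
    proof (rule sum.neutral, rule ballI)
      fix i assume "i \<in> I"
      then have "i \<in> disc2" "ev w i = 0" using I(1) by blast+
      then show "c i * ev (?S x) i = 0"
        by (simp only: resolvent_op_def ev_diff ev_scaleC ev_weighted_rotation[OF ab]) simp
    qed
    moreover have "(\<Sum>i\<in>I. c i * ev b' i) = (\<Sum>b\<in>B. u b * (\<Sum>i\<in>I. c i * ev b i))"
      by (simp add: u ev_sum ev_scaleC sum_distrib_left sum.swap[of _ B] mult_ac)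
    then have "(\<Sum>i\<in>I. c i * ev b' i) = 0" using c(2) by simp
    ultimately show ?thesis by (simp add: b'(2) ev_add distrib_left sum.distrib)
  qed
  obtain j where j: "j \<in> I" "c j \<noteq> 0" using c(1) by blast
  define h where "h k z = (if fst k \<noteq> fst j then fst z - fst k else snd z - snd k)" for k z :: "complex \<times> complex"
  define g where "g = mk_bidisc (\<lambda>z. \<Prod>k\<in>I - {j}. h k z)"
  have h: "holomorphic2_on (h k) A" "continuous_on A (h k)" for k A
  proof -
    show "holomorphic2_on (h k) A"
      by (cases "fst k = fst j") (auto simp: h_def[abs_def] intro!: holomorphic2_on_diff
          holomorphic2_on_const holomorphic2_on_fst holomorphic2_on_snd)
    show "continuous_on A (h k)"
      by (cases "fst k = fst j") (auto simp: h_def[abs_def] intro!: continuous_intros)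
  qed
  have eg: "ev g z = (\<Prod>k\<in>I - {j}. h k z)" if "z \<in> disc2" for z
    unfolding g_def by (intro ev_mk_bidisc[OF _ _ that] continuous_on_prod holomorphic2_on_prod h)
  have jd: "j \<in> disc2" using I(1) j(1) by blast
  have "(\<Sum>i\<in>I - {j}. c i * ev g i) = 0"
  proof (rule sum.neutral, rule ballI)
    fix i assume i: "i \<in> I - {j}"
    then have "i \<in> disc2" using I(1) by blast
    moreover have "(\<Prod>k\<in>I - {j}. h k i) = 0"
      by (rule prod_zero) (use I(2) i in \<open>auto intro!: bexI[of _ i] simp: h_def\<close>)
    ultimately show "c i * ev g i = 0" by (simp add: eg)
  qed
  then have "c j * ev g j = 0" using zero[of g] sum.remove[OF I(2) j(1), of "\<lambda>i. c i * ev g i"] by simp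
  then have "(\<Prod>k\<in>I - {j}. h k j) = 0" using j(2) eg[OF jd] by simp
  then obtain k where "k \<in> I - {j}" "h k j = 0" using I(2) by auto
  then show False by (auto simp: h_def prod_eq_iff split: if_splits)
qed


section \<open>Orbit profiles exclude the semi-Fredholm property\<close>

text \<open>Composition with the rotation shifts the peak functions along the orbit, so the operator acts on the
  coefficients alone.\<close>

lemma resolvent_op_peak_sum:
  assumes ab: "cmod a = 1" "cmod b = 1" and y: "y 0 = 0" "y (Suc L) = 0" and z: "z \<in> disc2"
  shows "ev (resolvent_op \<mu> (weighted_rotation a b w) (peak_sum L y (\<lambda>i. rot a b i q) m)) z =
    (\<Sum>i\<le>L. (\<mu> * y i - ev w z * y (Suc i)) * peak (rot a b i q) z ^ m)"
proof -
  define f where "f i = y i * peak (rot a b i q) (rot a b 1 z) ^ m" for i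
  have "(\<Sum>i\<le>L. f i) = (\<Sum>i\<le>Suc L. f i)" using y(2) by (simp add: f_def)
  also have "\<dots> = f 0 + (\<Sum>i\<le>L. f (Suc i))" by (rule sum.atMost_Suc_shift)
  also have "\<dots> = (\<Sum>i\<le>L. y (Suc i) * peak (rot a b i q) z ^ m)"
    by (simp only: f_def peak_rot[OF ab] y(1) mult_zero_left add_0)
  finally have "ev (weighted_rotation a b w (peak_sum L y (\<lambda>i. rot a b i q) m)) z =
      ev w z * (\<Sum>i\<le>L. y (Suc i) * peak (rot a b i q) z ^ m)"
    by (simp add: ev_weighted_rotation[OF ab z] ev_peak_sum[OF rot_disc2[OF ab z]] f_def)
  then show ?thesis
    by (simp add: resolvent_op_def ev_diff ev_scaleC ev_peak_sum[OF z] sum_distrib_left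
        left_diff_distrib sum_subtractf mult.assoc)
qed

text \<open>Orbits under an irrational rotation of the first coordinate are infinite and recurrent, so every point
  of the torus is approached from outside \<open>F\<close>.\<close>

lemma norm_le_if_ev_le_off_finite:
  assumes a: "cmod a = 1" "\<And>n. n > 0 \<Longrightarrow> a ^ n \<noteq> 1" and F: "finite F"
    and le: "\<And>z. z \<in> torus2 \<Longrightarrow> z \<notin> F \<Longrightarrow> cmod (ev f z) \<le> M"
  shows "norm f \<le> M"
proof (rule norm_le_if_ev_le_torus2, rule field_le_epsilon)
  fix z :: "complex \<times> complex" and e :: real assume z: "z \<in> torus2" and e: "e > 0"
  have a1: "cmod 1 = (1::real)" by simp
  have "continuous_on torus2 (ev f)"
    by (rule continuous_on_subset[OF continuous_on_ev torus2_subset_disc2])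
  then obtain d where d: "d > 0" "\<And>z'. z' \<in> torus2 \<Longrightarrow> dist z' z < d \<Longrightarrow> dist (ev f z') (ev f z) < e"
    using z e unfolding continuous_on_iff by blast
  have "finite ((\<lambda>i. rot a 1 i z) -` F)"
    by (rule finite_vimageI[OF F inj_rot[OF a z]])
  then obtain N where N: "\<forall>i\<in>(\<lambda>i. rot a 1 i z) -` F. i < N"
    unfolding finite_nat_set_iff_bounded by blast
  obtain k where k: "k \<ge> N" "dist (rot a 1 k z) z < d"
    using rot_recurrent[OF a(1) a1 d(1), of N] z by blast
  have r1: "rot a 1 k z \<in> torus2" by (rule rot_torus2[OF a(1) a1 z])
  have r2: "rot a 1 k z \<notin> F"
  proof
    assume "rot a 1 k z \<in> F"
    then have "k < N" using N by simp
    then show False using k(1) by simp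
  qed
  from le[OF r1 r2] d(2)[OF r1 k(2)] show "cmod (ev f z) \<le> M + e"
    using norm_triangle_sub[of "ev f z" "ev f (rot a 1 k z)"] by (simp add: dist_norm norm_minus_commute)
qed

text \<open>The coefficients are twice the values of the profile, so that the norms tend to at least \<open>2\<close> and
  are eventually at least \<open>1\<close>. The errors at the orbit points are then at most \<open>\<epsilon> / 2\<close>, which leaves room for the
  rest of the torus.\<close>

lemma singular_sequence_if_profile:
  assumes ab: "cmod a = 1" "cmod b = 1" and a: "\<And>n. n > 0 \<Longrightarrow> a ^ n \<noteq> 1"
    and p: "\<exists>q L y. orbit_profile (inverse a) (inverse b) (ev w) \<mu> (\<epsilon> / 4) q L y" and \<epsilon>: "\<epsilon> > 0"
  shows "\<exists>(x :: nat \<Rightarrow> bidisc_algebra) M F. (\<forall>n. 1 \<le> norm (x n) \<and> norm (x n) \<le> M \<and>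
      norm (resolvent_op \<mu> (weighted_rotation a b w) (x n)) \<le> \<epsilon>) \<and>
      finite F \<and> (\<forall>z\<in>torus2 - F. (\<lambda>n. ev (x n) z) \<longlonglongrightarrow> 0)"
proof -
  obtain q0 L0 y0 where "orbit_profile (inverse a) (inverse b) (ev w) \<mu> (\<epsilon> / 4) q0 L0 y0" using p by blast
  from reversed_orbit_profile[OF ab this] obtain q L y where q: "q \<in> torus2"
    and y: "y 0 = 0" "y (Suc L) = 0" "\<exists>k\<le>L. cmod (y k) = 1"
    and e: "\<And>i. i \<le> L \<Longrightarrow> cmod (ev w (rot a b i q) * y (Suc i) - \<mu> * y i) \<le> \<epsilon> / 4" by blast
  define c where "c i = 2 * y i" for i
  define Q where "Q i = rot a b i q" for i
  have Q: "Q i \<in> torus2" for i unfolding Q_def by (rule rot_torus2[OF ab q])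
  have injQ: "inj Q" unfolding Q_def[abs_def] by (rule inj_rot[OF ab(1) a q])
  have c0: "c 0 = 0" "c (Suc L) = 0" using y by (auto simp: c_def)
  have hQ: "cmod (\<mu> * c i - ev w (Q i) * c (Suc i)) \<le> \<epsilon> / 2" if "i \<le> L" for i
  proof -
    have "\<mu> * c i - ev w (Q i) * c (Suc i) = - (2 * (ev w (rot a b i q) * y (Suc i) - \<mu> * y i))"
      by (simp add: c_def Q_def algebra_simps)
    then have "cmod (\<mu> * c i - ev w (Q i) * c (Suc i)) = 2 * cmod (ev w (rot a b i q) * y (Suc i) - \<mu> * y i)"
      by (simp only: norm_minus_cancel norm_mult) simp
    then show ?thesis using e[OF that] by simp
  qed
  have "\<exists>m0. \<forall>m\<ge>m0. \<forall>z\<in>torus2.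
      (\<Sum>i\<le>L. cmod (\<mu> * c i - ev w z * c (Suc i)) * cmod (peak (Q i) z) ^ m) \<le> \<epsilon>"
    by (rule eventually_peak_sum_le[where E = "\<epsilon> / 2"])
      (use Q hQ \<epsilon> inj_on_subset[OF injQ subset_UNIV] in
        \<open>auto intro!: continuous_intros continuous_on_subset[OF continuous_on_ev torus2_subset_disc2]\<close>)
  then obtain m0 where m0: "\<And>m z. m \<ge> m0 \<Longrightarrow> z \<in> torus2 \<Longrightarrow>
      (\<Sum>i\<le>L. cmod (\<mu> * c i - ev w z * c (Suc i)) * cmod (peak (Q i) z) ^ m) \<le> \<epsilon>" by blast
  have small: "norm (resolvent_op \<mu> (weighted_rotation a b w) (peak_sum L c Q m)) \<le> \<epsilon>" if "m \<ge> m0" for m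
  proof (rule norm_le_if_ev_le_torus2)
    fix z assume z: "z \<in> torus2"
    have "cmod (ev (resolvent_op \<mu> (weighted_rotation a b w) (peak_sum L c Q m)) z) \<le>
        (\<Sum>i\<le>L. cmod (\<mu> * c i - ev w z * c (Suc i)) * cmod (peak (Q i) z) ^ m)"
      unfolding Q_def[abs_def] resolvent_op_peak_sum[OF ab c0 subsetD[OF torus2_subset_disc2 z]]
      by (rule sum_norm_le) (simp add: norm_mult norm_power)
    then show "cmod (ev (resolvent_op \<mu> (weighted_rotation a b w) (peak_sum L c Q m)) z) \<le> \<epsilon>"
      using m0[OF that z] by simp
  qed
  obtain k where k: "k \<le> L" "cmod (y k) = 1" using y(3) by blast
  have "(\<lambda>m. ev (peak_sum L c Q m) (Q k)) \<longlonglongrightarrow> (\<Sum>i\<le>L. c i * (if Q k = Q i then 1 else 0))"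
    by (rule ev_peak_sum_tendsto[OF Q subsetD[OF torus2_subset_disc2 Q]])
  also have "(\<Sum>i\<le>L. c i * (if Q k = Q i then 1 else 0)) = (\<Sum>i\<le>L. if i = k then c i else 0)"
    using injQ by (intro sum.cong) (auto simp: inj_def)
  also have "\<dots> = c k" using sum.delta[of "{..L}" k c] k by simp
  finally have "(\<lambda>m. cmod (ev (peak_sum L c Q m) (Q k))) \<longlonglongrightarrow> cmod (c k)" by (rule tendsto_norm)
  moreover have "1 < cmod (c k)" using k by (simp add: c_def norm_mult)
  ultimately have "\<forall>\<^sub>F m in sequentially. 1 < cmod (ev (peak_sum L c Q m) (Q k))"
    by (rule order_tendstoD)
  then obtain m1 where m1: "\<And>m. m \<ge> m1 \<Longrightarrow> 1 < cmod (ev (peak_sum L c Q m) (Q k))"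
    by (auto simp: eventually_sequentially)
  define x where "x n = peak_sum L c Q (n + max m0 m1)" for n
  have mm: "m0 \<le> n + max m0 m1" "m1 \<le> n + max m0 m1" for n by (auto simp: le_max_iff_disj trans_le_add2)
  have "1 \<le> norm (x n)" for n
    using m1[OF mm(2)[of n]] norm_ev_le[of "x n" "Q k"] unfolding x_def by linarith
  moreover have "norm (x n) \<le> (\<Sum>i\<le>L. cmod (c i))" for n
    unfolding x_def by (rule norm_peak_sum_le[OF Q])
  moreover have "norm (resolvent_op \<mu> (weighted_rotation a b w) (x n)) \<le> \<epsilon>" for n
    unfolding x_def by (rule small[OF mm(1)])
  moreover have "(\<lambda>n. ev (x n) z) \<longlonglongrightarrow> 0" if "z \<in> torus2 - Q ` {..L}" for z
  proof -
    have "(\<lambda>m. ev (peak_sum L c Q m) z) \<longlonglongrightarrow> (\<Sum>i\<le>L. c i * (if z = Q i then 1 else 0))"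
      by (rule ev_peak_sum_tendsto[OF Q]) (use that torus2_subset_disc2 in blast)
    also have "(\<Sum>i\<le>L. c i * (if z = Q i then 1 else 0)) = 0"
      using that by (intro sum.neutral) auto
    finally show ?thesis unfolding x_def by (rule LIMSEQ_ignore_initial_segment)
  qed
  ultimately show ?thesis
    by (intro exI[of _ x] exI[of _ "\<Sum>i\<le>L. cmod (c i)"] exI[of _ "Q ` {..L}"]) simp
qed

lemma not_upper_semi_Fredholm_weighted_rotation:
  assumes ab: "cmod a = 1" "cmod b = 1" and a: "\<And>n. n > 0 \<Longrightarrow> a ^ n \<noteq> 1"
    and p: "\<And>\<epsilon>. \<epsilon> > 0 \<Longrightarrow> \<exists>q L y. orbit_profile (inverse a) (inverse b) (ev w) \<mu> \<epsilon> q L y"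
  shows "\<not> upper_semi_Fredholm (resolvent_op \<mu> (weighted_rotation a b w))"
proof (rule not_upper_semi_Fredholm_if_singular_sequence)
  show "bounded_clinear (resolvent_op \<mu> (weighted_rotation a b w))"
    by (intro bounded_clinear_resolvent_op bounded_clinear_weighted_rotation ab)
  fix \<epsilon> :: real assume \<epsilon>: "\<epsilon> > 0"
  then have "\<epsilon> / 4 > 0" by simp
  from singular_sequence_if_profile[OF ab a p[OF this] \<epsilon>]
  obtain x :: "nat \<Rightarrow> bidisc_algebra" and M F where x: "\<forall>n. 1 \<le> norm (x n) \<and> norm (x n) \<le> M \<and>
      norm (resolvent_op \<mu> (weighted_rotation a b w) (x n)) \<le> \<epsilon>"
    and F: "finite F" "\<And>z. z \<in> torus2 - F \<Longrightarrow> (\<lambda>n. ev (x n) z) \<longlonglongrightarrow> 0" by blast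
  have "norm l \<le> 1 / 2" if fr: "\<exists>\<^sub>F n in sequentially. norm (x n - l) \<le> 1 / 4" for l
  proof (rule norm_le_if_ev_le_off_finite[OF ab(1) a F(1)])
    fix z assume "z \<in> torus2" "z \<notin> F"
    then have "(\<lambda>n. cmod (ev (x n) z)) \<longlonglongrightarrow> 0" using F(2) by (intro tendsto_norm_zero) blast
    then have "\<forall>\<^sub>F n in sequentially. cmod (ev (x n) z) < 1 / 4" by (rule order_tendstoD) simp
    from frequently_eventually_frequently[OF fr this]
    obtain n where n: "norm (x n - l) \<le> 1 / 4" "cmod (ev (x n) z) < 1 / 4"
      using frequently_ex by blast
    have "cmod (ev (x n) z - ev l z) \<le> 1 / 4" using norm_ev_le[of "x n - l" z] n(1) by (simp add: ev_diff)
    then show "cmod (ev l z) \<le> 1 / 2"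
      using norm_triangle_sub[of "ev l z" "ev (x n) z"] n(2) by (simp add: norm_minus_commute)
  qed
  with x show "\<exists>(x :: nat \<Rightarrow> bidisc_algebra) M. (\<forall>n. 1 \<le> norm (x n) \<and> norm (x n) \<le> M \<and>
      norm (resolvent_op \<mu> (weighted_rotation a b w) (x n)) \<le> \<epsilon>) \<and>
      (\<forall>l. (\<exists>\<^sub>F n in sequentially. norm (x n - l) \<le> 1 / 4) \<longrightarrow> norm l \<le> 1 / 2)"
    by blast
qed

lemma approx_point_weighted_rotation:
  assumes ab: "cmod a = 1" "cmod b = 1" and a: "\<And>n. n > 0 \<Longrightarrow> a ^ n \<noteq> 1"
    and p: "\<And>\<epsilon>. \<epsilon> > 0 \<Longrightarrow> \<exists>q L y. orbit_profile (inverse a) (inverse b) (ev w) \<mu> \<epsilon> q L y"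
  shows "\<mu> \<in> approx_point_spectrum (weighted_rotation a b w)"
proof -
  let ?T = "weighted_rotation a b w"
  have T: "bounded_clinear ?T" by (rule bounded_clinear_weighted_rotation[OF ab])
  have "\<exists>f. norm f = 1 \<and> norm (?T f - \<mu> *\<^sub>C f) \<le> 1 / real (Suc n)" for n
  proof -
    have e: "1 / real (Suc n) > 0" "1 / real (Suc n) / 4 > 0" by auto
    from singular_sequence_if_profile[OF ab a p[OF e(2)] e(1)]
    obtain g where g: "1 \<le> norm g" "norm (resolvent_op \<mu> ?T g) \<le> 1 / real (Suc n)" by blast
    define f where "f = complex_of_real (1 / norm g) *\<^sub>C g"
    have "g \<noteq> 0" using g(1) by auto
    then have "norm f = 1" by (simp add: f_def norm_scaleC norm_divide)
    moreover have "?T f - \<mu> *\<^sub>C f = complex_of_real (1 / norm g) *\<^sub>C (- resolvent_op \<mu> ?T g)"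
      by (simp add: f_def resolvent_op_def bounded_clinear_scaleC[OF T] scaleC_diff_right scaleC_scaleC mult.commute)
    then have "norm (?T f - \<mu> *\<^sub>C f) = 1 / norm g * norm (resolvent_op \<mu> ?T g)"
      using \<open>g \<noteq> 0\<close> by (simp add: norm_scaleC norm_divide)
    moreover have "1 / norm g * norm (resolvent_op \<mu> ?T g) \<le> 1 * norm (resolvent_op \<mu> ?T g)"
      using g(1) \<open>g \<noteq> 0\<close> by (intro mult_right_mono) (auto simp: divide_le_eq_1)
    ultimately show ?thesis using g(2) by (intro exI[of _ f]) auto
  qed
  then have "\<forall>n. \<exists>f. norm f = 1 \<and> norm (?T f - \<mu> *\<^sub>C f) \<le> 1 / real (Suc n)" by blast
  then obtain x where x: "\<forall>n. norm (x n) = 1 \<and> norm (?T (x n) - \<mu> *\<^sub>C x n) \<le> 1 / real (Suc n)"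
    by (rule choice[THEN exE])
  have "(\<lambda>n. ?T (x n) - \<mu> *\<^sub>C x n) \<longlonglongrightarrow> 0"
    by (rule Lim_null_comparison[OF _ LIMSEQ_Suc[OF lim_1_over_n]]) (use x in auto)
  then show ?thesis using x by (auto simp: approx_point_spectrum_def)
qed

definition orbit_functional :: "complex \<Rightarrow> complex \<Rightarrow> nat \<Rightarrow> (nat \<Rightarrow> complex) \<Rightarrow> complex \<times> complex \<Rightarrow> bidisc_algebra \<Rightarrow> complex"
  where "orbit_functional a b L y q f = (\<Sum>i\<le>L. y i * ev f (rot a b i q))"

lemma orbit_functional_resolvent_op:
  assumes ab: "cmod a = 1" "cmod b = 1" and y: "y 0 = 0" "y (Suc L) = 0" and q: "q \<in> torus2"
  shows "cmod (orbit_functional a b L y q (resolvent_op \<mu> (weighted_rotation a b w) f)) \<le>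
    (\<Sum>i\<le>L. cmod (ev w (rot a b i q) * y i - \<mu> * y (Suc i))) * norm f"
proof -
  have Q: "rot a b i q \<in> disc2" for i by (rule subsetD[OF torus2_subset_disc2 rot_torus2[OF ab q]])
  have "orbit_functional a b L y q (resolvent_op \<mu> (weighted_rotation a b w) f) =
      (\<Sum>i\<le>L. \<mu> * y i * ev f (rot a b i q)) - (\<Sum>i\<le>L. ev w (rot a b i q) * y i * ev f (rot a b (Suc i) q))"
    unfolding orbit_functional_def
    by (simp add: resolvent_op_def ev_diff ev_scaleC ev_weighted_rotation[OF ab Q] rot_rot
        right_diff_distrib sum_subtractf mult_ac)
  also have "(\<Sum>i\<le>L. \<mu> * y i * ev f (rot a b i q)) = (\<Sum>i\<le>Suc L. \<mu> * y i * ev f (rot a b i q))"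
    using y(2) by simp
  also have "\<dots> = (\<Sum>i\<le>L. \<mu> * y (Suc i) * ev f (rot a b (Suc i) q))"
    by (subst sum.atMost_Suc_shift) (simp add: y(1))
  finally have "orbit_functional a b L y q (resolvent_op \<mu> (weighted_rotation a b w) f) =
      (\<Sum>i\<le>L. (\<mu> * y (Suc i) - ev w (rot a b i q) * y i) * ev f (rot a b (Suc i) q))"
    by (simp add: left_diff_distrib sum_subtractf)
  also have "cmod \<dots> \<le> (\<Sum>i\<le>L. cmod (ev w (rot a b i q) * y i - \<mu> * y (Suc i)) * norm f)"
    by (rule sum_norm_le) (auto simp: norm_mult norm_minus_commute intro!: mult_left_mono norm_ev_le)
  finally show ?thesis by (simp add: sum_distrib_right)
qed

lemma tendsto_rot_ev:
  assumes ab: "cmod a = 1" "cmod b = 1" and q: "q \<in> torus2" "\<And>m. p m \<in> torus2" "p \<longlonglongrightarrow> q"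
  shows "(\<lambda>m. ev f (rot a b i (p m))) \<longlonglongrightarrow> ev f (rot a b i q)"
proof (rule continuous_on_tendsto_compose[OF continuous_on_ev])
  show "(\<lambda>m. rot a b i (p m)) \<longlonglongrightarrow> rot a b i q"
    unfolding rot_def by (intro tendsto_intros q(3))
  show "rot a b i q \<in> disc2"
    by (rule subsetD[OF torus2_subset_disc2 rot_torus2[OF ab q(1)]])
  show "\<forall>\<^sub>F m in sequentially. rot a b i (p m) \<in> disc2"
    by (rule always_eventually, rule allI, rule subsetD[OF torus2_subset_disc2 rot_torus2[OF ab q(2)]])
qed

text \<open>The functional attached to a profile at \<open>q\<close> almost annihilates the range. So does the one
  at a nearby point \<open>p\<close>, by continuity, and the difference of both tends to zero pointwise as \<open>p\<close> tends to
  \<open>q\<close>. Its norm does not become small: the two orbit segments are disjoint if \<open>p\<close> and \<open>q\<close> differ in the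
  first coordinate only, and a peak function combination sees the first but not the second.\<close>

lemma not_lower_semi_Fredholm_weighted_rotation:
  assumes ab: "cmod a = 1" "cmod b = 1"
    and a: "\<And>n. n > 0 \<Longrightarrow> a ^ n \<noteq> 1" and b: "\<And>n. n > 0 \<Longrightarrow> b ^ n \<noteq> 1"
    and p: "\<And>\<epsilon>. \<epsilon> > 0 \<Longrightarrow> \<exists>q L y. orbit_profile a b (ev w) \<mu> \<epsilon> q L y"
  shows "\<not> lower_semi_Fredholm (resolvent_op \<mu> (weighted_rotation a b w))"
proof (rule not_lower_semi_Fredholm_if_weakly_null_functionals)
  let ?S = "resolvent_op \<mu> (weighted_rotation a b w)"
  show "bounded_clinear ?S"
    by (intro bounded_clinear_resolvent_op bounded_clinear_weighted_rotation ab)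
  fix \<epsilon> :: real assume \<epsilon>: "\<epsilon> > 0"
  (* the errors at \<open>q\<close> and at the nearby point add up to three units, and the normalisation of \<open>\<Lambda>\<close> contributes a factor \<open>4\<close> *)
  then have "\<epsilon> / 12 > 0" by simp
  from p[OF this] obtain q L y where "orbit_profile a b (ev w) \<mu> (\<epsilon> / 12) q L y" by blast
  note P = this[unfolded orbit_profile_def]
  then have q: "q \<in> torus2" and y: "y 0 = 0" "y (Suc L) = 0" "\<exists>k\<le>L. cmod (y k) = 1"
    and e: "(\<Sum>i\<le>L. cmod (ev w (rot a b i q) * y i - \<mu> * y (Suc i))) \<le> \<epsilon> / 12 * (\<Sum>i\<le>L. cmod (y i))" by auto
  define s where "s = (\<Sum>i\<le>L. cmod (y i))"
  have s: "s \<ge> 1"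
  proof -
    obtain k where "k \<le> L" "cmod (y k) = 1" using y(3) by blast
    then show ?thesis using member_le_sum[of k "{..L}" "\<lambda>i. cmod (y i)"] by (simp add: s_def)
  qed
  define err where "err q = (\<Sum>i\<le>L. cmod (ev w (rot a b i q) * y i - \<mu> * y (Suc i)))" for q
  (* the nearby points arise from \<open>q\<close> by rotating the first coordinate by powers of \<open>a\<close> close to \<open>1\<close> *)
  have "\<exists>p\<in>torus2. p \<noteq> q \<and> snd p = snd q \<and> dist p q < 1 / real (Suc m)" for m
  proof -
    obtain k where k: "k \<ge> 1" "dist (rot a 1 k q) q < 1 / real (Suc m)"
      using rot_recurrent[of a 1 "1 / real (Suc m)" 1] ab(1) q by auto
    have k1: "rot a 1 k q \<noteq> q"
    proof
      assume "rot a 1 k q = q"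
      then have "rot a 1 k q = rot a 1 0 q" by simp
      then have "k = 0" using inj_rot[OF ab(1) a q, of 1] unfolding inj_def by blast
      then show False using k(1) by simp
    qed
    have k2: "snd (rot a 1 k q) = snd q" by (simp add: rot_def)
    have k3: "rot a 1 k q \<in> torus2" by (rule rot_torus2) (use ab(1) q in auto)
    show ?thesis by (intro bexI[of _ "rot a 1 k q"] conjI k1 k2 k3 k(2))
  qed
  then have "\<forall>m. \<exists>p. p \<in> torus2 \<and> p \<noteq> q \<and> snd p = snd q \<and> dist p q < 1 / real (Suc m)" by blast
  then obtain p where "\<forall>m. p m \<in> torus2 \<and> p m \<noteq> q \<and> snd (p m) = snd q \<and> dist (p m) q < 1 / real (Suc m)"
    by (rule choice[THEN exE])
  then have p: "p m \<in> torus2" "p m \<noteq> q" "snd (p m) = snd q" "dist (p m) q < 1 / real (Suc m)" for m by auto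
  have plim: "p \<longlonglongrightarrow> q"
    by (rule tendsto_dist_iff[THEN iffD2],
        rule tendsto_sandwich[OF _ _ tendsto_const LIMSEQ_Suc[OF lim_1_over_n]])
      (use p(4) in \<open>auto intro!: always_eventually less_imp_le\<close>)
  have "(\<lambda>m. err (p m)) \<longlonglongrightarrow> err q"
    unfolding err_def by (intro tendsto_intros tendsto_rot_ev ab q p plim)
  moreover have "err q < 2 * (\<epsilon> / 12 * s)"
    using e s \<epsilon> mult_pos_pos[of "\<epsilon> / 12" s] unfolding err_def s_def by linarith
  ultimately have "\<forall>\<^sub>F m in sequentially. err (p m) < 2 * (\<epsilon> / 12 * s)" by (rule order_tendstoD)
  then obtain m0 where m0: "\<And>m. m \<ge> m0 \<Longrightarrow> err (p m) < 2 * (\<epsilon> / 12 * s)"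
    by (auto simp: eventually_sequentially)
  define p' where "p' m = p (m + m0)" for m
  have p': "p' m \<in> torus2" "p' m \<noteq> q" "snd (p' m) = snd q" "err (p' m) < 2 * (\<epsilon> / 12 * s)" for m
    using p m0 by (auto simp: p'_def)
  have p'lim: "p' \<longlonglongrightarrow> q" unfolding p'_def[abs_def] by (rule LIMSEQ_ignore_initial_segment[OF plim])
  (* normalised so that the test functions below, of norm at most \<open>1\<close>, have values tending to \<open>2\<close> *)
  define \<Lambda> where "\<Lambda> m f = of_real (4 / s) * (orbit_functional a b L y q f - orbit_functional a b L y (p' m) f)" for m f
  have nof: "cmod (orbit_functional a b L y q f) \<le> s * norm f" for q f
    unfolding orbit_functional_def s_def sum_distrib_right
    by (rule sum_norm_le) (simp add: norm_mult mult_left_mono norm_ev_le)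
  have n\<Lambda>: "cmod (\<Lambda> m f) \<le> 4 / s * (cmod (orbit_functional a b L y q f) + cmod (orbit_functional a b L y (p' m) f))" for m f
  proof -
    have "cmod (of_real (4 / s)) = 4 / s" using s by (simp only: norm_of_real) simp
    then show ?thesis unfolding \<Lambda>_def norm_mult
      using s by (simp only:) (intro mult_left_mono norm_triangle_ineq4, simp)
  qed
  have Q: "rot a b i q \<in> torus2" for i by (rule rot_torus2[OF ab q])
  have injQ: "inj (\<lambda>i. rot a b i q)" by (rule inj_rot[OF ab(1) a q])
  have apart: "rot a b i (p' m) \<noteq> rot a b j q" for i j m
  proof
    assume eq: "rot a b i (p' m) = rot a b j q"
    have "snd q \<noteq> 0" using q by auto
    then have "b ^ i = b ^ j" using eq p'(3)[of m] by (simp add: rot_def)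
    then have "i = j" using inj_power_if_not_root_of_unity[OF ab(2) b] by (simp add: inj_def)
    then have "fst (p' m) = fst q" using eq ab(1) by (auto simp: rot_def)
    then show False using p'(2,3)[of m] by (simp add: prod_eq_iff)
  qed
  have "\<exists>g. norm g \<le> 1 \<and> 1 \<le> cmod (\<Lambda> m g)" for m
  proof -
    (* the factor \<open>1 / 2\<close> leaves room for the overlap of the peaks in the bound of the norm by \<open>1\<close> *)
    define c where "c i = cnj (sgn (y i)) / 2" for i
    have c: "cmod (c i) \<le> 1 / 2" "y i * c i = cmod (y i) / 2" for i
    proof -
      show "cmod (c i) \<le> 1 / 2" by (simp add: c_def norm_divide norm_sgn)
      show "y i * c i = cmod (y i) / 2"
        by (cases "y i = 0") (auto simp: c_def sgn_eq complex_norm_square[symmetric] power2_eq_square)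
    qed
    have "\<exists>n0. \<forall>n\<ge>n0. \<forall>z\<in>torus2. (\<Sum>i\<le>L. cmod (c i) * cmod (peak (rot a b i q) z) ^ n) \<le> 1"
      by (rule eventually_peak_sum_le[where E = "1 / 2" and h = "\<lambda>i z. c i"])
        (use Q c(1) inj_on_subset[OF injQ subset_UNIV] in auto)
    then obtain n0 where n0: "\<And>n z. n \<ge> n0 \<Longrightarrow> z \<in> torus2 \<Longrightarrow>
        (\<Sum>i\<le>L. cmod (c i) * cmod (peak (rot a b i q) z) ^ n) \<le> 1" by blast
    let ?g = "peak_sum L c (\<lambda>i. rot a b i q)"
    have ng: "norm (?g n) \<le> 1" if "n \<ge> n0" for n
    proof (rule norm_le_if_ev_le_torus2)
      fix z assume z: "z \<in> torus2"
      have "cmod (ev (?g n) z) \<le> (\<Sum>i\<le>L. cmod (c i) * cmod (peak (rot a b i q) z) ^ n)"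
        unfolding ev_peak_sum[OF subsetD[OF torus2_subset_disc2 z]]
        by (rule sum_norm_le) (simp add: norm_mult norm_power)
      then show "cmod (ev (?g n) z) \<le> 1" using n0[OF that z] by simp
    qed
    have lim: "(\<lambda>n. ev (?g n) z) \<longlonglongrightarrow> (\<Sum>i\<le>L. c i * (if z = rot a b i q then 1 else 0))" if "z \<in> torus2" for z
      by (rule ev_peak_sum_tendsto[OF Q subsetD[OF torus2_subset_disc2 that]])
    have "(\<lambda>n. ev (?g n) (rot a b j q)) \<longlonglongrightarrow> c j" if "j \<le> L" for j
    proof -
      have "(\<Sum>i\<le>L. c i * (if rot a b j q = rot a b i q then 1 else 0)) = (\<Sum>i\<le>L. if i = j then c i else 0)"
        using injQ by (intro sum.cong) (auto simp: inj_def)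
      also have "\<dots> = c j" using sum.delta[of "{..L}" j c] that by simp
      finally show ?thesis using lim[OF Q[of j]] by simp
    qed
    then have "(\<lambda>n. orbit_functional a b L y q (?g n)) \<longlonglongrightarrow> (\<Sum>j\<le>L. y j * c j)"
      unfolding orbit_functional_def by (intro tendsto_sum tendsto_mult tendsto_const) auto
    moreover have "(\<lambda>n. ev (?g n) (rot a b j (p' m))) \<longlonglongrightarrow> 0" for j
      using lim[OF rot_torus2[OF ab p'(1)[of m]], of j] apart by simp
    then have "(\<lambda>n. orbit_functional a b L y (p' m) (?g n)) \<longlonglongrightarrow> (\<Sum>j\<le>L. y j * 0)"
      unfolding orbit_functional_def by (intro tendsto_sum tendsto_mult tendsto_const)
    ultimately have lim\<Lambda>: "(\<lambda>n. cmod (\<Lambda> m (?g n))) \<longlonglongrightarrow> cmod (of_real (4 / s) * ((\<Sum>j\<le>L. y j * c j) - (\<Sum>j\<le>L. y j * 0)))"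
      unfolding \<Lambda>_def by (intro tendsto_norm tendsto_mult tendsto_const tendsto_diff)
    have "(\<Sum>j\<le>L. y j * c j) = of_real (s / 2)"
      by (simp add: c(2) s_def sum_divide_distrib)
    then have "of_real (4 / s) * ((\<Sum>j\<le>L. y j * c j) - (\<Sum>j\<le>L. y j * 0)) = complex_of_real (4 / s * (s / 2))"
      by (simp only: mult_zero_right sum.neutral_const diff_zero of_real_mult)
    moreover have "4 / s * (s / 2) = 2" using s by simp
    ultimately have "cmod (of_real (4 / s) * ((\<Sum>j\<le>L. y j * c j) - (\<Sum>j\<le>L. y j * 0))) = 2"
      by (simp only: norm_of_real abs_numeral)
    with lim\<Lambda> have "(\<lambda>n. cmod (\<Lambda> m (?g n))) \<longlonglongrightarrow> 2" by (simp only:)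
    then have "\<forall>\<^sub>F n in sequentially. 1 < cmod (\<Lambda> m (?g n))" by (rule order_tendstoD) simp
    then obtain n1 where n1: "\<And>n. n \<ge> n1 \<Longrightarrow> 1 < cmod (\<Lambda> m (?g n))"
      by (auto simp: eventually_sequentially)
    show ?thesis
      using ng[of "max n0 n1"] n1[of "max n0 n1"] by (intro exI[of _ "?g (max n0 n1)"]) auto
  qed
  then have "\<forall>m. \<exists>g. norm g \<le> 1 \<and> 1 \<le> cmod (\<Lambda> m g)" by blast
  then obtain g where g: "\<forall>m. norm (g m) \<le> 1 \<and> 1 \<le> cmod (\<Lambda> m (g m))" by (rule choice[THEN exE])
  have of_add: "orbit_functional a b L y q (x + z) = orbit_functional a b L y q x + orbit_functional a b L y q z"
    for q x z by (simp add: orbit_functional_def ev_add distrib_left sum.distrib)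
  have "\<forall>m x z. \<Lambda> m (x + z) = \<Lambda> m x + \<Lambda> m z"
    unfolding \<Lambda>_def of_add by (intro allI) algebra
  moreover have "\<forall>m x. cmod (\<Lambda> m x) \<le> 8 * norm x"
  proof (intro allI)
    fix m x
    have "4 / s * (cmod (orbit_functional a b L y q x) + cmod (orbit_functional a b L y (p' m) x))
        \<le> 4 / s * (s * norm x + s * norm x)"
      using s by (intro mult_left_mono add_mono nof) auto
    also have "\<dots> = 8 * norm x" using s by (simp add: field_simps)
    finally show "cmod (\<Lambda> m x) \<le> 8 * norm x" using n\<Lambda>[of m x] by linarith
  qed
  moreover have "\<forall>x. (\<lambda>m. \<Lambda> m x) \<longlonglongrightarrow> 0"
  proof
    fix x
    have "(\<lambda>m. \<Lambda> m x) \<longlonglongrightarrow> of_real (4 / s) * (orbit_functional a b L y q x - orbit_functional a b L y q x)"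
      unfolding \<Lambda>_def orbit_functional_def
      by (intro tendsto_intros tendsto_rot_ev ab q p' p'lim)
    then show "(\<lambda>m. \<Lambda> m x) \<longlonglongrightarrow> 0" by simp
  qed
  moreover have "\<forall>m x. cmod (\<Lambda> m (?S x)) \<le> \<epsilon> * norm x"
  proof (intro allI)
    fix m x
    have 1: "cmod (orbit_functional a b L y q (?S x)) \<le> err q * norm x"
      unfolding err_def by (rule orbit_functional_resolvent_op[OF ab y(1,2) q])
    have 2: "cmod (orbit_functional a b L y (p' m) (?S x)) \<le> err (p' m) * norm x"
      unfolding err_def by (rule orbit_functional_resolvent_op[OF ab y(1,2) p'(1)])
    have "cmod (orbit_functional a b L y q (?S x)) + cmod (orbit_functional a b L y (p' m) (?S x))
        \<le> (err q + err (p' m)) * norm x" using 1 2 by (simp add: distrib_right)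
    also have "\<dots> \<le> (\<epsilon> / 12 * s + 2 * (\<epsilon> / 12 * s)) * norm x"
      using e p'(4)[of m] by (intro mult_right_mono add_mono) (auto simp: err_def s_def)
    finally have "4 / s * (cmod (orbit_functional a b L y q (?S x)) + cmod (orbit_functional a b L y (p' m) (?S x)))
        \<le> 4 / s * ((\<epsilon> / 12 * s + 2 * (\<epsilon> / 12 * s)) * norm x)"
      using s by (intro mult_left_mono) auto
    also have "\<dots> = \<epsilon> * norm x" using s by (simp add: field_simps)
    finally show "cmod (\<Lambda> m (?S x)) \<le> \<epsilon> * norm x" using n\<Lambda>[of m "?S x"] by linarith
  qed
  ultimately show "\<exists>(\<Lambda> :: nat \<Rightarrow> bidisc_algebra \<Rightarrow> complex) C g.
      (\<forall>m x y. \<Lambda> m (x + y) = \<Lambda> m x + \<Lambda> m y) \<and> (\<forall>m x. cmod (\<Lambda> m x) \<le> C * norm x) \<and>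
      (\<forall>x. (\<lambda>m. \<Lambda> m x) \<longlonglongrightarrow> 0) \<and> (\<forall>m x. cmod (\<Lambda> m (?S x)) \<le> \<epsilon> * norm x) \<and>
      (\<forall>m. norm (g m) \<le> 1 \<and> 1 \<le> cmod (\<Lambda> m (g m)))"
    using g by (intro exI[of _ \<Lambda>] exI[of _ 8] exI[of _ g]) simp
qed

text \<open>The cocycles of a rotation and of its inverse have the same values, at shifted points.\<close>

lemma orbit_profile_exists_both:
  assumes ab: "cmod a = 1" "cmod b = 1" and \<epsilon>: "\<epsilon> > 0"
    and cond: "(\<mu> = 0 \<and> (\<exists>t\<in>torus2. ev w t = 0)) \<or> (\<mu> \<noteq> 0 \<and>
      (\<forall>n. \<exists>t\<in>torus2. cmod \<mu> ^ n \<le> cocycle a b (ev w) n t) \<and>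
      (\<forall>n. \<exists>t\<in>torus2. cocycle a b (ev w) n t \<le> cmod \<mu> ^ n))"
  shows "\<exists>q L y. orbit_profile a b (ev w) \<mu> \<epsilon> q L y"
    and "\<exists>q L y. orbit_profile (inverse a) (inverse b) (ev w) \<mu> \<epsilon> q L y"
proof -
  have ab': "cmod (inverse a) = 1" "cmod (inverse b) = 1" using ab by (auto simp: norm_inverse)
  have c: "continuous_on torus2 (ev w)"
    by (rule continuous_on_subset[OF continuous_on_ev torus2_subset_disc2])
  have shift: "cocycle (inverse a) (inverse b) (ev w) n (rot a b (n - 1) t) = cocycle a b (ev w) n t" for n t
    by (simp add: cocycle_inverse[OF ab] rot_inverse(1)[OF ab])
  show "\<exists>q L y. orbit_profile a b (ev w) \<mu> \<epsilon> q L y"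
  proof (cases "\<mu> = 0")
    case True
    then obtain t where "t \<in> torus2" "ev w t = 0" using cond by blast
    from orbit_profile_at_zero[of a b t "ev w" \<epsilon>, OF ab this less_imp_le[OF \<epsilon>]] show ?thesis using True by simp
  next
    case False
    with cond show ?thesis by (intro orbit_profile_exists[OF ab c False _ _ \<epsilon>]) simp_all
  qed
  show "\<exists>q L y. orbit_profile (inverse a) (inverse b) (ev w) \<mu> \<epsilon> q L y"
  proof (cases "\<mu> = 0")
    case True
    then obtain t where "t \<in> torus2" "ev w t = 0" using cond by blast
    from orbit_profile_at_zero[of "inverse a" "inverse b" t "ev w" \<epsilon>, OF ab' this less_imp_le[OF \<epsilon>]] show ?thesis using True by simp
  next
    case False
    then have l: "\<exists>t\<in>torus2. cmod \<mu> ^ n \<le> cocycle a b (ev w) n t"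
      and s: "\<exists>t\<in>torus2. cocycle a b (ev w) n t \<le> cmod \<mu> ^ n" for n using cond by auto
    show ?thesis
    proof (rule orbit_profile_exists[OF ab' c False _ _ \<epsilon>])
      fix n
      obtain t where "t \<in> torus2" "cmod \<mu> ^ n \<le> cocycle a b (ev w) n t" using l by blast
      then show "\<exists>t\<in>torus2. cmod \<mu> ^ n \<le> cocycle (inverse a) (inverse b) (ev w) n t"
        by (intro bexI[of _ "rot a b (n - 1) t"] rot_torus2 ab) (simp only: shift)
      obtain t where "t \<in> torus2" "cocycle a b (ev w) n t \<le> cmod \<mu> ^ n" using s by blast
      then show "\<exists>t\<in>torus2. cocycle (inverse a) (inverse b) (ev w) n t \<le> cmod \<mu> ^ n"
        by (intro bexI[of _ "rot a b (n - 1) t"] rot_torus2 ab) (simp only: shift)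
    qed
  qed
qed


section \<open>The weighted rotation on the torus\<close>

text \<open>The counterpart of \<open>ev\<close> for continuous functions on the torus.\<close>

definition tv :: "(torus \<Rightarrow>\<^sub>C complex) \<Rightarrow> complex \<times> complex \<Rightarrow> complex"
  where "tv f z = apply_bcontfun f (Torus z)"

lemma apply_eq_tv: "apply_bcontfun f t = tv f (torus_pt t)"
  by (simp add: tv_def torus_pt_inverse)

lemma tv_eqI:
  assumes "\<And>z. z \<in> torus2 \<Longrightarrow> tv f z = tv g z"
  shows "f = g"
  by (rule bcontfun_eqI) (simp only: apply_eq_tv assms[OF torus_pt])

lemma norm_tv_le: "cmod (tv f z) \<le> norm f"
  by (simp add: tv_def norm_bounded)

lemma norm_le_if_tv_le:
  assumes "\<And>z. z \<in> torus2 \<Longrightarrow> cmod (tv f z) \<le> M"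
  shows "norm f \<le> M"
  by (rule norm_bound) (simp only: apply_eq_tv assms[OF torus_pt])

lemma tv_weighted_rotation_torus:
  assumes ab: "cmod a = 1" "cmod b = 1" and z: "z \<in> torus2"
  shows "tv (weighted_rotation_torus a b w f) z = ev w z * tv f (rot a b 1 z)"
proof -
  have "torus_pt (Torus z) = z" using z by (rule Torus_inverse)
  then show ?thesis
    unfolding tv_def apply_weighted_rotation_torus[OF ab] apply_restrict_torus_eq_ev
    by (simp add: rotation_torus_def rot_1_eq_rotation[symmetric, simplified])
qed

lemma tv_scaleC: "tv (c *\<^sub>C f) z = c * tv f z"
  by (simp add: tv_def scaleC_complex_def)

lemma bounded_clinear_weighted_rotation_torus:
  assumes ab: "cmod a = 1" "cmod b = 1"
  shows "bounded_clinear (weighted_rotation_torus a b w)"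
proof -
  let ?T = "weighted_rotation_torus a b w"
  have sc: "?T (c *\<^sub>C f) = c *\<^sub>C ?T f" for c f
    by (rule tv_eqI) (simp only: tv_weighted_rotation_torus[OF ab] tv_scaleC mult.left_commute)
  have "bounded_linear ?T"
  proof (rule bounded_linear_intro[where K = "norm w"])
    show "?T (f + g) = ?T f + ?T g" for f g
    proof (rule tv_eqI)
      have add: "tv (f + g) z = tv f z + tv g z" for f g z by (simp add: tv_def)
      show "tv (?T (f + g)) z = tv (?T f + ?T g) z" if "z \<in> torus2" for z
        unfolding add tv_weighted_rotation_torus[OF ab that] by (simp add: distrib_left)
    qed
    show "?T (r *\<^sub>R f) = r *\<^sub>R ?T f" for r f by (simp add: scaleR_scaleC sc)
    show "norm (?T f) \<le> norm f * norm w" for f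
    proof (rule norm_le_if_tv_le)
      fix z assume z: "z \<in> torus2"
      show "cmod (tv (?T f) z) \<le> norm f * norm w"
        using mult_mono[OF norm_tv_le[of f "rot a b 1 z"] norm_ev_le[of w z]]
        unfolding tv_weighted_rotation_torus[OF ab z] norm_mult by (simp add: mult.commute)
    qed
  qed
  then show ?thesis using sc by (simp add: bounded_clinear_def)
qed

lemma tv_weighted_rotation_torus_funpow:
  assumes ab: "cmod a = 1" "cmod b = 1" and z: "z \<in> torus2"
  shows "tv ((weighted_rotation_torus a b w ^^ n) f) z = (\<Prod>k<n. ev w (rot a b k z)) * tv f (rot a b n z)"
  using z
proof (induction n arbitrary: z)
  case (Suc n)
  have "(\<Prod>k<Suc n. ev w (rot a b k z)) = ev w z * (\<Prod>k<n. ev w (rot a b k (rot a b 1 z)))"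
    by (subst prod.lessThan_Suc_shift) (simp add: rot_rot)
  then show ?case
    using Suc.IH[OF rot_torus2[OF ab Suc.prems, of 1]]
    by (simp add: tv_weighted_rotation_torus[OF ab Suc.prems, simplified] rot_rot mult.assoc)
qed simp

lemma norm_weighted_rotation_torus_funpow_ge:
  assumes ab: "cmod a = 1" "cmod b = 1" and s: "0 < s" "\<And>t. t \<in> torus2 \<Longrightarrow> s \<le> cocycle a b (ev w) n t"
  shows "s * norm f \<le> norm ((weighted_rotation_torus a b w ^^ n) f)"
proof -
  let ?N = "norm ((weighted_rotation_torus a b w ^^ n) f)"
  have "norm f \<le> ?N / s"
  proof (rule norm_le_if_tv_le)
    fix z assume z: "z \<in> torus2"
    define t where "t = rot (inverse a) (inverse b) n z"
    have t: "t \<in> torus2" unfolding t_def by (rule rot_torus2) (use ab z in \<open>auto simp: norm_inverse\<close>)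
    have rt: "rot a b n t = z" unfolding t_def by (rule rot_inverse(2)[OF ab])
    have "s * cmod (tv f z) \<le> cocycle a b (ev w) n t * cmod (tv f (rot a b n t))"
      unfolding rt by (rule mult_right_mono[OF s(2)[OF t]]) simp
    also have "\<dots> = cmod (tv ((weighted_rotation_torus a b w ^^ n) f) t)"
      using tv_weighted_rotation_torus_funpow[OF ab t]
      by (simp add: norm_mult cocycle_def prod_norm)
    also have "\<dots> \<le> ?N" by (rule norm_tv_le)
    finally show "cmod (tv f z) \<le> ?N / s" using s(1) by (simp add: field_simps)
  qed
  then show ?thesis using s(1) by (simp add: field_simps)
qed

lemma surj_weighted_rotation_torus:
  assumes ab: "cmod a = 1" "cmod b = 1" and nz: "\<And>z. z \<in> torus2 \<Longrightarrow> ev w z \<noteq> 0"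
  shows "surj (weighted_rotation_torus a b w)"
  unfolding surj_def
proof
  fix g
  let ?r = "rot (inverse a) (inverse b) 1"
  let ?h = "\<lambda>z. inverse (ev w z) * tv g z"
  have ab': "cmod (inverse a) = 1" "cmod (inverse b) = 1" using ab by (auto simp: norm_inverse)
  have ctv: "continuous_on torus2 (tv g)"
    unfolding tv_def[abs_def] by (rule continuous_on_compose2[OF _ continuous_on_Torus, of UNIV]) auto
  have c: "continuous_on torus2 ?h"
    by (intro continuous_intros ctv continuous_on_subset[OF continuous_on_ev torus2_subset_disc2])
      (use nz in blast)
  have c': "continuous_on UNIV (\<lambda>t. ?h (?r (torus_pt t)))"
  proof (rule continuous_on_compose2[OF c])
    show "continuous_on UNIV (\<lambda>t. ?r (torus_pt t))"
      by (rule continuous_on_compose2[OF continuous_on_rot[of UNIV] continuous_on_torus_pt]) simp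
    show "range (\<lambda>t. ?r (torus_pt t)) \<subseteq> torus2"
      by (rule image_subsetI) (rule rot_torus2[OF ab' torus_pt])
  qed
  have "bounded (range (\<lambda>t. ?h (?r (torus_pt t))))"
    by (intro compact_imp_bounded compact_continuous_image c' compact_UNIV_torus)
  then have m: "(\<lambda>t. ?h (?r (torus_pt t))) \<in> bcontfun" using c' by (simp add: bcontfun_def)
  define f where "f = Bcontfun (\<lambda>t. ?h (?r (torus_pt t)))"
  have tf: "tv f z = ?h (?r z)" if "z \<in> torus2" for z
  proof -
    have "tv f z = apply_bcontfun f (Torus z)" by (rule tv_def)
    also have "\<dots> = ?h (?r z)" unfolding f_def Bcontfun_inverse[OF m] Torus_inverse[OF that] ..
    finally show ?thesis .
  qed
  have "g = weighted_rotation_torus a b w f"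
  proof (rule tv_eqI)
    fix z assume z: "z \<in> torus2"
    have "?r (rot a b 1 z) = z" by (rule rot_inverse(1)[OF ab])
    then show "tv g z = tv (weighted_rotation_torus a b w f) z"
      unfolding tv_weighted_rotation_torus[OF ab z] tf[OF rot_torus2[OF ab z]] using nz[OF z] by simp
  qed
  then show "\<exists>x. g = weighted_rotation_torus a b w x" by blast
qed

lemma tv_restrict_torus: "z \<in> torus2 \<Longrightarrow> tv (restrict_torus f) z = ev f z"
  by (simp only: tv_def apply_restrict_torus_eq_ev Torus_inverse)

lemma norm_restrict_torus: "norm (restrict_torus f) = norm f"
proof (rule antisym)
  show "norm (restrict_torus f) \<le> norm f"
    by (rule norm_le_if_tv_le) (simp only: tv_restrict_torus norm_ev_le)
  show "norm f \<le> norm (restrict_torus f)"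
    by (rule norm_le_if_ev_le_torus2) (simp only: tv_restrict_torus[symmetric] norm_tv_le)
qed

lemma resolvent_op_restrict_torus:
  assumes ab: "cmod a = 1" "cmod b = 1"
  shows "resolvent_op \<mu> (weighted_rotation_torus a b w) (restrict_torus f) =
    restrict_torus (resolvent_op \<mu> (weighted_rotation a b w) f)"
proof (rule tv_eqI)
  fix z assume z: "z \<in> torus2"
  have diff: "tv (f - g) z = tv f z - tv g z" for f g z by (simp add: tv_def)
  note zd = subsetD[OF torus2_subset_disc2 z]
  show "tv (resolvent_op \<mu> (weighted_rotation_torus a b w) (restrict_torus f)) z =
      tv (restrict_torus (resolvent_op \<mu> (weighted_rotation a b w) f)) z"
    unfolding resolvent_op_def diff tv_scaleC tv_weighted_rotation_torus[OF ab z]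
      tv_restrict_torus[OF z] tv_restrict_torus[OF rot_torus2[OF ab z]]
      ev_diff ev_scaleC ev_weighted_rotation[OF ab zd] ..
qed

text \<open>Restriction to the torus is isometric and intertwines the two operators, so approximate eigenvectors
  restrict to approximate eigenvectors.\<close>

lemma approx_point_subset_spectrum_torus:
  assumes ab: "cmod a = 1" "cmod b = 1" and ap: "\<mu> \<in> approx_point_spectrum (weighted_rotation a b w)"
  shows "\<mu> \<in> spectrum (weighted_rotation_torus a b w)"
proof (rule ccontr)
  assume "\<mu> \<notin> spectrum (weighted_rotation_torus a b w)"
  then obtain c where c: "c > 0" "\<And>f. c * norm f \<le> norm (resolvent_op \<mu> (weighted_rotation_torus a b w) f)"
    using invertible_opD(4) by (auto simp: spectrum_def)
  have "c * norm f \<le> norm (resolvent_op \<mu> (weighted_rotation a b w) f)" for f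
    using c(2)[of "restrict_torus f"] by (simp add: resolvent_op_restrict_torus[OF ab] norm_restrict_torus)
  then show False using not_approx_point_if_bounded_below[OF c(1)] ap by blast
qed


section \<open>Spectra of weighted rotations\<close>

theorem proposition4p3:
  fixes \<alpha>\<^sub>1 \<alpha>\<^sub>2 :: complex
    and w :: bidisc_algebra
    and T :: "bidisc_algebra \<Rightarrow> bidisc_algebra"
    and T' :: "(torus \<Rightarrow>\<^sub>C complex) \<Rightarrow> (torus \<Rightarrow>\<^sub>C complex)"
  assumes "\<alpha>\<^sub>1 \<in> sphere 0 1" and "\<forall>n::nat. 0 < n \<longrightarrow> \<alpha>\<^sub>1 ^ n \<noteq> 1"
    and "\<alpha>\<^sub>2 \<in> sphere 0 1" and "\<forall>n::nat. 0 < n \<longrightarrow> \<alpha>\<^sub>2 ^ n \<noteq> 1"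
    and "T = weighted_rotation \<alpha>\<^sub>1 \<alpha>\<^sub>2 w"
    and "T' = weighted_rotation_torus \<alpha>\<^sub>1 \<alpha>\<^sub>2 w"
  shows "(invertible_in_bidisc_algebra w \<longrightarrow>
           spectrum T = sf_spectrum T \<and>
           sf_spectrum T = {\<mu>. min_spectral_radius T \<le> cmod \<mu> \<and> cmod \<mu> \<le> spectral_radius T})
       \<and> (\<not> invertible_in_C_torus w \<longrightarrow>
           spectrum T = sf_spectrum T \<and>
           sf_spectrum T = (\<lambda>z. complex_of_real (spectral_radius T) * z) ` cball 0 1)
       \<and> (invertible_in_C_torus w \<and> \<not> invertible_in_bidisc_algebra w \<longrightarrow>
           approx_point_spectrum T = sf_spectrum T \<and>
           sf_spectrum T = {\<mu>. min_spectral_radius T' \<le> cmod \<mu> \<and> cmod \<mu> \<le> spectral_radius T} \<and>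
           spectrum T = lsf_spectrum T \<and>
           lsf_spectrum T = (\<lambda>z. complex_of_real (spectral_radius T) * z) ` cball 0 1)"
proof -
  have ab: "cmod \<alpha>\<^sub>1 = 1" "cmod \<alpha>\<^sub>2 = 1"
    and a: "\<And>n. n > 0 \<Longrightarrow> \<alpha>\<^sub>1 ^ n \<noteq> 1" and b: "\<And>n. n > 0 \<Longrightarrow> \<alpha>\<^sub>2 ^ n \<noteq> 1"
    using assms(1-4) by auto
  note T_def = assms(5) and T'_def = assms(6)
  have W: "continuous_on torus2 (ev w)"
    by (rule continuous_on_subset[OF continuous_on_ev torus2_subset_disc2])
  define R where "R = upper_rate \<alpha>\<^sub>1 \<alpha>\<^sub>2 (ev w)"
  define r where "r = lower_rate \<alpha>\<^sub>1 \<alpha>\<^sub>2 (ev w)"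
  have R0: "0 \<le> R" unfolding R_def by (rule upper_rate_nonneg[OF ab W])
  have r0: "0 \<le> r" unfolding r_def by (rule lower_rate_le_iff(2)[OF ab W order_refl])
  have rR: "r \<le> R" unfolding r_def R_def by (rule lower_rate_le_upper_rate[OF ab W])
  have T: "bounded_clinear T" unfolding T_def by (rule bounded_clinear_weighted_rotation[OF ab])
  have T': "bounded_clinear T'" unfolding T'_def by (rule bounded_clinear_weighted_rotation_torus[OF ab])
  note res = bounded_clinear_resolvent_op[OF T]
  have outside: "invertible_op (resolvent_op \<mu> T)" if "R < cmod \<mu>" for \<mu>
  proof -
    from above_upper_rate[OF ab W that[unfolded R_def]] obtain n s where s: "0 \<le> s" "s < cmod \<mu> ^ n"
      "\<And>t. t \<in> torus2 \<Longrightarrow> cocycle \<alpha>\<^sub>1 \<alpha>\<^sub>2 (ev w) n t \<le> s" by blast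
    show ?thesis
      by (rule invertible_resolvent_op_if_power_small[OF T s(1,2)])
        (unfold T_def, rule norm_weighted_rotation_funpow_le[OF ab s(3)])
  qed
  have inside: "\<exists>n s. cmod \<mu> ^ n < s \<and> (\<forall>f. s * norm f \<le> norm ((T ^^ n) f)) \<and>
      (\<forall>f. s * norm f \<le> norm ((T' ^^ n) f))" if "cmod \<mu> < r" for \<mu>
  proof -
    from below_lower_rate[OF ab W norm_ge_zero that[unfolded r_def]] obtain n s where s: "cmod \<mu> ^ n < s"
      "\<And>t. t \<in> torus2 \<Longrightarrow> s \<le> cocycle \<alpha>\<^sub>1 \<alpha>\<^sub>2 (ev w) n t" by blast
    have s0: "0 < s" using s(1) by (meson norm_ge_zero zero_le_power order.strict_trans1)
    show ?thesis unfolding T_def T'_def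
      using s norm_weighted_rotation_funpow_ge[OF ab s(2)] norm_weighted_rotation_torus_funpow_ge[OF ab s0 s(2)]
      by blast
  qed
  have below: "\<exists>c>0. \<forall>f. c * norm f \<le> norm (resolvent_op \<mu> T f)" if mu: "cmod \<mu> < r" for \<mu>
  proof -
    from inside[OF mu] obtain n s where s: "cmod \<mu> ^ n < s" "\<And>f. s * norm f \<le> norm ((T ^^ n) f)" by blast
    show ?thesis by (rule resolvent_op_bounded_below_if_power_large[OF T s])
  qed
  have annulus: "\<not> upper_semi_Fredholm (resolvent_op \<mu> T)" "\<not> lower_semi_Fredholm (resolvent_op \<mu> T)"
      "\<mu> \<in> approx_point_spectrum T"
    if mu: "r \<le> cmod \<mu>" "cmod \<mu> \<le> R" for \<mu>
  proof -
    have large: "\<forall>n. \<exists>t\<in>torus2. cmod \<mu> ^ n \<le> cocycle \<alpha>\<^sub>1 \<alpha>\<^sub>2 (ev w) n t"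
      using mu(2) le_upper_rate_iff[OF ab W norm_ge_zero, of \<mu>] unfolding R_def by blast
    have small: "\<forall>n. \<exists>t\<in>torus2. cocycle \<alpha>\<^sub>1 \<alpha>\<^sub>2 (ev w) n t \<le> cmod \<mu> ^ n"
      using mu(1) lower_rate_le_iff(1)[OF ab W norm_ge_zero, of \<mu>] unfolding r_def by blast
    (* the annulus reaches the origin only if the weight vanishes somewhere on the torus *)
    have "\<exists>t\<in>torus2. ev w t = 0" if "\<mu> = 0"
    proof (rule ccontr)
      assume "\<not> (\<exists>t\<in>torus2. ev w t = 0)"
      then have "0 < r" unfolding r_def using lower_rate_pos_if_no_zero[OF ab W] by blast
      then show False using mu(1) that by simp
    qed
    then have cond: "(\<mu> = 0 \<and> (\<exists>t\<in>torus2. ev w t = 0)) \<or> (\<mu> \<noteq> 0 \<and>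
      (\<forall>n. \<exists>t\<in>torus2. cmod \<mu> ^ n \<le> cocycle \<alpha>\<^sub>1 \<alpha>\<^sub>2 (ev w) n t) \<and>
      (\<forall>n. \<exists>t\<in>torus2. cocycle \<alpha>\<^sub>1 \<alpha>\<^sub>2 (ev w) n t \<le> cmod \<mu> ^ n))"
      using large small by blast
    note P = orbit_profile_exists_both[OF ab _ cond]
    show "\<not> upper_semi_Fredholm (resolvent_op \<mu> T)"
      unfolding T_def by (rule not_upper_semi_Fredholm_weighted_rotation[OF ab a P(2)])
    show "\<not> lower_semi_Fredholm (resolvent_op \<mu> T)"
      unfolding T_def by (rule not_lower_semi_Fredholm_weighted_rotation[OF ab a b P(1)])
    show "\<mu> \<in> approx_point_spectrum T"
      unfolding T_def by (rule approx_point_weighted_rotation[OF ab a P(2)])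
  qed
  have inv_lower: "lower_semi_Fredholm (resolvent_op \<mu> T)" if "invertible_op (resolvent_op \<mu> T)" for \<mu>
    using that by (rule invertible_op_imp_lower_semi_Fredholm)
  have radius: "spectral_radius T = R"
  proof (rule spectral_radius_eqI)
    show "cmod \<mu> \<le> R" if "\<mu> \<in> spectrum T" for \<mu>
      using that outside[of \<mu>] by (force simp: spectrum_def)
    show "complex_of_real R \<in> spectrum T"
      using annulus(2)[of "complex_of_real R"] inv_lower rR R0 by (auto simp: spectrum_def)
  qed (use R0 in simp)
  have case1: "spectrum T = sf_spectrum T \<and>
      sf_spectrum T = {\<mu>. min_spectral_radius T \<le> cmod \<mu> \<and> cmod \<mu> \<le> spectral_radius T}"
    if inv: "invertible_in_bidisc_algebra w"
  proof -
    have nz: "\<And>z. z \<in> disc2 \<Longrightarrow> ev w z \<noteq> 0" using inv by (auto simp: invertible_in_bidisc_algebra_iff)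
    then have rpos: "0 < r" unfolding r_def
      by (intro lower_rate_pos_if_no_zero[OF ab W]) (use torus2_subset_disc2 in blast)
    obtain c where c: "c > 0" "\<And>f. c * norm f \<le> norm (resolvent_op 0 T f)" using below[of 0] rpos by auto
    have Tinv: "invertible_op T"
      by (rule invertible_opI[OF T c(1)])
        (use c(2) surj_weighted_rotation[OF ab nz] in \<open>simp_all add: resolvent_op_0 T_def\<close>)
    have "invertible_op (resolvent_op \<mu> T)" if "cmod \<mu> < r" for \<mu>
    proof -
      from inside[OF that] obtain n s where s: "cmod \<mu> ^ n < s" "\<And>f. s * norm f \<le> norm ((T ^^ n) f)" by blast
      show ?thesis by (rule invertible_resolvent_op_if_power_large[OF T Tinv s])
    qed
    then have inv_off: "invertible_op (resolvent_op \<mu> T)" if "\<not> (r \<le> cmod \<mu> \<and> cmod \<mu> \<le> R)" for \<mu>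
      using that outside[of \<mu>] by (meson not_le)
    have spec: "spectrum T = {\<mu>. r \<le> cmod \<mu> \<and> cmod \<mu> \<le> R}"
      using inv_off annulus(2) inv_lower by (auto simp: spectrum_def)
    have sf: "sf_spectrum T = {\<mu>. r \<le> cmod \<mu> \<and> cmod \<mu> \<le> R}"
      using inv_off annulus(1,2) inv_lower by (auto simp: sf_spectrum_def semi_Fredholm_def)
    have "min_spectral_radius T = r"
      by (rule min_spectral_radius_eqI[OF T Tinv rpos, where \<mu> = "complex_of_real r"])
        (use rpos rR in \<open>auto simp: spec\<close>)
    then show ?thesis using spec sf radius by simp
  qed
  have case2: "spectrum T = sf_spectrum T \<and>
      sf_spectrum T = (\<lambda>z. complex_of_real (spectral_radius T) * z) ` cball 0 1"
    if ninv: "\<not> invertible_in_C_torus w"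
  proof -
    obtain t where "t \<in> torus2" "ev w t = 0" using ninv unfolding invertible_in_C_torus_iff by blast
    then have "r = 0" unfolding r_def by (rule lower_rate_eq_0_if_zero[OF ab W])
    then have "spectrum T = {\<mu>. cmod \<mu> \<le> R}" "sf_spectrum T = {\<mu>. cmod \<mu> \<le> R}"
      using outside annulus(1,2) inv_lower
      by (auto simp: spectrum_def sf_spectrum_def semi_Fredholm_def not_le[symmetric])
    then show ?thesis using scaled_disc[OF R0] radius by simp
  qed
  have case3: "approx_point_spectrum T = sf_spectrum T \<and>
      sf_spectrum T = {\<mu>. min_spectral_radius T' \<le> cmod \<mu> \<and> cmod \<mu> \<le> spectral_radius T} \<and>
      spectrum T = lsf_spectrum T \<and>
      lsf_spectrum T = (\<lambda>z. complex_of_real (spectral_radius T) * z) ` cball 0 1"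
    if inv: "invertible_in_C_torus w" and ninv: "\<not> invertible_in_bidisc_algebra w"
  proof -
    have nz: "\<And>z. z \<in> torus2 \<Longrightarrow> ev w z \<noteq> 0" using inv by (auto simp: invertible_in_C_torus_iff)
    have rpos: "0 < r" unfolding r_def by (rule lower_rate_pos_if_no_zero[OF ab W nz])
    obtain z where z: "z \<in> disc2" "ev w z = 0" using ninv unfolding invertible_in_bidisc_algebra_iff by blast
    have "\<not> codim_range_le (resolvent_op 0 T) n" for n
      unfolding T_def
      by (rule not_codim_range_le_if_infinite_zeros[OF ab infinite_zeros[OF z nz]])
    then have not_lower: "\<not> lower_semi_Fredholm (resolvent_op \<mu> T)" if "cmod \<mu> < r" for \<mu>
      by (intro not_lower_semi_Fredholm_on_connected[OF T open_ball connected_ball, of 0 0 r])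
        (use rpos that below in auto)
    have upper: "upper_semi_Fredholm (resolvent_op \<mu> T)" if "cmod \<mu> < r" for \<mu>
      using below[OF that] upper_semi_Fredholm_if_bounded_below[OF res] by blast
    have not_ap: "\<mu> \<notin> approx_point_spectrum T" if "\<not> (r \<le> cmod \<mu> \<and> cmod \<mu> \<le> R)" for \<mu>
    proof -
      have "\<exists>c>0. \<forall>f. c * norm f \<le> norm (resolvent_op \<mu> T f)"
        using that below[of \<mu>] invertible_opD(4)[OF outside[of \<mu>]] by (meson not_le)
      then show ?thesis using not_approx_point_if_bounded_below by blast
    qed
    have ap: "approx_point_spectrum T = {\<mu>. r \<le> cmod \<mu> \<and> cmod \<mu> \<le> R}"
      using not_ap annulus(3) by blast
    have semi: "semi_Fredholm (resolvent_op \<mu> T)" if "\<not> (r \<le> cmod \<mu> \<and> cmod \<mu> \<le> R)" for \<mu>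
      using that upper[of \<mu>] inv_lower[OF outside[of \<mu>]] unfolding semi_Fredholm_def by (meson not_le)
    have sf: "sf_spectrum T = {\<mu>. r \<le> cmod \<mu> \<and> cmod \<mu> \<le> R}"
      using semi annulus(1,2) unfolding sf_spectrum_def semi_Fredholm_def by blast
    have no: "\<not> lower_semi_Fredholm (resolvent_op \<mu> T)" if "cmod \<mu> \<le> R" for \<mu>
      using that not_lower[of \<mu>] annulus(2)[of \<mu>] by linarith
    have spec: "spectrum T = {\<mu>. cmod \<mu> \<le> R}" "lsf_spectrum T = {\<mu>. cmod \<mu> \<le> R}"
      using no outside inv_lower by (auto simp: spectrum_def lsf_spectrum_def not_le[symmetric])
    from inside[of 0] rpos obtain n s where "cmod 0 ^ n < s" "\<And>f. s * norm f \<le> norm ((T' ^^ n) f)" by auto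
    from resolvent_op_bounded_below_if_power_large[OF T' this]
    obtain c where c: "c > 0" "\<And>f. c * norm f \<le> norm (resolvent_op 0 T' f)" by blast
    have Tinv: "invertible_op T'"
      by (rule invertible_opI[OF T' c(1)])
        (use c(2) surj_weighted_rotation_torus[OF ab nz] in \<open>simp_all add: resolvent_op_0 T'_def\<close>)
    have "min_spectral_radius T' = r"
    proof (rule min_spectral_radius_eqI[OF T' Tinv rpos])
      show "complex_of_real r \<in> spectrum T'"
        unfolding T'_def
        by (rule approx_point_subset_spectrum_torus[OF ab annulus(3)[unfolded T_def]]) (use rpos rR in auto)
      fix \<mu> assume mu: "\<mu> \<in> spectrum T'"
      show "r \<le> cmod \<mu>"
      proof (rule ccontr)
        assume "\<not> r \<le> cmod \<mu>"
        then have "cmod \<mu> < r" by simp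
        from inside[OF this] obtain n s where s: "cmod \<mu> ^ n < s" "\<And>f. s * norm f \<le> norm ((T' ^^ n) f)" by blast
        have "invertible_op (resolvent_op \<mu> T')"
          by (rule invertible_resolvent_op_if_power_large[OF T' Tinv s])
        then show False using mu by (simp add: spectrum_def)
      qed
    qed (use rpos in simp)
    then show ?thesis using ap sf spec scaled_disc[OF R0] radius by simp
  qed
  show ?thesis using case1 case2 case3 by blast
qed

end
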